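(* Let $\alpha>0$ be a constant independent of $n$, let $m=\alpha n$, and let $H$ be an $m\times n$ matrix with i.i.d. standard normal components. Let $$\xi_p=\max_{x\in\{-\frac{1}{\sqrt n},\frac{1}{\sqrt n}\}^n,\ y\in\{-\frac{1}{\sqrt m},\frac{1}{\sqrt m}\}^m} y^T H x$$ and let $$\xi_p^{(u,low)}=\min_{c\ge 0}\left(\frac{c}{2}+\frac{1}{c}\log\Big(\mathrm{erfc}\Big(-\frac{c}{\sqrt 2}\Big)\Big)+\frac{\alpha}{c}\log\Big(\mathrm{erfc}\Big(-\frac{c}{\sqrt{2\alpha}}\Big)\Big)\right).$$ Then $$\frac{E\xi_p}{\sqrt n}\le \xi_p^{(u,low)}.$$ Moreover, $$\lim_{n\to\infty}P\big(\xi_p\le \sqrt n\,\xi_p^{(u,low)}\big)=1,\qquad\text{equivalently}\qquad \lim_{n\to\infty}P\big(\xi_p^2\le n\,(\xi_p^{(u,low)})^2\big)=1.$$ In particular, when $\alpha=1$, $\frac{E\xi_p}{\sqrt n}\le\xi_p^{(u,low)}$ with $\xi_p^{(u,low)}\approx 2\times 0.7688$ (the factor $0.7688$ being rounded to four decimal places).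
   Context: $\mathrm{erfc}(z)=\frac{2}{\sqrt\pi}\int_z^\infty e^{-t^2}\,dt$. The expression minimized is understood at $c=0$ as its limit for $c\to 0^+$. The limits are taken along positive integers $n$ for which $m=\alpha n$ is an integer. $P$ and $E$ denote probability and expectation. *)

theory Defs
  imports "HOL-Probability.Probability"
begin

definition erfc :: "real \<Rightarrow> real" where
  "erfc z = 2 / sqrt pi * integral {z..} (\<lambda>t. exp (- t\<^sup>2))"

definition lifted_expr :: "real \<Rightarrow> real \<Rightarrow> real" where
  "lifted_expr \<alpha> c =
     c / 2 + 1 / c * ln (erfc (- (c / sqrt 2))) + \<alpha> / c * ln (erfc (- (c / sqrt (2 * \<alpha>))))"

definition lifted_obj :: "real \<Rightarrow> real \<Rightarrow> real" where
  "lifted_obj \<alpha> c = (if c = 0 then Lim (at_right 0) (lifted_expr \<alpha>) else lifted_expr \<alpha> c)"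

(* The minimum over c \<ge> 0, as the least element of the range of the objective; that it exists
   is shown in xi_u_low_is_min below. *)
definition xi_u_low :: "real \<Rightarrow> real" where
  "xi_u_low \<alpha> = (LEAST v. v \<in> lifted_obj \<alpha> ` {0..})"

definition sign_cube :: "nat \<Rightarrow> (nat \<Rightarrow> real) set" where
  "sign_cube n = {..<n} \<rightarrow>\<^sub>E {- (1 / sqrt (real n)), 1 / sqrt (real n)}"

(* An m \<times> n matrix is a function A with entries A i j, i < m, j < n. *)
definition xi_p :: "nat \<Rightarrow> nat \<Rightarrow> (nat \<Rightarrow> nat \<Rightarrow> real) \<Rightarrow> real" where
  "xi_p m n A =
     Max ((\<lambda>(x, y). \<Sum>i<m. \<Sum>j<n. y i * A i j * x j) ` (sign_cube n \<times> sign_cube m))"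

definition iid_std_normal_matrix ::
  "'a measure \<Rightarrow> nat \<Rightarrow> nat \<Rightarrow> ('a \<Rightarrow> nat \<Rightarrow> nat \<Rightarrow> real) \<Rightarrow> bool" where
  "iid_std_normal_matrix M m n H \<longleftrightarrow>
     prob_space M \<and>
     prob_space.indep_vars M (\<lambda>_. borel) (\<lambda>(i, j) \<omega>. H \<omega> i j) ({..<m} \<times> {..<n}) \<and>
     (\<forall>i<m. \<forall>j<n. distributed M lborel (\<lambda>\<omega>. H \<omega> i j) std_normal_density)"

definition admissible :: "real \<Rightarrow> nat set" where
  "admissible \<alpha> = {n. 0 < n \<and> \<alpha> * real n \<in> \<int>}"

(* For \<alpha> > 0 and n in admissible \<alpha> this is exactly \<alpha> * n. *)
definition num_rows :: "real \<Rightarrow> nat \<Rightarrow> nat" where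
  "num_rows \<alpha> n = nat \<lfloor>\<alpha> * real n\<rfloor>"

lemma num_rows_eq:
  assumes "\<alpha> > 0" "n \<in> admissible \<alpha>"
  shows "real (num_rows \<alpha> n) = \<alpha> * real n" and "0 < num_rows \<alpha> n"
proof -
  have n: "0 < n" "\<alpha> * real n \<in> \<int>" using assms by (auto simp: admissible_def)
  obtain k :: int where k: "\<alpha> * real n = of_int k" using n(2) by (elim Ints_cases)
  have pos: "\<alpha> * real n > 0" using assms(1) n(1) by simp
  hence "k > 0" using k by simp
  thus "real (num_rows \<alpha> n) = \<alpha> * real n" by (simp add: num_rows_def k)
  thus "0 < num_rows \<alpha> n" using pos by (metis of_nat_0_less_iff)
qed

lemma sign_cube_finite: "finite (sign_cube n)"
  by (auto simp: sign_cube_def intro!: finite_PiE)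

lemma sign_cube_nonempty: "sign_cube n \<noteq> {}"
  by (simp add: sign_cube_def PiE_eq_empty_iff)

lemma integrable_Max_image:
  fixes f :: "'b \<Rightarrow> 'a \<Rightarrow> real"
  assumes "finite S" "S \<noteq> {}" "\<And>s. s \<in> S \<Longrightarrow> integrable M (f s)"
  shows "integrable M (\<lambda>\<omega>. Max ((\<lambda>s. f s \<omega>) ` S))"
  using assms
proof (induction S rule: finite_ne_induct)
  case (singleton x)
  thus ?case by simp
next
  case (insert x F)
  have "Max ((\<lambda>s. f s \<omega>) ` insert x F) = max (f x \<omega>) (Max ((\<lambda>s. f s \<omega>) ` F))" for \<omega>
    using insert by simp
  thus ?case using insert by (auto intro!: integrable_max)
qed

lemma integrable_xi_p:
  assumes "iid_std_normal_matrix M m n H"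
  shows "integrable M (\<lambda>\<omega>. xi_p m n (H \<omega>))"
proof -
  interpret prob_space M using assms by (simp add: iid_std_normal_matrix_def)
  have int: "integrable M (\<lambda>\<omega>. H \<omega> i j)" if "i < m" "j < n" for i j
  proof -
    have D: "distributed M lborel (\<lambda>\<omega>. H \<omega> i j) std_normal_density"
      using assms that by (simp add: iid_std_normal_matrix_def)
    have "integrable lborel (\<lambda>x. std_normal_density x * x)"
      using integrable_normal_moment_nz_1[of 1 0] by simp
    thus ?thesis
      using distributed_integrable[OF D, of "\<lambda>x. x"] by simp
  qed
  have "integrable M (\<lambda>\<omega>. Max ((\<lambda>s. (\<Sum>i<m. \<Sum>j<n. snd s i * H \<omega> i j * fst s j))
      ` (sign_cube n \<times> sign_cube m)))"
    by (rule integrable_Max_image)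
      (auto simp: sign_cube_finite sign_cube_nonempty int intro!: Bochner_Integration.integrable_sum
        integrable_mult_left integrable_mult_right)
  thus ?thesis by (simp add: xi_p_def case_prod_beta')
qed

lemma erfc_neg:
  assumes "z \<ge> 0"
  shows "erfc (- z) = 1 + 2 / sqrt pi * integral {0..z} (\<lambda>t. exp (- t\<^sup>2))"
proof -
  let ?f = "\<lambda>t::real. exp (- t\<^sup>2)"
  have A: "(?f has_integral sqrt pi / 2) {0..}"
  proof -
    have "((\<lambda>x. indicator {0..} x *\<^sub>R ?f x) has_integral sqrt pi / 2) UNIV"
      using has_integral_integral_lborel[OF integrable.intros[OF gaussian_moment_0]]
      unfolding has_bochner_integral_integral_eq[OF gaussian_moment_0] .
    moreover have "(\<lambda>x::real. indicator {0..} x *\<^sub>R ?f x) = (\<lambda>x. if x \<in> {0..} then ?f x else 0)"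
      by (auto simp: indicator_def)
    ultimately show ?thesis by (simp only: has_integral_restrict_UNIV)
  qed
  have "(?f has_integral integral {0..z} ?f) {0..z}"
    by (intro integrable_integral integrable_continuous_real continuous_intros)
  hence "((\<lambda>t. ?f (- t)) has_integral integral {0..z} ?f) {- z..- 0}"
    by (subst has_integral_reflect_real) simp
  hence B: "(?f has_integral integral {0..z} ?f) {- z..0}" by simp
  have "{- z..0} \<union> {0..} = {- z..}" "{- z..0} \<inter> {0..} = {0}" using assms by auto
  hence "(?f has_integral (integral {0..z} ?f + sqrt pi / 2)) {- z..}"
    using has_integral_Un[OF B A] by simp
  hence "integral {- z..} ?f = integral {0..z} ?f + sqrt pi / 2" by (rule integral_unique)
  thus ?thesis by (simp add: erfc_def field_simps)
qed

lemma erfc_0: "erfc 0 = 1"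
  using erfc_neg[of 0] by simp

lemma erfc_neg_ge_1: "z \<ge> 0 \<Longrightarrow> erfc (- z) \<ge> 1"
  by (simp add: erfc_neg integral_nonneg integrable_continuous_real continuous_intros)

lemma erfc_neg_deriv:
  assumes "z \<ge> 0"
  shows "((\<lambda>z. erfc (- z)) has_real_derivative 2 / sqrt pi * exp (- z\<^sup>2)) (at z within {0..})"
proof -
  have "((\<lambda>x. integral {0..x} (\<lambda>t. exp (- t\<^sup>2))) has_real_derivative exp (- z\<^sup>2))
          (at z within {0..z+1})"
    using assms by (intro integral_has_real_derivative continuous_intros) auto
  moreover have "at z within {0..z+1} = at z within {0..}"
    using at_within_nhd[of z "{..<z+1}" "{0..z+1}" "{0..}"] by force
  ultimately have "((\<lambda>x. 1 + 2 / sqrt pi * integral {0..x} (\<lambda>t. exp (- t\<^sup>2)))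
      has_real_derivative 0 + 2 / sqrt pi * exp (- z\<^sup>2)) (at z within {0..})"
    by (intro DERIV_add DERIV_const DERIV_cmult) simp
  hence "((\<lambda>x. 1 + 2 / sqrt pi * integral {0..x} (\<lambda>t. exp (- t\<^sup>2)))
      has_real_derivative 2 / sqrt pi * exp (- z\<^sup>2)) (at z within {0..})"
    by simp
  thus ?thesis
    using assms by (rule_tac has_field_derivative_transform_within[of _ _ _ _ 1])
      (auto simp: erfc_neg)
qed

lemma erfc_neg_continuous: "continuous_on {0..} (\<lambda>z. erfc (- z))"
  unfolding continuous_on_eq_continuous_within
proof
  fix z :: real assume "z \<in> {0..}"
  thus "continuous (at z within {0..}) (\<lambda>z. erfc (- z))"
    using DERIV_continuous[OF erfc_neg_deriv[of z]] by simp
qed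

lemma ln_erfc_limit:
  assumes "k > 0"
  shows "((\<lambda>c. ln (erfc (- (c / k))) / c) \<longlongrightarrow> 2 / (sqrt pi * k)) (at_right 0)"
proof -
  have "((\<lambda>z. ln (erfc (- z))) has_real_derivative 2 / sqrt pi) (at 0 within {0..})"
    using erfc_neg_deriv[of 0] by (auto intro!: derivative_eq_intros simp: erfc_0)
  hence "((\<lambda>z. ln (erfc (- z)) / z) \<longlongrightarrow> 2 / sqrt pi) (at_right 0)"
    by (simp add: has_field_derivative_iff erfc_0 at_within_Ici_at_right)
  moreover have "filterlim (\<lambda>c. c / k) (at_right 0) (at_right 0)"
    using filtermap_times_pos_at_right[of "1 / k" 0] assms
    by (simp add: filterlim_def times_divide_eq_left divide_inverse_commute inverse_eq_divide[symmetric])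
  ultimately have lim: "((\<lambda>c. ln (erfc (- (c / k))) / (c / k)) \<longlongrightarrow> 2 / sqrt pi) (at_right 0)"
    by (rule filterlim_compose)
  have "((\<lambda>c. ln (erfc (- (c / k))) / (c / k) / k) \<longlongrightarrow> 2 / sqrt pi / k) (at_right 0)"
    using assms by (intro tendsto_divide[OF lim tendsto_const]) simp
  thus ?thesis using assms by (simp add: mult.commute)
qed

lemma lifted_expr_limit:
  assumes "\<alpha> > 0"
  shows "(lifted_expr \<alpha> \<longlongrightarrow> lifted_obj \<alpha> 0) (at_right 0)"
proof -
  have "((\<lambda>c. c / 2 + ln (erfc (- (c / sqrt 2))) / c
        + \<alpha> * (ln (erfc (- (c / sqrt (2 * \<alpha>)))) / c))
      \<longlongrightarrow> 0 / 2 + 2 / (sqrt pi * sqrt 2) + \<alpha> * (2 / (sqrt pi * sqrt (2 * \<alpha>)))) (at_right 0)"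
    using assms by (intro tendsto_intros ln_erfc_limit) auto
  hence lim: "(lifted_expr \<alpha> \<longlongrightarrow>
      0 / 2 + 2 / (sqrt pi * sqrt 2) + \<alpha> * (2 / (sqrt pi * sqrt (2 * \<alpha>)))) (at_right 0)"
    by (simp add: lifted_expr_def[abs_def])
  thus ?thesis unfolding lifted_obj_def using tendsto_Lim[OF _ lim] by simp
qed

lemma lifted_obj_ge:
  assumes "\<alpha> > 0" "c > 0"
  shows "lifted_obj \<alpha> c \<ge> c / 2"
  using assms erfc_neg_ge_1[of "c / sqrt 2"] erfc_neg_ge_1[of "c / sqrt (2 * \<alpha>)"]
  by (simp add: lifted_obj_def lifted_expr_def)

lemma lifted_obj_continuous:
  assumes "\<alpha> > 0"
  shows "continuous_on {0..} (lifted_obj \<alpha>)"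
proof -
  have erfc_k: "continuous_on {0<..} (\<lambda>c. erfc (- (c / k)))" if "k > 0" for k
    using that by (intro continuous_on_compose2[OF erfc_neg_continuous] continuous_intros) auto
  have pos: "erfc (- (c / k)) \<noteq> 0" if "k > 0" "c > 0" for c k
    using erfc_neg_ge_1[of "c / k"] that by simp
  have "continuous_on {0<..} (lifted_expr \<alpha>)"
    unfolding lifted_expr_def[abs_def]
    using assms by (intro continuous_intros erfc_k) (auto simp: pos)
  hence cont: "continuous_on {0<..} (lifted_obj \<alpha>)"
    by (rule continuous_on_eq) (simp add: lifted_obj_def)
  show ?thesis unfolding continuous_on_eq_continuous_within
  proof
    fix c :: real assume "c \<in> {0..}"
    show "continuous (at c within {0..}) (lifted_obj \<alpha>)"
    proof (cases "c = 0")
      case True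
      have "(lifted_obj \<alpha> \<longlongrightarrow> lifted_obj \<alpha> 0) (at_right 0)"
        using lifted_expr_limit[OF assms]
        by (rule Lim_transform_eventually)
           (auto simp: eventually_at_filter lifted_obj_def)
      thus ?thesis using True
        by (simp add: continuous_within at_within_Ici_at_right)
    next
      case False
      hence "c \<in> {0<..}" using \<open>c \<in> {0..}\<close> by auto
      hence "continuous (at c) (lifted_obj \<alpha>)"
        using cont continuous_on_eq_continuous_at[OF open_greaterThan] by blast
      thus ?thesis by (rule continuous_at_imp_continuous_within)
    qed
  qed
qed

lemma xi_u_low_is_min:
  assumes "\<alpha> > 0"
  shows "\<exists>c\<ge>0. lifted_obj \<alpha> c = xi_u_low \<alpha>"
    and "c \<ge> 0 \<Longrightarrow> xi_u_low \<alpha> \<le> lifted_obj \<alpha> c"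
proof -
  define B where "B = max 1 (2 * lifted_obj \<alpha> 0)"
  have B: "{0..B} \<noteq> {}" by (simp add: B_def)
  have "continuous_on {0..B} (lifted_obj \<alpha>)"
    by (rule continuous_on_subset[OF lifted_obj_continuous[OF assms]]) auto
  then obtain a where a: "a \<in> {0..B}" "\<And>c. c \<in> {0..B} \<Longrightarrow> lifted_obj \<alpha> a \<le> lifted_obj \<alpha> c"
    using continuous_attains_inf[OF compact_Icc, of 0 B "lifted_obj \<alpha>"] B by auto
  have min: "lifted_obj \<alpha> a \<le> lifted_obj \<alpha> c" if "c \<ge> 0" for c
  proof (cases "c \<le> B")
    case True
    thus ?thesis using a that by auto
  next
    case False
    have "lifted_obj \<alpha> a \<le> lifted_obj \<alpha> 0" using a by (auto simp: B_def)
    also have "\<dots> \<le> c / 2" using False by (auto simp: B_def)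
    also have "\<dots> \<le> lifted_obj \<alpha> c" using False assms by (intro lifted_obj_ge) (auto simp: B_def)
    finally show ?thesis .
  qed
  have eq: "xi_u_low \<alpha> = lifted_obj \<alpha> a"
    unfolding xi_u_low_def by (rule Least_equality) (use a min in auto)
  show "\<exists>c\<ge>0. lifted_obj \<alpha> c = xi_u_low \<alpha>" using a eq by auto
  show "c \<ge> 0 \<Longrightarrow> xi_u_low \<alpha> \<le> lifted_obj \<alpha> c" using min eq by simp
qed

end

theory Submission
  imports Defs "HOL-Real_Asymp.Real_Asymp"
begin

text \<open>
Let \<open>\<xi>\<close> be the maximum and write \<open>R\<close>, \<open>Q\<close> for the overlaps of two sign vectors \<open>x\<close>, \<open>x'\<close> and
\<open>y\<close>, \<open>y'\<close>. Replace \<open>exp (c * sqrt n * \<xi>)\<close> by \<open>Z powr p\<close>, where \<open>Z\<close> is the partition function at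
inverse temperature \<open>\<beta> = b * sqrt n\<close> and \<open>p = c / b\<close>. Interpolating between \<open>y\<^sup>T H x\<close> and two
independent Gaussian fields \<open>h\<^sup>T x + g\<^sup>T y\<close>, Gaussian integration by parts gives
\<open>d/dt ln E (Z powr p) = - c\<^sup>2 n / 2 - n c (b - c) / 2 * \<langle>(1 - R) (1 - Q)\<rangle>\<close>. Dropping the last term is
Gordon's comparison; letting \<open>b\<close> tend to infinity and using Jensen's inequality bounds \<open>E \<xi>\<close>.

At the optimal \<open>c\<close> the resulting Chernoff bound for \<open>P (\<xi> > sqrt n * \<xi>_low)\<close> is exactly \<open>1\<close>, so an
exponential gain is needed, and it comes from the dropped term. Suppose the comparison were tight
at some fixed large \<open>b\<close>. Then lowering a field would lower \<open>E (Z powr p)\<close> exponentially, so under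
the tilted law \<open>g\<^sup>T y\<close> is large, and \<open>h\<^sup>T x\<close> is large even after weighting with \<open>1 - Q\<close>.
Integrating by parts backwards, this bounds \<open>\<langle>1 - Q\<rangle>\<close> below by a multiple of \<open>1/b\<close>, and
\<open>\<langle>(1 - Q_12) (1 - R_13)\<rangle>\<close> over three replicas below by a multiple of \<open>1/b\<^sup>2\<close>. As \<open>1 - R\<close> and
\<open>1 - Q\<close> satisfy the triangle inequality, the latter is at most \<open>8 \<langle>(1 - R) (1 - Q)\<rangle>\<close>. The
interpolation thus gains an amount of order \<open>n/b\<close>, while the softening of the maximum costs only
\<open>n/b\<^sup>2\<close>, so that a large \<open>b\<close> leaves a net gain.
\<close>


section \<open>Gaussian integration by parts\<close>

text \<open>Separate lower bounds on \<open><1 - R>\<close> and \<open><1 - Q>\<close> would not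
  suffice: the two distances could be large on disjoint sets of replica pairs, leaving
  \<open><(1 - R) (1 - Q)>\<close> near 0. Weighting the second field by \<open>1 - Q\<close> ties
  them together, at the price of a third replica. Integration by parts gives a field
  \<open>g^T y\<close> of scale \<sigma> the tilted mean
  \<open>sqrt n * \<sigma> * (c + (b - c) * <1 - Q>)\<close>. The summand \<open>c\<close> is there
  even if all replicas coincide, so only an excess over \<open>c\<close> is informative. It comes
  from erfc: lowering one field variance from 1 to U lowers the decoupled exponent per n by at least
  \<open>(c\<^sup>2 / 2 + \<kappa>) * (1 - U)\<close>. The Gaussian part
  \<open>c\<^sup>2 / 2\<close> accounts for the trivial \<open>c\<close>, and \<kappa> > 0, the
  slope of the log-erfc terms, produces the excess \<open>2 * \<mu> = \<kappa> / (2 * c)\<close>.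
  Tightness is supposed only at the pure matrix end of the path. The plain comparison carries it
  back to every earlier time, so the argument works uniformly on the first half of the path, where
  the field variances are at least 1/2. If tightness fails, that failure is already the exponential
  gain.\<close>

lemma prob_space_std_normal: "prob_space std_normal_distribution"
  by (rule prob_space_normal_density) simp

text \<open>Completing the square spends half of the Gaussian exponent on the factor
  \<open>exp (B * \<bar>x\<bar>)\<close>. Functions of this exponential growth are the class in
  which all later integrands live.\<close>

lemma exp_abs_times_std_normal_density_le:
  "exp (B * \<bar>x\<bar>) * std_normal_density x \<le> exp (B\<^sup>2) * exp (- x\<^sup>2 / 4)"
proof -
  have "(B - \<bar>x\<bar> / 2)\<^sup>2 \<ge> 0" by simp
  hence "B * \<bar>x\<bar> - x\<^sup>2 / 2 \<le> B\<^sup>2 - x\<^sup>2 / 4"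
    by (simp add: power2_diff power_divide)
  hence "exp (B * \<bar>x\<bar> - x\<^sup>2 / 2) \<le> exp (B\<^sup>2 - x\<^sup>2 / 4)" by simp
  moreover have "1 / sqrt (2 * pi) \<le> 1" using pi_gt3 by simp
  ultimately have "(1 / sqrt (2 * pi)) * exp (B * \<bar>x\<bar> - x\<^sup>2 / 2) \<le> 1 * exp (B\<^sup>2 - x\<^sup>2 / 4)"
    by (intro mult_mono) auto
  moreover have "exp (B * \<bar>x\<bar>) * std_normal_density x = (1 / sqrt (2 * pi)) * exp (B * \<bar>x\<bar> - x\<^sup>2 / 2)"
    by (simp add: std_normal_density_def diff_conv_add_uminus exp_add mult_ac del: add_uminus_conv_diff)
  moreover have "1 * exp (B\<^sup>2 - x\<^sup>2 / 4) = exp (B\<^sup>2) * exp (- x\<^sup>2 / 4)"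
    by (simp add: diff_conv_add_uminus exp_add del: add_uminus_conv_diff)
  ultimately show ?thesis by simp
qed

lemma integrable_gaussian_quarter: "integrable lborel (\<lambda>x::real. exp (- x\<^sup>2 / 4))"
proof -
  have "integrable lborel (\<lambda>x. sqrt (2 * pi * (sqrt 2)\<^sup>2) * normal_density 0 (sqrt 2) x)"
    by (intro integrable_mult_right integrable_normal_density) simp
  thus ?thesis by (simp add: normal_density_def)
qed

lemma integrable_exp_abs_std_normal: "integrable std_normal_distribution (\<lambda>x. exp (B * \<bar>x\<bar>))"
proof (subst integrable_density)
  show "integrable lborel (\<lambda>x. std_normal_density x *\<^sub>R exp (B * \<bar>x\<bar>))"
    by (rule Bochner_Integration.integrable_bound[OF integrable_mult_right[OF integrable_gaussian_quarter, of "exp (B\<^sup>2)"]])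
       (use exp_abs_times_std_normal_density_le[of B] in \<open>auto simp: mult.commute\<close>)
qed auto

text \<open>The derivative of \<open>F\<close> times the density is \<open>F' x - x * F x\<close>
  times the density, so its integral over the line is a difference of boundary values, and the
  growth bound makes both of them 0.\<close>

lemma std_normal_integration_by_parts:
  assumes deriv: "\<And>x. (F has_real_derivative F' x) (at x)"
    and cont: "\<And>x. isCont F' x"
    and F: "\<And>x. \<bar>F x\<bar> \<le> A * exp (B * \<bar>x\<bar>)"
    and F': "\<And>x. \<bar>F' x\<bar> \<le> A * exp (B * \<bar>x\<bar>)"
  shows "(\<integral>x. x * F x \<partial>std_normal_distribution) = (\<integral>x. F' x \<partial>std_normal_distribution)"
proof -
  let ?\<phi> = std_normal_density
  let ?N = std_normal_distribution
  have contF: "isCont F x" for x using deriv DERIV_isCont by blast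
  have m[measurable]: "F \<in> borel_measurable borel" "F' \<in> borel_measurable borel"
    by (auto intro!: borel_measurable_continuous_onI continuous_at_imp_continuous_on contF cont)
  have A: "A \<ge> 0" using order_trans[OF abs_ge_zero F[of 0]] by simp
  have integ: "integrable ?N G" if [measurable]: "G \<in> borel_measurable borel"
    and G: "\<And>x. \<bar>G x\<bar> \<le> A * exp (B' * \<bar>x\<bar>)" for G B'
    by (rule Bochner_Integration.integrable_bound[OF integrable_mult_right[OF integrable_exp_abs_std_normal, of A B']])
       (use G A in auto)
  have intF': "integrable ?N F'" by (rule integ[OF _ F']) measurable
  have "\<bar>x * F x\<bar> \<le> A * exp ((B + 1) * \<bar>x\<bar>)" for x
  proof -
    have "\<bar>x\<bar> \<le> exp \<bar>x\<bar>" using exp_ge_add_one_self[of "\<bar>x\<bar>"] by linarith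
    hence "\<bar>x\<bar> * \<bar>F x\<bar> \<le> exp \<bar>x\<bar> * (A * exp (B * \<bar>x\<bar>))"
      by (intro mult_mono F) auto
    thus ?thesis by (simp add: abs_mult ring_distribs exp_add mult_ac)
  qed
  hence intxF: "integrable ?N (\<lambda>x. x * F x)" by (intro integ[where B' = "B + 1"]) measurable
  define f where "f x = F' x * ?\<phi> x - x * F x * ?\<phi> x" for x
  have dphi: "(?\<phi> has_real_derivative - x * ?\<phi> x) (at x)" for x
  proof -
    have "((\<lambda>x::real. c * exp (- x\<^sup>2 / 2)) has_real_derivative - x * (c * exp (- x\<^sup>2 / 2))) (at x)" for c
      by (auto intro!: derivative_eq_intros)
    thus ?thesis unfolding std_normal_density_def .
  qed
  have d: "((\<lambda>x. F x * ?\<phi> x) has_vector_derivative f x) (at x)" for x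
    unfolding has_real_derivative_iff_has_vector_derivative[symmetric] f_def
    by (auto intro!: derivative_eq_intros deriv dphi)
  have contphi: "isCont ?\<phi> x" for x using dphi DERIV_isCont by blast
  have cf: "isCont f x" for x unfolding f_def by (intro continuous_intros cont contF contphi)
  have i1: "integrable lborel (\<lambda>x. F' x * ?\<phi> x)" and i2: "integrable lborel (\<lambda>x. x * F x * ?\<phi> x)"
    using intF' intxF by (simp_all add: integrable_density mult.commute)
  have lim: "((\<lambda>x. F x * ?\<phi> x) \<longlongrightarrow> 0) G" if G: "((\<lambda>x. A * (exp (B\<^sup>2) * exp (- x\<^sup>2 / 4))) \<longlongrightarrow> 0) G" for G
  proof (rule Lim_null_comparison[OF _ G], intro always_eventually allI)
    fix x
    have "\<bar>F x\<bar> * ?\<phi> x \<le> A * exp (B * \<bar>x\<bar>) * ?\<phi> x" by (intro mult_right_mono F) simp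
    also have "\<dots> \<le> A * (exp (B\<^sup>2) * exp (- x\<^sup>2 / 4))"
      using exp_abs_times_std_normal_density_le[of B x] A by (simp add: mult.assoc mult_left_mono)
    finally show "norm (F x * ?\<phi> x) \<le> A * (exp (B\<^sup>2) * exp (- x\<^sup>2 / 4))" by (simp add: abs_mult)
  qed
  have q: "((\<lambda>x::real. exp (- x\<^sup>2 / 4)) \<longlongrightarrow> 0) at_top" "((\<lambda>x::real. exp (- x\<^sup>2 / 4)) \<longlongrightarrow> 0) at_bot"
    by real_asymp+
  have lims: "((\<lambda>x. F x * ?\<phi> x) \<longlongrightarrow> 0) at_top" "((\<lambda>x. F x * ?\<phi> x) \<longlongrightarrow> 0) at_bot"
    using lim[OF tendsto_mult_right_zero[OF tendsto_mult_right_zero[OF q(1)]]]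
      lim[OF tendsto_mult_right_zero[OF tendsto_mult_right_zero[OF q(2)]]] by auto
  have "(LBINT x=-\<infinity>..\<infinity>. f x) = 0 - 0"
  proof (rule interval_integral_FTC_integrable[where F = "\<lambda>x. F x * ?\<phi> x"])
    show "set_integrable lborel (einterval (-\<infinity>) \<infinity>) f"
      unfolding f_def using i1 i2 by (simp add: set_integrable_def)
    show "(((\<lambda>x. F x * ?\<phi> x) \<circ> real_of_ereal) \<longlongrightarrow> 0) (at_right (-\<infinity>))"
      using lims(2) by (simp add: at_right_MInf filterlim_filtermap o_def)
    show "(((\<lambda>x. F x * ?\<phi> x) \<circ> real_of_ereal) \<longlongrightarrow> 0) (at_left \<infinity>)"
      using lims(1) by (simp add: at_left_PInf filterlim_filtermap o_def)
  qed (use d cf in auto)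
  hence "(\<integral>x. f x \<partial>lborel) = 0" by (simp add: interval_integral_to_infinity_eq interval_lebesgue_integral_def set_lebesgue_integral_def)
  hence "(\<integral>x. F' x * ?\<phi> x \<partial>lborel) = (\<integral>x. x * F x * ?\<phi> x \<partial>lborel)"
    unfolding f_def using Bochner_Integration.integral_diff[OF i1 i2] by simp
  thus "(\<integral>x. x * F x \<partial>?N) = (\<integral>x. F' x \<partial>?N)"
    by (simp add: integral_density mult.commute)
qed

section \<open>Families of independent standard normals\<close>

definition gauss :: "'k set \<Rightarrow> ('k \<Rightarrow> real) measure" where
  "gauss K = (\<Pi>\<^sub>M k\<in>K. std_normal_distribution)"

lemma sets_gauss[measurable_cong]: "sets (gauss K) = sets (\<Pi>\<^sub>M k\<in>K. borel)"
  unfolding gauss_def by (intro sets_PiM_cong) auto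

interpretation std_normal: prob_space std_normal_distribution
  by (rule prob_space_std_normal)

interpretation gauss_product: product_prob_space "\<lambda>_. std_normal_distribution" K for K
  by standard

lemma prob_space_gauss: "prob_space (gauss K)"
  unfolding gauss_def by (intro prob_space_PiM prob_space_std_normal)

lemma integrable_gauss_prod:
  fixes f :: "'k \<Rightarrow> real \<Rightarrow> real"
  assumes "finite K" "\<And>k. k \<in> K \<Longrightarrow> integrable std_normal_distribution (f k)"
  shows "integrable (gauss K) (\<lambda>g. \<Prod>k\<in>K. f k (g k))"
  unfolding gauss_def using assms by (intro gauss_product.product_integrable_prod) auto

lemma integral_gauss_prod:
  fixes f :: "'k \<Rightarrow> real \<Rightarrow> real"
  assumes "finite K" "\<And>k. k \<in> K \<Longrightarrow> integrable std_normal_distribution (f k)"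
  shows "(\<integral>g. (\<Prod>k\<in>K. f k (g k)) \<partial>gauss K) = (\<Prod>k\<in>K. \<integral>x. f k x \<partial>std_normal_distribution)"
  unfolding gauss_def using assms by (intro gauss_product.product_integral_prod) auto

lemma integrable_exp_gauss:
  assumes "finite K"
  shows "integrable (gauss K) (\<lambda>g. A * exp (B * (\<Sum>k\<in>K. \<bar>g k\<bar>)))"
  using integrable_gauss_prod[OF assms, of "\<lambda>_ x. exp (B * \<bar>x\<bar>)"] assms
  by (simp add: integrable_exp_abs_std_normal sum_distrib_left exp_sum)

lemma integrable_gauss_bound:
  fixes G :: "('k \<Rightarrow> real) \<Rightarrow> real"
  assumes "finite K" "G \<in> borel_measurable (gauss K)"
    "\<And>g. \<bar>G g\<bar> \<le> A * exp (B * (\<Sum>k\<in>K. \<bar>g k\<bar>))"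
  shows "integrable (gauss K) G"
  by (rule Bochner_Integration.integrable_bound[OF integrable_exp_gauss[OF assms(1), of A B]])
     (use assms in \<open>auto intro: order_trans[OF _ abs_ge_self]\<close>)

lemma sum_abs_fun_upd_notin:
  fixes g :: "'k \<Rightarrow> real"
  assumes "finite J" "k \<notin> J"
  shows "(\<Sum>i\<in>insert k J. \<bar>(g(k := x)) i\<bar>) = \<bar>x\<bar> + (\<Sum>i\<in>J. \<bar>g i\<bar>)"
  using assms by (auto intro!: sum.cong)

text \<open>Fubini splits off the coordinate \<open>k\<close>. In the inner integral the other
  coordinates are frozen and only change the constant in front of the exponential bound.\<close>

lemma gauss_integration_by_parts:
  fixes G G' :: "('k \<Rightarrow> real) \<Rightarrow> real"
  assumes K: "finite K" "k \<in> K"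
    and [measurable]: "G \<in> borel_measurable (gauss K)" "G' \<in> borel_measurable (gauss K)"
    and deriv: "\<And>g x. ((\<lambda>x. G (g(k := x))) has_real_derivative G' (g(k := x))) (at x)"
    and cont: "\<And>g x. isCont (\<lambda>x. G' (g(k := x))) x"
    and G: "\<And>g. \<bar>G g\<bar> \<le> A * exp (B * (\<Sum>k\<in>K. \<bar>g k\<bar>))"
    and G': "\<And>g. \<bar>G' g\<bar> \<le> A * exp (B * (\<Sum>k\<in>K. \<bar>g k\<bar>))"
  shows "(\<integral>g. g k * G g \<partial>gauss K) = (\<integral>g. G' g \<partial>gauss K)"
    and "integrable (gauss K) (\<lambda>g. g k * G g)"
proof -
  define J where "J = K - {k}"
  have J: "finite J" "k \<notin> J" "K = insert k J" using K by (auto simp: J_def)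
  have A: "A \<ge> 0" using order_trans[OF abs_ge_zero G[of "\<lambda>_. 0"]] by simp
  show int1: "integrable (gauss K) (\<lambda>g. g k * G g)"
  proof (rule integrable_gauss_bound[OF K(1)])
    have "(\<lambda>g. g k) \<in> borel_measurable (gauss K)" using K(2) by measurable
    thus "(\<lambda>g. g k * G g) \<in> borel_measurable (gauss K)" by measurable
    fix g :: "'k \<Rightarrow> real"
    let ?s = "\<Sum>k\<in>K. \<bar>g k\<bar>"
    have "\<bar>g k\<bar> \<le> ?s" using K by (intro member_le_sum) auto
    also have "?s \<le> exp ?s" using exp_ge_add_one_self[of ?s] by linarith
    finally have "\<bar>g k\<bar> * \<bar>G g\<bar> \<le> exp ?s * (A * exp (B * ?s))" by (intro mult_mono G) auto
    thus "\<bar>g k * G g\<bar> \<le> A * exp ((B + 1) * ?s)" by (simp add: abs_mult ring_distribs exp_add mult_ac)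
  qed
  have int2: "integrable (gauss K) G'" by (rule integrable_gauss_bound[OF K(1) _ G']) measurable
  have "(\<integral>g. g k * G g \<partial>gauss K) = (\<integral>g. (\<integral>x. x * G (g(k := x)) \<partial>std_normal_distribution) \<partial>gauss J)"
    using gauss_product.product_integral_insert[OF J(1,2) int1[unfolded gauss_def J(3)]]
    by (simp add: gauss_def J(3)[symmetric])
  also have "\<dots> = (\<integral>g. (\<integral>x. G' (g(k := x)) \<partial>std_normal_distribution) \<partial>gauss J)"
  proof (rule Bochner_Integration.integral_cong[OF refl])
    fix g :: "'k \<Rightarrow> real"
    let ?A = "A * exp (B * (\<Sum>i\<in>J. \<bar>g i\<bar>))"
    have b: "A * exp (B * (\<Sum>i\<in>K. \<bar>(g(k := x)) i\<bar>)) = ?A * exp (B * \<bar>x\<bar>)" for x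
      by (simp only: J(3) sum_abs_fun_upd_notin[OF J(1,2)] ring_distribs exp_add) simp
    show "(\<integral>x. x * G (g(k := x)) \<partial>std_normal_distribution) = (\<integral>x. G' (g(k := x)) \<partial>std_normal_distribution)"
      by (rule std_normal_integration_by_parts[OF deriv cont, where A = ?A and B = B])
         (use G[of "g(k := _)"] G'[of "g(k := _)"] b in metis)+
  qed
  also have "\<dots> = (\<integral>g. G' g \<partial>gauss K)"
    using gauss_product.product_integral_insert[OF J(1,2) int2[unfolded gauss_def J(3)]]
    by (simp add: gauss_def J(3)[symmetric])
  finally show "(\<integral>g. g k * G g \<partial>gauss K) = (\<integral>g. G' g \<partial>gauss K)" .
qed

text \<open>By the mean value inequality the bound \<open>w\<close> on the derivative also bounds
  every difference quotient, so dominated convergence applies along each sequence tending to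
  \<open>t\<close>.\<close>

lemma has_real_derivative_integral:
  fixes f f' :: "real \<Rightarrow> 'a \<Rightarrow> real"
  assumes t: "l < t" "t < r"
    and deriv: "\<And>s x. \<lbrakk>l < s; s < r; x \<in> space M\<rbrakk> \<Longrightarrow> ((\<lambda>s. f s x) has_real_derivative f' s x) (at s)"
    and bound: "\<And>s x. \<lbrakk>l < s; s < r; x \<in> space M\<rbrakk> \<Longrightarrow> \<bar>f' s x\<bar> \<le> w x"
    and w: "integrable M w"
    and f: "\<And>s. \<lbrakk>l < s; s < r\<rbrakk> \<Longrightarrow> integrable M (f s)"
    and f'[measurable]: "f' t \<in> borel_measurable M"
  shows "((\<lambda>s. \<integral>x. f s x \<partial>M) has_real_derivative (\<integral>x. f' t x \<partial>M)) (at t)"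
  unfolding has_field_derivative_iff tendsto_at_iff_sequentially comp_def
proof (intro allI impI)
  fix X :: "nat \<Rightarrow> real" assume X: "\<forall>i. X i \<in> UNIV - {t}" "X \<longlonglongrightarrow> t"
  have "eventually (\<lambda>i. X i \<in> {l<..<r}) sequentially"
    using X(2) t by (intro topological_tendstoD) auto
  then obtain n0 where n0: "\<And>i. i \<ge> n0 \<Longrightarrow> X i \<in> {l<..<r}" by (auto simp: eventually_sequentially)
  \<comment> \<open>Only a tail of \<open>X\<close> has to lie in the interval where derivative and
    bound are available.\<close>
  define Y where "Y i = X (i + n0)" for i
  have Y: "Y i \<noteq> t" "l < Y i" "Y i < r" for i using X(1) n0[of "i + n0"] by (auto simp: Y_def)
  have Ylim: "Y \<longlonglongrightarrow> t" unfolding Y_def using X(2) by (rule LIMSEQ_ignore_initial_segment)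
  have "(\<lambda>i. \<integral>x. (f (Y i) x - f t x) / (Y i - t) \<partial>M) \<longlonglongrightarrow> (\<integral>x. f' t x \<partial>M)"
  proof (rule integral_dominated_convergence[where w = w])
    show "(\<lambda>x. (f (Y i) x - f t x) / (Y i - t)) \<in> borel_measurable M" for i
      using f[OF Y(2,3)] f[OF t] by measurable
    show "AE x in M. (\<lambda>i. (f (Y i) x - f t x) / (Y i - t)) \<longlonglongrightarrow> f' t x"
    proof (rule AE_I2)
      fix x assume x: "x \<in> space M"
      show "(\<lambda>i. (f (Y i) x - f t x) / (Y i - t)) \<longlonglongrightarrow> f' t x"
        using deriv[OF t x] Y Ylim
        unfolding has_field_derivative_iff tendsto_at_iff_sequentially comp_def by auto
    qed
    show "AE x in M. norm ((f (Y i) x - f t x) / (Y i - t)) \<le> w x" for i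
    proof (rule AE_I2)
      fix x assume x: "x \<in> space M"
      have "norm (f (Y i) x - f t x) \<le> w x * norm (Y i - t)"
        by (rule field_differentiable_bound[where S = "{l<..<r}" and f' = "\<lambda>s. f' s x"])
           (use deriv x bound Y t in \<open>auto intro: has_field_derivative_at_within\<close>)
      thus "norm ((f (Y i) x - f t x) / (Y i - t)) \<le> w x"
        using Y(1)[of i] by (simp add: field_simps)
    qed
  qed (use w in auto)
  also have "(\<lambda>i. \<integral>x. (f (Y i) x - f t x) / (Y i - t) \<partial>M)
      = (\<lambda>i. ((\<integral>x. f (Y i) x \<partial>M) - (\<integral>x. f t x \<partial>M)) / (Y i - t))"
    using f Y t by (subst integral_divide_zero) (simp add: Bochner_Integration.integral_diff)
  finally show "(\<lambda>i. ((\<integral>x. f (X i) x \<partial>M) - (\<integral>x. f t x \<partial>M)) / (X i - t)) \<longlonglongrightarrow> (\<integral>x. f' t x \<partial>M)"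
    unfolding Y_def by (rule LIMSEQ_offset)
qed

section \<open>Gibbs averages with Gaussian disorder\<close>

text \<open>Jensen's inequality for the concave power \<open>p\<close>, by averaging the tangent
  line at the mean. The tangent inequality itself is Young's inequality with second factor
  1.\<close>

lemma sum_power_mean_le:
  fixes q w :: "'s \<Rightarrow> real"
  assumes q: "\<And>s. s \<in> S \<Longrightarrow> 0 \<le> q s" "sum q S = 1"
    and w: "\<And>s. s \<in> S \<Longrightarrow> 0 < w s" and p: "0 < p" "p \<le> 1"
  shows "(\<Sum>s\<in>S. q s * w s powr p) \<le> (\<Sum>s\<in>S. q s * w s) powr p"
proof -
  define m where "m = (\<Sum>s\<in>S. q s * w s)"
  have fin: "finite S" using q(2) by (rule_tac ccontr) simp
  obtain s0 where s0: "s0 \<in> S" "q s0 \<noteq> 0" using q(2) by (metis sum.neutral zero_neq_one)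
  have "0 < q s0 * w s0" using s0 q(1) w by (simp add: order_less_le)
  also have "\<dots> \<le> m" unfolding m_def
    using s0 q w fin by (intro member_le_sum) (auto intro: mult_nonneg_nonneg less_imp_le)
  finally have m: "m > 0" .
  have tangent: "w s powr p \<le> m powr p * (1 + p * (w s / m - 1))" if "s \<in> S" for s
  proof -
    have "(w s / m) powr p * 1 powr (1 - p) \<le> p * (w s / m) + (1 - p) * 1"
      using p w[OF that] m by (intro Youngs_inequality_0) auto
    hence "(w s / m) powr p \<le> 1 + p * (w s / m - 1)" by (simp add: algebra_simps)
    moreover have "w s powr p = m powr p * (w s / m) powr p"
      using m w[OF that] by (simp add: powr_divide)
    ultimately show ?thesis by (simp add: mult_left_mono)
  qed
  have "(\<Sum>s\<in>S. q s * w s powr p) \<le> (\<Sum>s\<in>S. q s * (m powr p * (1 + p * (w s / m - 1))))"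
    by (intro sum_mono mult_left_mono tangent q)
  also have "\<dots> = m powr p * ((1 - p) * sum q S + p / m * (\<Sum>s\<in>S. q s * w s))"
    by (simp add: sum_distrib_left sum.distrib[symmetric] algebra_simps)
  also have "\<dots> = m powr p" using m q(2) by (simp add: m_def[symmetric])
  finally show ?thesis by (simp add: m_def)
qed

text \<open>The energy of a configuration \<open>s\<close> is linear in the Gaussian coordinates
  \<open>k\<close>, with feature \<open>v s k\<close> and a scale \<open>a k\<close> that is varied
  later. The bound on \<open>v\<close> keeps \<open>Z powr p\<close> below an exponential of the sum
  of the absolute coordinates; \<open>p \<le> 1\<close> makes the power concave.\<close>

locale gibbs =
  fixes S :: "'s set" and K :: "'k set" and v :: "'s \<Rightarrow> 'k \<Rightarrow> real" and \<beta> p :: real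
  assumes finite_S: "finite S" and S_ne: "S \<noteq> {}" and finite_K: "finite K"
    and v_le: "\<And>s k. \<lbrakk>s \<in> S; k \<in> K\<rbrakk> \<Longrightarrow> \<bar>v s k\<bar> \<le> 1"
    and \<beta>_pos: "0 < \<beta>" and p_pos: "0 < p" and p_le: "p \<le> 1"
begin

definition wt :: "('k \<Rightarrow> real) \<Rightarrow> ('k \<Rightarrow> real) \<Rightarrow> 's \<Rightarrow> real" where
  "wt a g s = exp (\<beta> * (\<Sum>k\<in>K. a k * g k * v s k))"

definition Z :: "('k \<Rightarrow> real) \<Rightarrow> ('k \<Rightarrow> real) \<Rightarrow> real" where
  "Z a g = (\<Sum>s\<in>S. wt a g s)"

definition q :: "('k \<Rightarrow> real) \<Rightarrow> ('k \<Rightarrow> real) \<Rightarrow> 's \<Rightarrow> real" where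
  "q a g s = wt a g s / Z a g"

definition D :: "('k \<Rightarrow> real) \<Rightarrow> real" where
  "D a = (\<integral>g. Z a g powr p \<partial>gauss K)"

text \<open>Up to the factor \<open>D a\<close>, this is the average over two independent replicas
  when the law of \<open>g\<close> is tilted by \<open>Z powr p\<close>. Left unnormalised it is
  linear in \<open>W\<close> and appears directly in the derivative of \<open>D\<close>.\<close>

definition avg2 :: "('k \<Rightarrow> real) \<Rightarrow> ('s \<Rightarrow> 's \<Rightarrow> real) \<Rightarrow> real" where
  "avg2 a W = (\<integral>g. Z a g powr p * (\<Sum>s\<in>S. \<Sum>r\<in>S. q a g s * q a g r * W s r) \<partial>gauss K)"

definition avg3 :: "('k \<Rightarrow> real) \<Rightarrow> ('s \<Rightarrow> 's \<Rightarrow> 's \<Rightarrow> real) \<Rightarrow> real" where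
  "avg3 a W = (\<integral>g. Z a g powr p * (\<Sum>s\<in>S. \<Sum>r\<in>S. \<Sum>u\<in>S. q a g s * q a g r * q a g u * W s r u) \<partial>gauss K)"

lemma Z_pos: "Z a g > 0"
  unfolding Z_def using finite_S S_ne by (intro sum_pos) (auto simp: wt_def)

lemma q_nonneg: "q a g s \<ge> 0"
  using Z_pos[of a g] by (simp add: q_def wt_def)

lemma sum_q: "(\<Sum>s\<in>S. q a g s) = 1"
  using Z_pos[of a g] by (simp add: q_def sum_divide_distrib[symmetric] Z_def[symmetric])

lemma q_le_1: "s \<in> S \<Longrightarrow> q a g s \<le> 1"
  using member_le_sum[of s S "q a g"] q_nonneg finite_S by (simp add: sum_q)

lemma wt_measurable[measurable]: "(\<lambda>g. wt a g s) \<in> borel_measurable (gauss K)"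
  unfolding wt_def by measurable

lemma Z_measurable[measurable]: "Z a \<in> borel_measurable (gauss K)"
  unfolding Z_def by measurable

lemma q_measurable[measurable]: "(\<lambda>g. q a g s) \<in> borel_measurable (gauss K)"
  unfolding q_def by measurable

lemma Z_le:
  assumes "\<And>k. k \<in> K \<Longrightarrow> \<bar>a k\<bar> \<le> B"
  shows "Z a g \<le> real (card S) * exp (\<beta> * B * (\<Sum>k\<in>K. \<bar>g k\<bar>))"
proof -
  have "wt a g s \<le> exp (\<beta> * B * (\<Sum>k\<in>K. \<bar>g k\<bar>))" if s: "s \<in> S" for s
  proof -
    have "a k * g k * v s k \<le> B * \<bar>g k\<bar>" if k: "k \<in> K" for k
    proof -
      have B: "B \<ge> 0" using assms[OF k] by simp
      have "a k * g k * v s k \<le> \<bar>a k\<bar> * \<bar>g k\<bar> * \<bar>v s k\<bar>" by (simp add: abs_mult[symmetric])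
      also have "\<dots> \<le> B * \<bar>g k\<bar> * 1"
        by (intro mult_mono assms v_le k s) (use B in auto)
      finally show ?thesis by simp
    qed
    hence "(\<Sum>k\<in>K. a k * g k * v s k) \<le> B * (\<Sum>k\<in>K. \<bar>g k\<bar>)"
      unfolding sum_distrib_left by (rule sum_mono)
    thus ?thesis unfolding wt_def using \<beta>_pos by simp
  qed
  thus ?thesis unfolding Z_def by (rule sum_bounded_above)
qed

lemma Z_powr_le:
  assumes "\<And>k. k \<in> K \<Longrightarrow> \<bar>a k\<bar> \<le> B"
  shows "Z a g powr p \<le> real (card S) powr p * exp (\<beta> * B * p * (\<Sum>k\<in>K. \<bar>g k\<bar>))"
proof -
  have "Z a g powr p \<le> (real (card S) * exp (\<beta> * B * (\<Sum>k\<in>K. \<bar>g k\<bar>))) powr p"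
    using Z_le[of a B g] assms Z_pos[of a g] p_pos by (intro powr_mono2) auto
  thus ?thesis by (simp add: powr_mult exp_powr_real mult_ac)
qed

lemma coeff_le: "k \<in> K \<Longrightarrow> \<bar>a k\<bar> \<le> (\<Sum>k\<in>K. \<bar>a k\<bar>)" for a :: "'k \<Rightarrow> real"
  using finite_K by (intro member_le_sum) auto

lemma integrable_Z_powr_mult:
  assumes [measurable]: "F \<in> borel_measurable (gauss K)" and F: "\<And>g. \<bar>F g\<bar> \<le> B"
  shows "integrable (gauss K) (\<lambda>g. Z a g powr p * F g)"
proof (rule integrable_gauss_bound[OF finite_K])
  let ?B = "\<Sum>k\<in>K. \<bar>a k\<bar>"
  fix g :: "'k \<Rightarrow> real"
  have "B \<ge> 0" using order_trans[OF abs_ge_zero F[of g]] .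
  hence "Z a g powr p * \<bar>F g\<bar> \<le> real (card S) powr p * exp (\<beta> * ?B * p * (\<Sum>k\<in>K. \<bar>g k\<bar>)) * B"
    by (intro mult_mono Z_powr_le F coeff_le) auto
  thus "\<bar>Z a g powr p * F g\<bar> \<le> (real (card S) powr p * B) * exp ((\<beta> * ?B * p) * (\<Sum>k\<in>K. \<bar>g k\<bar>))"
    by (simp add: abs_mult mult_ac)
qed measurable

lemma integrable_Z_powr: "integrable (gauss K) (\<lambda>g. Z a g powr p)"
  using integrable_Z_powr_mult[of "\<lambda>_. 1" 1 a] by simp

lemma qq_bound: "\<bar>\<Sum>s\<in>S. \<Sum>r\<in>S. q a g s * q a g r * W s r\<bar> \<le> (\<Sum>s\<in>S. \<Sum>r\<in>S. \<bar>W s r\<bar>)"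
proof (intro order_trans[OF sum_abs] sum_mono)
  fix s r assume "s \<in> S" "r \<in> S"
  hence "q a g s * q a g r * \<bar>W s r\<bar> \<le> 1 * 1 * \<bar>W s r\<bar>"
    by (intro mult_mono q_le_1 q_nonneg mult_nonneg_nonneg) auto
  thus "\<bar>q a g s * q a g r * W s r\<bar> \<le> \<bar>W s r\<bar>" by (simp add: abs_mult q_nonneg)
qed

lemma qqq_bound: "\<bar>\<Sum>s\<in>S. \<Sum>r\<in>S. \<Sum>u\<in>S. q a g s * q a g r * q a g u * W s r u\<bar>
    \<le> (\<Sum>s\<in>S. \<Sum>r\<in>S. \<Sum>u\<in>S. \<bar>W s r u\<bar>)"
proof (intro order_trans[OF sum_abs] sum_mono)
  fix s r u assume "s \<in> S" "r \<in> S" "u \<in> S"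
  hence "q a g s * q a g r * q a g u * \<bar>W s r u\<bar> \<le> 1 * 1 * 1 * \<bar>W s r u\<bar>"
    by (intro mult_mono q_le_1 q_nonneg mult_nonneg_nonneg) auto
  thus "\<bar>q a g s * q a g r * q a g u * W s r u\<bar> \<le> \<bar>W s r u\<bar>" by (simp add: abs_mult q_nonneg)
qed

lemma integrable_avg2:
  "integrable (gauss K) (\<lambda>g. Z a g powr p * (\<Sum>s\<in>S. \<Sum>r\<in>S. q a g s * q a g r * W s r))"
  by (rule integrable_Z_powr_mult[OF _ qq_bound]) measurable

lemma integrable_avg3:
  "integrable (gauss K) (\<lambda>g. Z a g powr p * (\<Sum>s\<in>S. \<Sum>r\<in>S. \<Sum>u\<in>S. q a g s * q a g r * q a g u * W s r u))"
  by (rule integrable_Z_powr_mult[OF _ qqq_bound]) measurable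

lemma D_pos: "D a > 0"
proof -
  interpret G: prob_space "gauss K" by (rule prob_space_gauss)
  have "D a \<noteq> 0"
    unfolding D_def
    using integrable_Z_powr[of a] integral_nonneg_eq_0_iff_AE[of "gauss K" "\<lambda>g. Z a g powr p"] Z_pos
    by (simp add: less_imp_neq[OF Z_pos, symmetric] G.AE_False)
  moreover have "D a \<ge> 0" unfolding D_def by simp
  ultimately show ?thesis by simp
qed

section \<open>Algebra of replica averages\<close>

lemma avg2_const: "avg2 a (\<lambda>s r. c) = c * D a"
  unfolding avg2_def D_def
  by (simp add: sum_distrib_left[symmetric] sum_distrib_right[symmetric] sum_q mult.commute)

lemma avg2_add: "avg2 a (\<lambda>s r. U s r + W s r) = avg2 a U + avg2 a W"
  unfolding avg2_def
  by (simp add: ring_distribs sum.distrib integrable_avg2)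

lemma avg2_cmult: "avg2 a (\<lambda>s r. c * W s r) = c * avg2 a W"
proof -
  have "(\<Sum>s\<in>S. \<Sum>r\<in>S. q a g s * q a g r * (c * W s r)) = c * (\<Sum>s\<in>S. \<Sum>r\<in>S. q a g s * q a g r * W s r)" for g
    by (simp add: sum_distrib_left mult_ac)
  thus ?thesis unfolding avg2_def by (simp add: mult.left_commute)
qed

lemma avg2_sum: "finite J \<Longrightarrow> avg2 a (\<lambda>s r. \<Sum>k\<in>J. W k s r) = (\<Sum>k\<in>J. avg2 a (W k))"
  by (induction J rule: finite_induct) (simp_all add: avg2_add avg2_const[of a 0, simplified])

lemma avg2_cong: "(\<And>s r. \<lbrakk>s \<in> S; r \<in> S\<rbrakk> \<Longrightarrow> U s r = W s r) \<Longrightarrow> avg2 a U = avg2 a W"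
  unfolding avg2_def by (intro Bochner_Integration.integral_cong refl arg_cong2[where f = "(*)"] sum.cong) auto

lemma avg2_mono: "(\<And>s r. \<lbrakk>s \<in> S; r \<in> S\<rbrakk> \<Longrightarrow> U s r \<le> W s r) \<Longrightarrow> avg2 a U \<le> avg2 a W"
  unfolding avg2_def
  by (intro integral_mono integrable_avg2 mult_left_mono sum_mono) (auto simp: q_nonneg)

lemma avg3_add: "avg3 a (\<lambda>s r u. U s r u + W s r u) = avg3 a U + avg3 a W"
  unfolding avg3_def
  by (simp add: ring_distribs sum.distrib integrable_avg3)

lemma avg3_cmult: "avg3 a (\<lambda>s r u. c * W s r u) = c * avg3 a W"
proof -
  have "(\<Sum>s\<in>S. \<Sum>r\<in>S. \<Sum>u\<in>S. q a g s * q a g r * q a g u * (c * W s r u))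
      = c * (\<Sum>s\<in>S. \<Sum>r\<in>S. \<Sum>u\<in>S. q a g s * q a g r * q a g u * W s r u)" for g
    by (simp add: sum_distrib_left mult_ac)
  thus ?thesis unfolding avg3_def by (simp add: mult.left_commute)
qed

lemma avg3_sum: "finite J \<Longrightarrow> avg3 a (\<lambda>s r u. \<Sum>k\<in>J. W k s r u) = (\<Sum>k\<in>J. avg3 a (W k))"
  by (induction J rule: finite_induct) (simp_all add: avg3_add avg3_cmult[of a 0 "\<lambda>_ _ _. 0", simplified])

lemma avg3_cong: "(\<And>s r u. \<lbrakk>s \<in> S; r \<in> S; u \<in> S\<rbrakk> \<Longrightarrow> U s r u = W s r u) \<Longrightarrow> avg3 a U = avg3 a W"
  unfolding avg3_def by (intro Bochner_Integration.integral_cong refl arg_cong2[where f = "(*)"] sum.cong) auto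

lemma avg3_mono: "(\<And>s r u. \<lbrakk>s \<in> S; r \<in> S; u \<in> S\<rbrakk> \<Longrightarrow> U s r u \<le> W s r u) \<Longrightarrow> avg3 a U \<le> avg3 a W"
  unfolding avg3_def
  by (intro integral_mono integrable_avg3 mult_left_mono sum_mono) (auto simp: q_nonneg)

text \<open>A replica on which the function does not depend sums out, because the weights
  \<open>q\<close> have total 1. This and the two variants below say that all pairs of replicas have
  the same law.\<close>

lemma avg3_12: "avg3 a (\<lambda>s r u. W s r) = avg2 a W"
proof -
  have "(\<Sum>u\<in>S. q a g s * q a g r * q a g u * W s r) = q a g s * q a g r * W s r" for g s r
    by (simp add: sum_distrib_left[symmetric] sum_distrib_right[symmetric] sum_q)
  thus ?thesis unfolding avg3_def avg2_def by simp
qed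

lemma avg3_13: "avg3 a (\<lambda>s r u. W s u) = avg2 a W"
proof -
  have "(\<Sum>r\<in>S. \<Sum>u\<in>S. q a g s * q a g r * q a g u * W s u)
      = (\<Sum>r\<in>S. q a g r) * (\<Sum>u\<in>S. q a g s * q a g u * W s u)" for g s
    unfolding sum_product by (simp add: sum_distrib_left mult_ac)
  thus ?thesis unfolding avg3_def avg2_def by (simp add: sum_q)
qed

lemma avg3_23: "avg3 a (\<lambda>s r u. W r u) = avg2 a W"
proof -
  have "(\<Sum>s\<in>S. \<Sum>r\<in>S. \<Sum>u\<in>S. q a g s * q a g r * q a g u * W r u)
      = (\<Sum>s\<in>S. q a g s) * (\<Sum>r\<in>S. \<Sum>u\<in>S. q a g r * q a g u * W r u)" for g
    unfolding sum_product by (simp add: sum_distrib_left mult_ac)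
  thus ?thesis unfolding avg3_def avg2_def by (simp add: sum_q)
qed

section \<open>Derivatives in a single Gaussian coordinate\<close>

lemma wt_deriv:
  assumes k: "k \<in> K"
  shows "((\<lambda>x. wt a (g(k := x)) s) has_real_derivative \<beta> * a k * v s k * wt a (g(k := x)) s) (at x)"
proof -
  have eq: "wt a (g(k := x)) s = exp (\<beta> * (a k * x * v s k + (\<Sum>i\<in>K - {k}. a i * g i * v s i)))" for x
  proof -
    have "(\<Sum>i\<in>K. a i * (g(k := x)) i * v s i) = a k * x * v s k + (\<Sum>i\<in>K - {k}. a i * (g(k := x)) i * v s i)"
      using sum.remove[OF finite_K k, of "\<lambda>i. a i * (g(k := x)) i * v s i"] by simp
    also have "(\<Sum>i\<in>K - {k}. a i * (g(k := x)) i * v s i) = (\<Sum>i\<in>K - {k}. a i * g i * v s i)"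
      by (intro sum.cong) auto
    finally show ?thesis by (simp add: wt_def)
  qed
  show ?thesis unfolding eq by (auto intro!: derivative_eq_intros)
qed

lemma Z_deriv:
  assumes k: "k \<in> K"
  shows "((\<lambda>x. Z a (g(k := x))) has_real_derivative
     \<beta> * a k * Z a (g(k := x)) * (\<Sum>s\<in>S. q a (g(k := x)) s * v s k)) (at x)"
proof -
  have "((\<lambda>x. Z a (g(k := x))) has_real_derivative (\<Sum>s\<in>S. \<beta> * a k * v s k * wt a (g(k := x)) s)) (at x)"
    unfolding Z_def by (intro DERIV_sum wt_deriv k)
  also have "(\<Sum>s\<in>S. \<beta> * a k * v s k * wt a (g(k := x)) s)
      = \<beta> * a k * Z a (g(k := x)) * (\<Sum>s\<in>S. q a (g(k := x)) s * v s k)"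
    using Z_pos[of a "g(k := x)"] by (simp add: q_def sum_distrib_left mult_ac)
  finally show ?thesis .
qed

lemma q_deriv:
  assumes k: "k \<in> K"
  shows "((\<lambda>x. q a (g(k := x)) s) has_real_derivative
     \<beta> * a k * q a (g(k := x)) s * (v s k - (\<Sum>r\<in>S. q a (g(k := x)) r * v r k))) (at x)"
  unfolding q_def[of a _ s]
  using Z_pos[of a "g(k := x)"]
  by (auto intro!: derivative_eq_intros wt_deriv Z_deriv k simp: field_simps power2_eq_square)

lemma Z_powr_deriv:
  assumes k: "k \<in> K"
  shows "((\<lambda>x. Z a (g(k := x)) powr p) has_real_derivative
     p * \<beta> * a k * Z a (g(k := x)) powr p * (\<Sum>r\<in>S. q a (g(k := x)) r * v r k)) (at x)"
proof -
  have "((\<lambda>x. Z a (g(k := x)) powr p) has_real_derivative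
      (p * Z a (g(k := x)) powr (p - 1)) * (\<beta> * a k * Z a (g(k := x)) * (\<Sum>s\<in>S. q a (g(k := x)) s * v s k))) (at x)"
    by (rule DERIV_chain2[OF has_real_derivative_powr[OF Z_pos] Z_deriv[OF k]])
  also have "(p * Z a (g(k := x)) powr (p - 1)) * (\<beta> * a k * Z a (g(k := x)) * (\<Sum>s\<in>S. q a (g(k := x)) s * v s k))
      = p * \<beta> * a k * Z a (g(k := x)) powr p * (\<Sum>r\<in>S. q a (g(k := x)) r * v r k)"
    using Z_pos[of a "g(k := x)"] by (simp add: powr_diff)
  finally show ?thesis .
qed

text \<open>The third replica \<open>u\<close> comes from differentiating the
  normalisation \<open>Z\<close> and the factor \<open>p - 2\<close> from \<open>Z powr p\<close> together with the two weights.\<close>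

lemma avg2_integration_by_parts:
  assumes k: "k \<in> K"
  shows "(\<integral>g. g k * (Z a g powr p * (\<Sum>s\<in>S. \<Sum>r\<in>S. q a g s * q a g r * W s r)) \<partial>gauss K)
     = \<beta> * a k * avg3 a (\<lambda>s r u. W s r * (v s k + v r k + (p - 2) * v u k))" (is ?thesis1)
    and "integrable (gauss K) (\<lambda>g. g k * (Z a g powr p * (\<Sum>s\<in>S. \<Sum>r\<in>S. q a g s * q a g r * W s r)))" (is ?thesis2)
proof -
  define G where "G g = Z a g powr p * (\<Sum>s\<in>S. \<Sum>r\<in>S. q a g s * q a g r * W s r)" for g
  define U where "U s r u = \<beta> * a k * (W s r * (v s k + v r k + (p - 2) * v u k))" for s r u
  define G' where "G' g = Z a g powr p * (\<Sum>s\<in>S. \<Sum>r\<in>S. \<Sum>u\<in>S. q a g s * q a g r * q a g u * U s r u)" for g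
  \<comment> \<open>This is the shape delivered by the product rule. It agrees with the
    three-replica sum once each Gibbs mean of \<open>v\<close> is written as a sum over
    \<open>u\<close>.\<close>
  have G'_alt: "G' g = p * \<beta> * a k * Z a g powr p * (\<Sum>u\<in>S. q a g u * v u k) * (\<Sum>s\<in>S. \<Sum>r\<in>S. q a g s * q a g r * W s r)
      + (\<Sum>s\<in>S. \<Sum>r\<in>S. (\<beta> * a k * q a g s * (v s k - (\<Sum>u\<in>S. q a g u * v u k)) * q a g r
          + \<beta> * a k * q a g r * (v r k - (\<Sum>u\<in>S. q a g u * v u k)) * q a g s) * W s r) * Z a g powr p" for g
  proof -
    define M where "M = (\<Sum>u\<in>S. q a g u * v u k)"
    have u: "(\<Sum>u\<in>S. q a g s * q a g r * q a g u * U s r u)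
        = \<beta> * a k * (q a g s * q a g r * W s r * (v s k + v r k + (p - 2) * M))" for s r
    proof -
      have "(\<Sum>u\<in>S. q a g s * q a g r * q a g u * U s r u)
        = (\<Sum>u\<in>S. \<beta> * a k * q a g s * q a g r * W s r * (v s k + v r k) * q a g u
            + \<beta> * a k * q a g s * q a g r * W s r * (p - 2) * (q a g u * v u k))"
        unfolding U_def by (intro sum.cong refl) (simp add: algebra_simps)
      also have "\<dots> = \<beta> * a k * q a g s * q a g r * W s r * (v s k + v r k)
            + \<beta> * a k * q a g s * q a g r * W s r * (p - 2) * M"
        by (simp add: sum.distrib sum_distrib_left[symmetric] sum_q M_def)
      finally show ?thesis by (simp add: algebra_simps)
    qed
    show ?thesis unfolding G'_def u M_def[symmetric]
      by (simp add: sum_distrib_left sum_distrib_right sum.distrib[symmetric] algebra_simps)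
  qed
  have Gd: "((\<lambda>x. G (g(k := x))) has_real_derivative G' (g(k := x))) (at x)" for g x
    unfolding G_def G'_alt
    by (intro DERIV_mult Z_powr_deriv k DERIV_sum DERIV_cmult_right q_deriv)
  have contq: "isCont (\<lambda>x. q a (g(k := x)) s) x" and contZ: "isCont (\<lambda>x. Z a (g(k := x)) powr p) x" for g s x
    using DERIV_isCont[OF q_deriv[OF k]] DERIV_isCont[OF Z_powr_deriv[OF k]] by auto
  have G'c: "isCont (\<lambda>x. G' (g(k := x))) x" for g x
    unfolding G'_def by (intro continuous_intros contq contZ)
  define B1 B2 where "B1 = (\<Sum>s\<in>S. \<Sum>r\<in>S. \<bar>W s r\<bar>)" and "B2 = (\<Sum>s\<in>S. \<Sum>r\<in>S. \<Sum>u\<in>S. \<bar>U s r u\<bar>)"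
  have B: "0 \<le> B1" "0 \<le> B2" by (auto simp: B1_def B2_def intro!: sum_nonneg)
  let ?A = "\<Sum>k\<in>K. \<bar>a k\<bar>"
  have bnd: "\<bar>Z a g powr p * F\<bar> \<le> real (card S) powr p * (B1 + B2) * exp ((\<beta> * ?A * p) * (\<Sum>k\<in>K. \<bar>g k\<bar>))"
    if "\<bar>F\<bar> \<le> B1 \<or> \<bar>F\<bar> \<le> B2" for F g
  proof -
    have "\<bar>F\<bar> \<le> B1 + B2" using that B by auto
    hence "Z a g powr p * \<bar>F\<bar> \<le> real (card S) powr p * exp (\<beta> * ?A * p * (\<Sum>k\<in>K. \<bar>g k\<bar>)) * (B1 + B2)"
      by (intro mult_mono Z_powr_le coeff_le) auto
    thus ?thesis by (simp add: abs_mult mult_ac)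
  qed
  have bG: "\<bar>G g\<bar> \<le> real (card S) powr p * (B1 + B2) * exp ((\<beta> * ?A * p) * (\<Sum>k\<in>K. \<bar>g k\<bar>))" for g
    unfolding G_def by (rule bnd) (use qq_bound in \<open>auto simp: B1_def\<close>)
  have bG': "\<bar>G' g\<bar> \<le> real (card S) powr p * (B1 + B2) * exp ((\<beta> * ?A * p) * (\<Sum>k\<in>K. \<bar>g k\<bar>))" for g
    unfolding G'_def by (rule bnd) (use qqq_bound in \<open>auto simp: B2_def\<close>)
  have "G \<in> borel_measurable (gauss K)" "G' \<in> borel_measurable (gauss K)"
    unfolding G_def[abs_def] G'_def[abs_def] by measurable
  hence "(\<integral>g. g k * G g \<partial>gauss K) = (\<integral>g. G' g \<partial>gauss K)" "integrable (gauss K) (\<lambda>g. g k * G g)"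
    using gauss_integration_by_parts[OF finite_K k _ _ Gd G'c bG bG'] by auto
  moreover have "(\<integral>g. G' g \<partial>gauss K) = \<beta> * a k * avg3 a (\<lambda>s r u. W s r * (v s k + v r k + (p - 2) * v u k))"
    unfolding avg3_cmult[symmetric] unfolding avg3_def G'_def U_def ..
  ultimately show ?thesis1 ?thesis2 unfolding G_def by auto
qed

text \<open>Summing the coordinate identity over a block of constant scale turns products of
  features into the block covariance \<open>C\<close>; the field acts on replica \<open>s\<close>,
  so every covariance involves \<open>s\<close>.\<close>

lemma avg2_field_integration_by_parts:
  assumes "J \<subseteq> K" and a: "\<And>k. k \<in> J \<Longrightarrow> a k = \<sigma>"
  defines "C \<equiv> \<lambda>s r. \<Sum>k\<in>J. v s k * v r k"
  shows "(\<integral>g. Z a g powr p * (\<Sum>s\<in>S. \<Sum>r\<in>S. q a g s * q a g r * (W s r * (\<Sum>k\<in>J. g k * v s k))) \<partial>gauss K)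
     = \<beta> * \<sigma> * avg3 a (\<lambda>s r u. W s r * (C s s + C s r + (p - 2) * C s u))"
    and "integrable (gauss K) (\<lambda>g. Z a g powr p * (\<Sum>s\<in>S. \<Sum>r\<in>S. q a g s * q a g r * (W s r * (\<Sum>k\<in>J. g k * v s k))))"
proof -
  have finJ: "finite J" using assms(1) finite_K finite_subset by blast
  have eq: "Z a g powr p * (\<Sum>s\<in>S. \<Sum>r\<in>S. q a g s * q a g r * (W s r * (\<Sum>k\<in>J. g k * v s k)))
      = (\<Sum>k\<in>J. g k * (Z a g powr p * (\<Sum>s\<in>S. \<Sum>r\<in>S. q a g s * q a g r * (W s r * v s k))))" for g
  proof -
    have "(\<Sum>s\<in>S. \<Sum>r\<in>S. q a g s * q a g r * (W s r * (\<Sum>k\<in>J. g k * v s k)))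
       = (\<Sum>s\<in>S. \<Sum>r\<in>S. \<Sum>k\<in>J. g k * (q a g s * q a g r * (W s r * v s k)))"
      by (simp add: sum_distrib_left mult_ac)
    also have "\<dots> = (\<Sum>s\<in>S. \<Sum>k\<in>J. \<Sum>r\<in>S. g k * (q a g s * q a g r * (W s r * v s k)))"
      by (intro sum.cong refl sum.swap)
    also have "\<dots> = (\<Sum>k\<in>J. \<Sum>s\<in>S. \<Sum>r\<in>S. g k * (q a g s * q a g r * (W s r * v s k)))"
      by (rule sum.swap)
    finally show ?thesis by (simp add: sum_distrib_left mult_ac)
  qed
  have k: "k \<in> K" if "k \<in> J" for k using that assms(1) by auto
  show "integrable (gauss K) (\<lambda>g. Z a g powr p * (\<Sum>s\<in>S. \<Sum>r\<in>S. q a g s * q a g r * (W s r * (\<Sum>k\<in>J. g k * v s k))))"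
    unfolding eq by (intro Bochner_Integration.integrable_sum avg2_integration_by_parts k)
  have "(\<integral>g. Z a g powr p * (\<Sum>s\<in>S. \<Sum>r\<in>S. q a g s * q a g r * (W s r * (\<Sum>k\<in>J. g k * v s k))) \<partial>gauss K)
     = (\<Sum>k\<in>J. \<beta> * a k * avg3 a (\<lambda>s r u. (W s r * v s k) * (v s k + v r k + (p - 2) * v u k)))"
    unfolding eq by (subst Bochner_Integration.integral_sum) (auto intro!: avg2_integration_by_parts sum.cong k)
  also have "\<dots> = \<beta> * \<sigma> * (\<Sum>k\<in>J. avg3 a (\<lambda>s r u. (W s r * v s k) * (v s k + v r k + (p - 2) * v u k)))"
    unfolding sum_distrib_left by (intro sum.cong refl) (simp add: a)
  also have "(\<Sum>k\<in>J. avg3 a (\<lambda>s r u. (W s r * v s k) * (v s k + v r k + (p - 2) * v u k)))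
      = avg3 a (\<lambda>s r u. W s r * (C s s + C s r + (p - 2) * C s u))"
    unfolding avg3_sum[OF finJ, symmetric] C_def
    by (intro avg3_cong) (simp add: sum_distrib_left sum.distrib[symmetric] algebra_simps)
  finally show "(\<integral>g. Z a g powr p * (\<Sum>s\<in>S. \<Sum>r\<in>S. q a g s * q a g r * (W s r * (\<Sum>k\<in>J. g k * v s k))) \<partial>gauss K)
     = \<beta> * \<sigma> * avg3 a (\<lambda>s r u. W s r * (C s s + C s r + (p - 2) * C s u))" .
qed

text \<open>Lowering the coefficients on \<open>J\<close> by \<open>\<eta>\<close> tilts the Gibbs measure by the field on \<open>J\<close>. Hence, if
  \<open>D\<close> drops substantially, the field is typically large.\<close>

lemma avg2_field_lower_bound:
  assumes J: "J \<subseteq> K" and a: "\<And>k. k \<in> J \<Longrightarrow> a k = \<sigma>" and \<eta>: "\<eta> > 0"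
    and W: "\<And>s r. \<lbrakk>s \<in> S; r \<in> S\<rbrakk> \<Longrightarrow> 0 \<le> W s r \<and> W s r \<le> w"
  defines "l \<equiv> p * \<beta> * \<eta>"
  shows "y * avg2 a W - w / l * exp (l * y) * D (\<lambda>k. if k \<in> J then a k - \<eta> else a k)
     \<le> (\<integral>g. Z a g powr p * (\<Sum>s\<in>S. \<Sum>r\<in>S. q a g s * q a g r * (W s r * (\<Sum>k\<in>J. g k * v s k))) \<partial>gauss K)"
proof -
  let ?a' = "\<lambda>k. if k \<in> J then a k - \<eta> else a k"
  define Y where "Y g s = (\<Sum>k\<in>J. g k * v s k)" for g s
  have l: "l > 0" using \<beta>_pos p_pos \<eta> by (simp add: l_def)
  have w: "w \<ge> 0" using S_ne W by (meson ex_in_conv order_trans)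
  \<comment> \<open>The lowered partition function is \<open>Z a g\<close> times the Gibbs mean of
    \<open>exp (- \<beta> * \<eta> * Y)\<close>; concavity then lets the power \<open>p\<close> move
    inside the mean, where it turns the exponent into \<open>- l * Y\<close>.\<close>
  have key: "Z a g powr p * (\<Sum>s\<in>S. q a g s * exp (- l * Y g s)) \<le> Z ?a' g powr p" for g
  proof -
    have "wt ?a' g s = wt a g s * exp (- \<beta> * \<eta> * Y g s)" for s
    proof -
      have "(\<Sum>k\<in>K. ?a' k * g k * v s k) = (\<Sum>k\<in>K. a k * g k * v s k - (if k \<in> J then \<eta> * (g k * v s k) else 0))"
        by (intro sum.cong) (auto simp: algebra_simps)
      also have "\<dots> = (\<Sum>k\<in>K. a k * g k * v s k) - \<eta> * Y g s"
        unfolding sum_subtractf Y_def sum_distrib_left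
        using J finite_K by (simp add: sum.If_cases Int_absorb1)
      finally have *: "(\<Sum>k\<in>K. ?a' k * g k * v s k) = (\<Sum>k\<in>K. a k * g k * v s k) - \<eta> * Y g s" .
      show ?thesis unfolding wt_def * by (simp add: exp_add[symmetric] algebra_simps)
    qed
    hence "Z ?a' g = Z a g * (\<Sum>s\<in>S. q a g s * exp (- \<beta> * \<eta> * Y g s))"
      using Z_pos[of a g] by (simp add: Z_def[of ?a'] q_def sum_distrib_left)
    hence "Z ?a' g powr p = Z a g powr p * (\<Sum>s\<in>S. q a g s * exp (- \<beta> * \<eta> * Y g s)) powr p"
      using Z_pos[of a g] by (simp add: powr_mult sum_nonneg q_nonneg)
    moreover have "(\<Sum>s\<in>S. q a g s * exp (- \<beta> * \<eta> * Y g s) powr p) \<le> (\<Sum>s\<in>S. q a g s * exp (- \<beta> * \<eta> * Y g s)) powr p"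
      by (rule sum_power_mean_le) (auto simp: q_nonneg sum_q p_pos p_le)
    ultimately show ?thesis
      by (simp add: exp_powr_real l_def mult_ac mult_left_mono)
  qed
  have point: "y * (Z a g powr p * (\<Sum>s\<in>S. \<Sum>r\<in>S. q a g s * q a g r * W s r)) - w / l * exp (l * y) * Z ?a' g powr p
      \<le> Z a g powr p * (\<Sum>s\<in>S. \<Sum>r\<in>S. q a g s * q a g r * (W s r * Y g s))" for g
  proof -
    have 1: "q a g s * q a g r * (y * W s r - w / l * exp (l * y) * exp (- l * Y g s))
        \<le> q a g s * q a g r * (W s r * Y g s)" if "s \<in> S" "r \<in> S" for s r
    proof (intro mult_left_mono mult_nonneg_nonneg q_nonneg)
      have Wsr: "0 \<le> W s r" "W s r \<le> w" using W[OF that] by auto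
      \<comment> \<open>A shortfall of \<open>Y\<close> below the level \<open>y\<close> is paid for
        by the exponential that the lowered partition function controls.\<close>
      have "1 + - l * (Y g s - y) \<le> exp (- l * (Y g s - y))" by (rule exp_ge_add_one_self)
      hence "l * (y - Y g s) \<le> exp (l * y) * exp (- l * Y g s)"
        by (simp add: exp_add[symmetric] algebra_simps)
      hence "y - Y g s \<le> 1 / l * exp (l * y) * exp (- l * Y g s)"
        using l by (simp add: field_simps)
      hence "W s r * (y - Y g s) \<le> w * (1 / l * exp (l * y) * exp (- l * Y g s))"
      proof -
        assume h: "y - Y g s \<le> 1 / l * exp (l * y) * exp (- l * Y g s)"
        have "W s r * (y - Y g s) \<le> W s r * (1 / l * exp (l * y) * exp (- l * Y g s))"
          by (rule mult_left_mono[OF h Wsr(1)])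
        also have "\<dots> \<le> w * (1 / l * exp (l * y) * exp (- l * Y g s))"
          by (rule mult_right_mono[OF Wsr(2)]) (use l in auto)
        finally show ?thesis .
      qed
      thus "y * W s r - w / l * exp (l * y) * exp (- l * Y g s) \<le> W s r * Y g s"
        by (simp add: algebra_simps)
    qed
    have "y * (\<Sum>s\<in>S. \<Sum>r\<in>S. q a g s * q a g r * W s r) - w / l * exp (l * y) * (\<Sum>s\<in>S. q a g s * exp (- l * Y g s))
       = (\<Sum>s\<in>S. \<Sum>r\<in>S. q a g s * q a g r * (y * W s r - w / l * exp (l * y) * exp (- l * Y g s)))"
    proof -
      have "(\<Sum>s\<in>S. q a g s * exp (- l * Y g s)) = (\<Sum>s\<in>S. \<Sum>r\<in>S. q a g s * q a g r * exp (- l * Y g s))"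
      proof (intro sum.cong refl)
        fix s
        have "(\<Sum>r\<in>S. q a g s * q a g r * exp (- l * Y g s)) = (\<Sum>r\<in>S. q a g r) * (q a g s * exp (- l * Y g s))"
          unfolding sum_distrib_right by (simp add: mult_ac)
        thus "q a g s * exp (- l * Y g s) = (\<Sum>r\<in>S. q a g s * q a g r * exp (- l * Y g s))" by (simp add: sum_q)
      qed
      thus ?thesis by (simp add: sum_distrib_left sum_subtractf[symmetric] algebra_simps)
    qed
    also have "\<dots> \<le> (\<Sum>s\<in>S. \<Sum>r\<in>S. q a g s * q a g r * (W s r * Y g s))" by (intro sum_mono 1)
    finally have "Z a g powr p * (y * (\<Sum>s\<in>S. \<Sum>r\<in>S. q a g s * q a g r * W s r)
          - w / l * exp (l * y) * (\<Sum>s\<in>S. q a g s * exp (- l * Y g s)))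
        \<le> Z a g powr p * (\<Sum>s\<in>S. \<Sum>r\<in>S. q a g s * q a g r * (W s r * Y g s))"
      by (rule mult_left_mono) simp
    moreover have "w / l * exp (l * y) * (Z a g powr p * (\<Sum>s\<in>S. q a g s * exp (- l * Y g s)))
        \<le> w / l * exp (l * y) * Z ?a' g powr p"
      by (rule mult_left_mono[OF key]) (use w l in auto)
    ultimately show ?thesis by (simp add: algebra_simps)
  qed
  have "y * avg2 a W - w / l * exp (l * y) * D ?a'
      = (\<integral>g. y * (Z a g powr p * (\<Sum>s\<in>S. \<Sum>r\<in>S. q a g s * q a g r * W s r)) - w / l * exp (l * y) * Z ?a' g powr p \<partial>gauss K)"
    unfolding avg2_def D_def by (simp add: integrable_avg2 integrable_Z_powr)
  also have "\<dots> \<le> (\<integral>g. Z a g powr p * (\<Sum>s\<in>S. \<Sum>r\<in>S. q a g s * q a g r * (W s r * Y g s)) \<partial>gauss K)"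
    by (intro integral_mono point Bochner_Integration.integrable_diff integrable_mult_right integrable_avg2 integrable_Z_powr)
       (unfold Y_def, rule avg2_field_integration_by_parts(2)[OF J a])
  finally show ?thesis unfolding Y_def .
qed

section \<open>Dependence of the partition function on the scales\<close>

text \<open>Differentiating in the scales brings down factors \<open>g k\<close>, which integration
  by parts removes again. The pairs \<open>(s, r)\<close> and \<open>(s, u)\<close> have the same
  average, so their coefficients 1 and \<open>p - 2\<close> merge into \<open>p - 1\<close>.\<close>

lemma D_has_derivative:
  assumes t: "l < t" "t < r"
    and a: "\<And>s k. \<lbrakk>l < s; s < r; k \<in> K\<rbrakk> \<Longrightarrow> ((\<lambda>s. a s k) has_real_derivative a' s k) (at s)"
    and aB: "\<And>s k. \<lbrakk>l < s; s < r; k \<in> K\<rbrakk> \<Longrightarrow> \<bar>a s k\<bar> \<le> B"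
    and a'B: "\<And>s k. \<lbrakk>l < s; s < r; k \<in> K\<rbrakk> \<Longrightarrow> \<bar>a' s k\<bar> \<le> B"
  shows "((\<lambda>s. D (a s)) has_real_derivative
     p * \<beta>\<^sup>2 * (\<Sum>k\<in>K. a t k * a' t k * avg2 (a t) (\<lambda>s r. v s k * (v s k + (p - 1) * v r k)))) (at t)"
proof -
  define f' where "f' s g = (\<Sum>k\<in>K. p * \<beta> * a' s k * (g k * (Z (a s) g powr p * (\<Sum>s'\<in>S. \<Sum>r\<in>S. q (a s) g s' * q (a s) g r * v s' k))))" for s g
  have single: "(\<Sum>s'\<in>S. \<Sum>r\<in>S. q c g s' * q c g r * v s' k) = (\<Sum>s'\<in>S. q c g s' * v s' k)" for c g k
  proof (intro sum.cong refl)
    fix s'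
    have "(\<Sum>r\<in>S. q c g s' * q c g r * v s' k) = (\<Sum>r\<in>S. q c g r) * (q c g s' * v s' k)"
      unfolding sum_distrib_right by (simp add: mult_ac)
    thus "(\<Sum>r\<in>S. q c g s' * q c g r * v s' k) = q c g s' * v s' k" by (simp add: sum_q)
  qed
  have Zd: "((\<lambda>s. Z (a s) g powr p) has_real_derivative f' s g) (at s)" if s: "l < s" "s < r" for s g
  proof -
    have wd: "((\<lambda>s. wt (a s) g s') has_real_derivative wt (a s) g s' * (\<beta> * (\<Sum>k\<in>K. a' s k * (g k * v s' k)))) (at s)" for s'
      unfolding wt_def mult.assoc
      by (rule DERIV_fun_exp[THEN DERIV_cong, OF DERIV_cmult, OF DERIV_sum, OF DERIV_cmult_right, OF a[OF s]])
         (auto simp: mult_ac)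
    have "((\<lambda>s. Z (a s) g) has_real_derivative (\<Sum>s'\<in>S. wt (a s) g s' * (\<beta> * (\<Sum>k\<in>K. a' s k * (g k * v s' k))))) (at s)"
      unfolding Z_def by (intro DERIV_sum wd)
    note DERIV_chain2[OF has_real_derivative_powr[OF Z_pos, of p] this]
    moreover have "p * Z (a s) g powr (p - 1) * (\<Sum>s'\<in>S. wt (a s) g s' * (\<beta> * (\<Sum>k\<in>K. a' s k * (g k * v s' k)))) = f' s g"
    proof -
      have sum_eq: "(\<Sum>s'\<in>S. wt (a s) g s' * (\<beta> * (\<Sum>k\<in>K. a' s k * (g k * v s' k))))
          = Z (a s) g * (\<beta> * (\<Sum>k\<in>K. a' s k * (g k * (\<Sum>s'\<in>S. q (a s) g s' * v s' k))))"
      proof -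
        have "wt (a s) g s' * (\<beta> * (\<Sum>k\<in>K. a' s k * (g k * v s' k)))
           = (\<Sum>k\<in>K. Z (a s) g * (\<beta> * (a' s k * (g k * (q (a s) g s' * v s' k)))))" for s'
          using Z_pos[of "a s" g] by (simp add: q_def sum_distrib_left mult_ac)
        hence "(\<Sum>s'\<in>S. wt (a s) g s' * (\<beta> * (\<Sum>k\<in>K. a' s k * (g k * v s' k))))
           = (\<Sum>k\<in>K. \<Sum>s'\<in>S. Z (a s) g * (\<beta> * (a' s k * (g k * (q (a s) g s' * v s' k)))))"
          by (simp add: sum.swap[of _ K S])
        thus ?thesis by (simp add: sum_distrib_left)
      qed
      have "Z (a s) g powr (p - 1) * Z (a s) g = Z (a s) g powr p"
        using Z_pos[of "a s" g] by (simp add: powr_diff)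
      hence "p * Z (a s) g powr (p - 1) * (\<Sum>s'\<in>S. wt (a s) g s' * (\<beta> * (\<Sum>k\<in>K. a' s k * (g k * v s' k))))
          = p * Z (a s) g powr p * (\<beta> * (\<Sum>k\<in>K. a' s k * (g k * (\<Sum>s'\<in>S. q (a s) g s' * v s' k))))"
        unfolding sum_eq by (simp only: mult.assoc[symmetric]) (simp only: mult.assoc)
      thus ?thesis unfolding f'_def single
        by (simp add: sum_distrib_left mult_ac)
    qed
    ultimately show ?thesis by simp
  qed
  define B' where "B' = max B 0"
  have B': "B' \<ge> 0" "\<And>s k. \<lbrakk>l < s; s < r; k \<in> K\<rbrakk> \<Longrightarrow> \<bar>a s k\<bar> \<le> B'" "\<And>s k. \<lbrakk>l < s; s < r; k \<in> K\<rbrakk> \<Longrightarrow> \<bar>a' s k\<bar> \<le> B'"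
    using aB a'B by (auto simp: B'_def le_max_iff_disj)
  define A where "A = p * \<beta> * B' * real (card S) powr p"
  have f'_le: "\<bar>f' s g\<bar> \<le> A * exp ((\<beta> * B' * p + 1) * (\<Sum>k\<in>K. \<bar>g k\<bar>))" if s: "l < s" "s < r" for s g
  proof -
    let ?n = "\<Sum>k\<in>K. \<bar>g k\<bar>"
    have m: "\<bar>\<Sum>s'\<in>S. q (a s) g s' * v s' k\<bar> \<le> 1" if "k \<in> K" for k
    proof -
      have "\<bar>\<Sum>s'\<in>S. q (a s) g s' * v s' k\<bar> \<le> (\<Sum>s'\<in>S. q (a s) g s' * 1)"
      proof (intro order_trans[OF sum_abs] sum_mono)
        fix s' assume "s' \<in> S"
        hence "q (a s) g s' * \<bar>v s' k\<bar> \<le> q (a s) g s' * 1" using v_le that by (intro mult_left_mono q_nonneg) auto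
        thus "\<bar>q (a s) g s' * v s' k\<bar> \<le> q (a s) g s' * 1" by (simp add: abs_mult q_nonneg)
      qed
      thus ?thesis by (simp add: sum_q)
    qed
    have "\<bar>f' s g\<bar> \<le> (\<Sum>k\<in>K. p * \<beta> * B' * (\<bar>g k\<bar> * (Z (a s) g powr p * 1)))"
      unfolding f'_def single
    proof (intro order_trans[OF sum_abs] sum_mono)
      fix k assume k: "k \<in> K"
      have "p * \<beta> * \<bar>a' s k\<bar> * (\<bar>g k\<bar> * (Z (a s) g powr p * \<bar>\<Sum>s'\<in>S. q (a s) g s' * v s' k\<bar>))
          \<le> p * \<beta> * B' * (\<bar>g k\<bar> * (Z (a s) g powr p * 1))"
        using p_pos \<beta>_pos B'(1) B'(3)[OF s k]
        by (intro mult_mono mult_left_mono m k) auto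
      thus "\<bar>p * \<beta> * a' s k * (g k * (Z (a s) g powr p * (\<Sum>s'\<in>S. q (a s) g s' * v s' k)))\<bar>
          \<le> p * \<beta> * B' * (\<bar>g k\<bar> * (Z (a s) g powr p * 1))"
        using p_pos \<beta>_pos by (simp add: abs_mult)
    qed
    also have "\<dots> = p * \<beta> * B' * (?n * Z (a s) g powr p)"
      by (simp add: sum_distrib_left sum_distrib_right)
    also have "\<dots> \<le> p * \<beta> * B' * (exp ?n * (real (card S) powr p * exp (\<beta> * B' * p * ?n)))"
    proof (intro mult_left_mono mult_mono)
      show "?n \<le> exp ?n" using exp_ge_add_one_self[of ?n] by linarith
      show "Z (a s) g powr p \<le> real (card S) powr p * exp (\<beta> * B' * p * ?n)"
        using B'(2)[OF s] by (intro Z_powr_le)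
    qed (use p_pos \<beta>_pos B' in \<open>auto intro!: sum_nonneg\<close>)
    also have "\<dots> = A * exp ((\<beta> * B' * p + 1) * ?n)"
      by (simp add: A_def ring_distribs exp_add mult_ac)
    finally show ?thesis .
  qed
  have f'm: "f' t \<in> borel_measurable (gauss K)"
    unfolding f'_def[abs_def] by measurable
  have "((\<lambda>s. D (a s)) has_real_derivative (\<integral>g. f' t g \<partial>gauss K)) (at t)"
    unfolding D_def
    by (rule has_real_derivative_integral[OF t, where w = "\<lambda>g. A * exp ((\<beta> * B' * p + 1) * (\<Sum>k\<in>K. \<bar>g k\<bar>))"])
       (rule Zd f'_le f'm integrable_exp_gauss[OF finite_K] integrable_Z_powr; assumption)+
  also have "(\<integral>g. f' t g \<partial>gauss K) = (\<Sum>k\<in>K. p * \<beta> * a' t k * (\<beta> * a t k * avg3 (a t) (\<lambda>s r u. v s k * (v s k + v r k + (p - 2) * v u k))))"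
    unfolding f'_def
    by (subst Bochner_Integration.integral_sum)
       (auto intro!: sum.cong integrable_mult_right avg2_integration_by_parts simp: avg2_integration_by_parts(1))
  also have "\<dots> = (\<Sum>k\<in>K. p * \<beta> * a' t k * (\<beta> * a t k * avg2 (a t) (\<lambda>s r. v s k * (v s k + (p - 1) * v r k))))"
  proof (intro sum.cong refl arg_cong2[where f = "(*)"])
    fix k
    show "avg3 (a t) (\<lambda>s r u. v s k * (v s k + v r k + (p - 2) * v u k))
      = avg2 (a t) (\<lambda>s r. v s k * (v s k + (p - 1) * v r k))"
    proof -
    have "avg3 (a t) (\<lambda>s r u. v s k * (v s k + v r k + (p - 2) * v u k))
        = avg3 (a t) (\<lambda>s r u. v s k * (v s k + v r k) + (p - 2) * (v s k * v u k))"
      by (intro avg3_cong) (simp add: algebra_simps)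
    also have "\<dots> = avg2 (a t) (\<lambda>s r. v s k * (v s k + v r k)) + (p - 2) * avg2 (a t) (\<lambda>s r. v s k * v r k)"
      unfolding avg3_add avg3_cmult avg3_12[of _ "\<lambda>s r. v s k * (v s k + v r k)"] avg3_13[of _ "\<lambda>s u. v s k * v u k"] ..
    also have "\<dots> = avg2 (a t) (\<lambda>s r. v s k * (v s k + (p - 1) * v r k))"
      unfolding avg2_cmult[symmetric] avg2_add[symmetric]
      by (intro avg2_cong) (simp add: algebra_simps)
    finally show ?thesis .
    qed
  qed
  finally show ?thesis
    by (simp add: sum_distrib_left power2_eq_square mult_ac)
qed

text \<open>Needed at the end points of the interpolation, where the square-root scales are
  continuous but need not be differentiable.\<close>

lemma D_continuous_on:
  assumes a: "\<And>k. k \<in> K \<Longrightarrow> continuous_on A (\<lambda>s. a s k)"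
    and aB: "\<And>s k. \<lbrakk>s \<in> A; k \<in> K\<rbrakk> \<Longrightarrow> \<bar>a s k\<bar> \<le> B"
  shows "continuous_on A (\<lambda>s::real. D (a s))"
  unfolding continuous_on_sequentially comp_def
proof (intro allI ballI impI)
  fix X t assume t: "t \<in> A" and X: "(\<forall>n. X n \<in> A) \<and> X \<longlonglongrightarrow> t"
  show "(\<lambda>n. D (a (X n))) \<longlonglongrightarrow> D (a t)"
    unfolding D_def
  proof (rule integral_dominated_convergence[where w = "\<lambda>g. real (card S) powr p * exp (\<beta> * B * p * (\<Sum>k\<in>K. \<bar>g k\<bar>))"])
    show "AE g in gauss K. (\<lambda>n. Z (a (X n)) g powr p) \<longlonglongrightarrow> Z (a t) g powr p"
    proof (rule AE_I2)
      fix g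
      have "(\<lambda>n. a (X n) k) \<longlonglongrightarrow> a t k" if "k \<in> K" for k
        using a[OF that] X t unfolding continuous_on_sequentially comp_def by blast
      thus "(\<lambda>n. Z (a (X n)) g powr p) \<longlonglongrightarrow> Z (a t) g powr p"
        using Z_pos[of "a t" g] unfolding Z_def wt_def
        by (intro tendsto_intros) auto
    qed
    show "AE g in gauss K. norm (Z (a (X n)) g powr p) \<le> real (card S) powr p * exp (\<beta> * B * p * (\<Sum>k\<in>K. \<bar>g k\<bar>))" for n
      using Z_powr_le[of "a (X n)" B] aB X by auto
  qed (measurable, rule integrable_exp_gauss[OF finite_K])
qed

end

section \<open>The bordered bipartite model\<close>

text \<open>Turns a product of distances over two different pairs into products over a single pair.
  If neither \<open>d12\<close> nor \<open>e13\<close> reaches half of its target, the triangle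
  inequalities make both \<open>d23\<close> and \<open>e23\<close> do so.\<close>

lemma cross_distance_le:
  fixes d12 :: real
  assumes "0 \<le> d12" "0 \<le> d13" "0 \<le> d23" "0 \<le> e12" "0 \<le> e13" "0 \<le> e23"
    and "d13 \<le> d12 + d23" "e12 \<le> e13 + e23"
  shows "e12 * d13 \<le> 2 * (d12 * e12) + 2 * (d13 * e13) + 4 * (d23 * e23)"
proof -
  have nn: "0 \<le> d12 * e12" "0 \<le> d13 * e13" "0 \<le> d23 * e23" using assms by auto
  consider "d12 \<ge> d13 / 2" | "e13 \<ge> e12 / 2" | "d23 \<ge> d13 / 2" "e23 \<ge> e12 / 2"
    using assms by linarith
  thus ?thesis
  proof cases
    case 1
    have "e12 * (d13 / 2) \<le> e12 * d12" by (rule mult_left_mono[OF 1]) fact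
    thus ?thesis using nn by (simp add: mult.commute)
  next
    case 2
    have "d13 * (e12 / 2) \<le> d13 * e13" by (rule mult_left_mono[OF 2]) fact
    thus ?thesis using nn by (simp add: mult.commute)
  next
    case 3
    have "(e12 / 2) * (d13 / 2) \<le> e23 * d23" using 3 assms by (intro mult_mono) auto
    thus ?thesis using nn by (simp add: mult.commute)
  qed
qed

section \<open>Distances between sign vectors\<close>

text \<open>On \<open>sign_cube n\<close> with \<open>n > 0\<close> this is \<open>2 / n\<close>
  times the Hamming distance.\<close>

definition cube_dist :: "nat \<Rightarrow> (nat \<Rightarrow> real) \<Rightarrow> (nat \<Rightarrow> real) \<Rightarrow> real" where
  "cube_dist n x x' = 1 - (\<Sum>j<n. x j * x' j)"

lemma sign_cubeD:
  assumes "x \<in> sign_cube n" "j < n"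
  shows "x j = 1 / sqrt n \<or> x j = - (1 / sqrt n)"
  using assms by (force simp: sign_cube_def)

lemma cube_dist_alt:
  assumes "0 < n"
  shows "cube_dist n x x' = (\<Sum>j<n. 1 / n - x j * x' j)"
  using assms by (simp add: cube_dist_def sum_subtractf)

lemma sign_cube_prod_le:
  assumes "x \<in> sign_cube n" "x' \<in> sign_cube n" "j < n"
  shows "x j * x' j \<le> 1 / n" and "- (1 / n) \<le> x j * x' j"
  using sign_cubeD[OF assms(1,3)] sign_cubeD[OF assms(2,3)]
  by (auto simp: real_sqrt_mult[symmetric] simp: power_divide simp flip: power2_eq_square)

lemma cube_dist_nonneg: "\<lbrakk>0 < n; x \<in> sign_cube n; x' \<in> sign_cube n\<rbrakk> \<Longrightarrow> 0 \<le> cube_dist n x x'"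
  unfolding cube_dist_alt by (intro sum_nonneg) (simp add: sign_cube_prod_le)

lemma cube_dist_le_2:
  assumes "0 < n" "x \<in> sign_cube n" "x' \<in> sign_cube n"
  shows "cube_dist n x x' \<le> 2"
proof -
  have "(\<Sum>j<n. - (1 / n)) \<le> (\<Sum>j<n. x j * x' j)" by (intro sum_mono sign_cube_prod_le(2) assms) auto
  thus ?thesis using assms(1) by (simp add: cube_dist_def)
qed

lemma cube_dist_self:
  assumes "0 < n" "x \<in> sign_cube n"
  shows "cube_dist n x x = 0"
proof -
  have "x j * x j = 1 / n" if "j < n" for j
    using sign_cubeD[OF assms(2) that] by auto
  thus ?thesis using assms(1) by (simp add: cube_dist_def)
qed

lemma cube_dist_triangle:
  assumes "0 < n" "x \<in> sign_cube n" "x' \<in> sign_cube n" "z \<in> sign_cube n"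
  shows "cube_dist n x z \<le> cube_dist n x x' + cube_dist n x' z"
  unfolding cube_dist_alt[OF assms(1)] sum.distrib[symmetric]
proof (intro sum_mono)
  fix j assume "j \<in> {..<n}"
  hence j: "j < n" by simp
  show "1 / n - x j * z j \<le> 1 / n - x j * x' j + (1 / n - x' j * z j)"
    using sign_cubeD[OF assms(2) j] sign_cubeD[OF assms(3) j] sign_cubeD[OF assms(4) j] assms(1)
    by auto
qed

text \<open>The Gaussian coordinates are indexed by a bordered matrix: the entries \<open>(i, j)\<close> with
  \<open>i < m\<close>, \<open>j < n\<close> are the matrix, the row \<open>m\<close> is a field acting on \<open>x\<close> and the column \<open>n\<close> a
  field acting on \<open>y\<close>; \<open>coef t u w\<close> assigns these three blocks the scales \<open>t\<close>, \<open>u\<close>, \<open>w\<close>.\<close>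

definition mat_block :: "nat \<Rightarrow> nat \<Rightarrow> (nat \<times> nat) set" where
  "mat_block m n = {..<m} \<times> {..<n}"

definition row_block :: "nat \<Rightarrow> nat \<Rightarrow> (nat \<times> nat) set" where
  "row_block m n = {m} \<times> {..<n}"

definition col_block :: "nat \<Rightarrow> nat \<Rightarrow> (nat \<times> nat) set" where
  "col_block m n = {..<m} \<times> {n}"

definition bordered :: "nat \<Rightarrow> nat \<Rightarrow> (nat \<times> nat) set" where
  "bordered m n = mat_block m n \<union> row_block m n \<union> col_block m n"

text \<open>The rank-one matrix of \<open>s = (x, y)\<close> after both vectors are prolonged by an
  entry 1: the border row then reads \<open>x\<close> and the border column reads \<open>y\<close>,
  so one family of features serves the matrix and both fields.\<close>

definition bordered_prod :: "nat \<Rightarrow> nat \<Rightarrow> (nat \<Rightarrow> real) \<times> (nat \<Rightarrow> real) \<Rightarrow> nat \<times> nat \<Rightarrow> real" where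
  "bordered_prod m n s k = (if fst k < m then snd s (fst k) else 1) * (if snd k < n then fst s (snd k) else 1)"

definition coef :: "nat \<Rightarrow> nat \<Rightarrow> real \<Rightarrow> real \<Rightarrow> real \<Rightarrow> nat \<times> nat \<Rightarrow> real" where
  "coef m n t u w k = (if fst k < m then if snd k < n then t else w else u)"

lemma finite_bordered: "finite (bordered m n)"
  by (simp add: bordered_def mat_block_def row_block_def col_block_def)

lemma sum_bordered:
  fixes f :: "nat \<times> nat \<Rightarrow> real"
  shows "sum f (bordered m n) = sum f (mat_block m n) + sum f (row_block m n) + sum f (col_block m n)"
proof -
  have "sum f (mat_block m n \<union> row_block m n \<union> col_block m n)
      = sum f (mat_block m n \<union> row_block m n) + sum f (col_block m n)"
    by (rule sum.union_disjoint) (auto simp: mat_block_def row_block_def col_block_def)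
  also have "sum f (mat_block m n \<union> row_block m n) = sum f (mat_block m n) + sum f (row_block m n)"
    by (rule sum.union_disjoint) (auto simp: mat_block_def row_block_def)
  finally show ?thesis by (simp add: bordered_def)
qed

lemma prod_bordered:
  fixes f :: "nat \<times> nat \<Rightarrow> real"
  shows "prod f (bordered m n) = prod f (mat_block m n) * prod f (row_block m n) * prod f (col_block m n)"
proof -
  have "prod f (mat_block m n \<union> row_block m n \<union> col_block m n)
      = prod f (mat_block m n \<union> row_block m n) * prod f (col_block m n)"
    by (rule prod.union_disjoint) (auto simp: mat_block_def row_block_def col_block_def)
  also have "prod f (mat_block m n \<union> row_block m n) = prod f (mat_block m n) * prod f (row_block m n)"
    by (rule prod.union_disjoint) (auto simp: mat_block_def row_block_def)
  finally show ?thesis by (simp add: bordered_def)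
qed

lemma sum_mat_block: "sum f (mat_block m n) = (\<Sum>i<m. \<Sum>j<n. f (i, j))" for f :: "_ \<Rightarrow> real"
  by (simp add: mat_block_def sum.cartesian_product)

lemma sum_row_block: "sum f (row_block m n) = (\<Sum>j<n. f (m, j))" for f :: "_ \<Rightarrow> real"
proof -
  have "row_block m n = Pair m ` {..<n}" by (auto simp: row_block_def)
  thus ?thesis by (simp add: sum.reindex inj_on_def)
qed

lemma sum_col_block: "sum f (col_block m n) = (\<Sum>i<m. f (i, n))" for f :: "_ \<Rightarrow> real"
proof -
  have "col_block m n = (\<lambda>i. (i, n)) ` {..<m}" by (auto simp: col_block_def)
  thus ?thesis by (simp add: sum.reindex inj_on_def)
qed

lemma prod_row_block: "prod f (row_block m n) = (\<Prod>j<n. f (m, j))" for f :: "_ \<Rightarrow> real"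
proof -
  have "row_block m n = Pair m ` {..<n}" by (auto simp: row_block_def)
  thus ?thesis by (simp add: prod.reindex inj_on_def)
qed

lemma prod_col_block: "prod f (col_block m n) = (\<Prod>i<m. f (i, n))" for f :: "_ \<Rightarrow> real"
proof -
  have "col_block m n = (\<lambda>i. (i, n)) ` {..<m}" by (auto simp: col_block_def)
  thus ?thesis by (simp add: prod.reindex inj_on_def)
qed

lemma sum_sign_cube_exp:
  assumes "0 < n"
  shows "(\<Sum>x\<in>sign_cube n. exp (\<Sum>j<n. h j * x j))
    = (\<Prod>j<n. exp (h j / sqrt n) + exp (- (h j / sqrt n)))"
proof -
  have ne: "1 / sqrt n \<noteq> - (1 / sqrt n)"
    using assms by (metis add.inverse_inverse divide_eq_0_iff neg_equal_zero of_nat_0_less_iff order_less_irrefl real_sqrt_eq_zero_cancel_iff zero_neq_one)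
  have "(\<Sum>x\<in>sign_cube n. exp (\<Sum>j<n. h j * x j)) = (\<Sum>x\<in>sign_cube n. \<Prod>j<n. exp (h j * x j))"
    by (simp add: exp_sum)
  also have "\<dots> = (\<Prod>j<n. \<Sum>z\<in>{- (1 / sqrt n), 1 / sqrt n}. exp (h j * z))"
    unfolding sign_cube_def by (rule prod_sum_PiE[symmetric]) auto
  also have "\<dots> = (\<Prod>j<n. exp (h j / sqrt n) + exp (- (h j / sqrt n)))"
    using ne by (intro prod.cong refl) auto
  finally show ?thesis .
qed

locale bipartite =
  fixes m n :: nat and \<beta> p :: real
  assumes m_pos: "0 < m" and n_pos: "0 < n"
    and \<beta>_pos': "0 < \<beta>" and p_pos': "0 < p" and p_le': "p \<le> 1"

sublocale bipartite \<subseteq> gibbs "sign_cube n \<times> sign_cube m" "bordered m n" "bordered_prod m n" \<beta> p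
proof
  have "\<bar>x j\<bar> \<le> 1" if "x \<in> sign_cube N" "j < N" for x N j
  proof -
    have "1 / sqrt N \<le> 1" using that(2) by simp
    thus ?thesis using sign_cubeD[OF that] by (auto simp: abs_if)
  qed
  hence "\<bar>bordered_prod m n s k\<bar> \<le> 1 * 1" if "s \<in> sign_cube n \<times> sign_cube m" for s k
    unfolding bordered_prod_def abs_mult using that by (intro mult_mono) auto
  thus "\<bar>bordered_prod m n s k\<bar> \<le> 1" if "s \<in> sign_cube n \<times> sign_cube m" "k \<in> bordered m n" for s k
    using that by simp
qed (use \<beta>_pos' p_pos' p_le' in \<open>auto simp: sign_cube_finite sign_cube_nonempty finite_bordered\<close>)

context bipartite
begin

abbreviation "C \<equiv> coef m n"
abbreviation "V \<equiv> bordered_prod m n"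

definition dx where "dx s r = cube_dist n (fst s) (fst r)"
definition dy where "dy s r = cube_dist m (snd s) (snd r)"

lemma sum_V_row: "(\<Sum>k\<in>row_block m n. V s k * V r k) = 1 - dx s r"
  by (simp add: sum_row_block bordered_prod_def dx_def cube_dist_def)

lemma sum_V_col: "(\<Sum>k\<in>col_block m n. V s k * V r k) = 1 - dy s r"
  by (simp add: sum_col_block bordered_prod_def dy_def cube_dist_def)

lemma sum_V_mat: "(\<Sum>k\<in>mat_block m n. V s k * V r k) = (1 - dx s r) * (1 - dy s r)"
proof -
  have "(\<Sum>k\<in>mat_block m n. V s k * V r k) = (\<Sum>i<m. \<Sum>j<n. (snd s i * snd r i) * (fst s j * fst r j))"
    unfolding sum_mat_block by (intro sum.cong refl) (simp add: bordered_prod_def mult_ac)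
  also have "\<dots> = (\<Sum>i<m. snd s i * snd r i) * (\<Sum>j<n. fst s j * fst r j)"
    by (simp add: sum_product)
  finally show ?thesis by (simp add: dx_def dy_def cube_dist_def)
qed

lemma dx_nonneg: "\<lbrakk>s \<in> sign_cube n \<times> sign_cube m; r \<in> sign_cube n \<times> sign_cube m\<rbrakk> \<Longrightarrow> 0 \<le> dx s r"
  and dy_nonneg: "\<lbrakk>s \<in> sign_cube n \<times> sign_cube m; r \<in> sign_cube n \<times> sign_cube m\<rbrakk> \<Longrightarrow> 0 \<le> dy s r"
  and dy_le_2: "\<lbrakk>s \<in> sign_cube n \<times> sign_cube m; r \<in> sign_cube n \<times> sign_cube m\<rbrakk> \<Longrightarrow> dy s r \<le> 2"
  unfolding dx_def dy_def using m_pos n_pos by (auto intro!: cube_dist_nonneg cube_dist_le_2)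

lemma dx_self: "s \<in> sign_cube n \<times> sign_cube m \<Longrightarrow> dx s s = 0"
  and dy_self: "s \<in> sign_cube n \<times> sign_cube m \<Longrightarrow> dy s s = 0"
  unfolding dx_def dy_def using m_pos n_pos by (auto intro!: cube_dist_self)

lemma D_cong: "(\<And>k. k \<in> bordered m n \<Longrightarrow> a k = a' k) \<Longrightarrow> D a = D a'"
  unfolding D_def Z_def wt_def by (simp cong: sum.cong)

lemma coef_mat: "k \<in> mat_block m n \<Longrightarrow> C t u w k = t"
  and coef_row: "k \<in> row_block m n \<Longrightarrow> C t u w k = u"
  and coef_col: "k \<in> col_block m n \<Longrightarrow> C t u w k = w"
  by (auto simp: coef_def mat_block_def row_block_def col_block_def)

lemma D_shift_row: "D (\<lambda>k. if k \<in> row_block m n then C t u w k - \<eta> else C t u w k) = D (C t (u - \<eta>) w)"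
  by (rule D_cong) (auto simp: coef_def bordered_def mat_block_def row_block_def col_block_def)

lemma D_shift_col: "D (\<lambda>k. if k \<in> col_block m n then C t u w k - \<eta> else C t u w k) = D (C t u (w - \<eta>))"
  by (rule D_cong) (auto simp: coef_def bordered_def mat_block_def row_block_def col_block_def)

section \<open>The interpolation between the matrix and the two fields\<close>

text \<open>The matrix gains variance at the rate at which each field loses it. The initial
  variances \<open>U\<close> and \<open>W\<close> are independent parameters because a model with
  one lowered field lies on such a path with \<open>U \<noteq> W\<close>.\<close>

abbreviation "gpath U W \<tau> \<equiv> C (sqrt \<tau>) (sqrt (U - \<tau>)) (sqrt (W - \<tau>))"

text \<open>Scale times its derivative is 1/2 on the matrix and -1/2 on each field, and the
  covariances combine to \<open>(1 - dx) * (1 - dy) - (1 - dx) - (1 - dy) = dx * dy - 1\<close>.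
  Equal replicas contribute -1, distinct ones this expression times \<open>p - 1\<close>.\<close>

lemma D_path_deriv:
  assumes "0 < \<tau>" "\<tau> < U" "\<tau> < W"
  shows "((\<lambda>\<tau>. D (gpath U W \<tau>)) has_real_derivative
     - ((p * \<beta>)\<^sup>2 / 2 * D (gpath U W \<tau>) + p * \<beta>\<^sup>2 * (1 - p) / 2 * avg2 (gpath U W \<tau>) (\<lambda>s r. dx s r * dy s r))) (at \<tau>)"
proof -
  let ?S = "sign_cube n \<times> sign_cube m"
  define a' where "a' s = C (inverse (sqrt s) / 2) (- (inverse (sqrt (U - s)) / 2)) (- (inverse (sqrt (W - s)) / 2))" for s
  \<comment> \<open>The interval from \<open>l\<close> to \<open>r\<close> keeps a margin from 0,
    \<open>U\<close> and \<open>W\<close>, where the derivatives of the square roots blow up;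
    \<open>\<delta>\<close> below is that margin.\<close>
  define l where "l = \<tau> / 2"
  define r where "r = (\<tau> + min U W) / 2"
  have lr: "l < \<tau>" "\<tau> < r" "0 < l" "r < U" "r < W" using assms by (auto simp: l_def r_def)
  define \<delta> where "\<delta> = min l (min (U - r) (W - r))"
  have \<delta>: "\<delta> > 0" using lr by (auto simp: \<delta>_def)
  define B where "B = max (sqrt (max r (max U W))) (inverse (sqrt \<delta>))"
  have sqB: "sqrt z \<le> B" if "z \<le> max r (max U W)" for z
    unfolding B_def using real_sqrt_le_mono[OF that] by (rule order_trans) (rule max.cobounded1)
  have inB: "inverse (sqrt z) / 2 \<le> B" "0 < inverse (sqrt z)" if "z \<ge> \<delta>" for z
  proof -
    have "inverse (sqrt z) \<le> inverse (sqrt \<delta>)" using that \<delta> by (simp add: le_imp_inverse_le)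
    moreover have "inverse (sqrt z) > 0" using that \<delta> by simp
    moreover have "inverse (sqrt \<delta>) \<le> B" unfolding B_def by (rule max.cobounded2)
    ultimately show "inverse (sqrt z) / 2 \<le> B" "0 < inverse (sqrt z)" by linarith+
  qed
  have d: "((\<lambda>s. gpath U W s k) has_real_derivative a' s k) (at s)" if "l < s" "s < r" for s k
  proof -
    have "((\<lambda>s. sqrt (U - s)) has_real_derivative - (inverse (sqrt (U - s)) / 2)) (at s)"
         "((\<lambda>s. sqrt (W - s)) has_real_derivative - (inverse (sqrt (W - s)) / 2)) (at s)"
         "(sqrt has_real_derivative inverse (sqrt s) / 2) (at s)"
      using that lr by (auto intro!: derivative_eq_intros)
    thus ?thesis by (simp add: coef_def a'_def)
  qed
  have "((\<lambda>s. D (gpath U W s)) has_real_derivative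
     p * \<beta>\<^sup>2 * (\<Sum>k\<in>bordered m n. gpath U W \<tau> k * a' \<tau> k * avg2 (gpath U W \<tau>) (\<lambda>s r. V s k * (V s k + (p - 1) * V r k)))) (at \<tau>)"
  proof (rule D_has_derivative[OF lr(1,2) d])
    fix s k assume s: "l < s" "s < r"
    have "0 \<le> sqrt s" "0 \<le> sqrt (U - s)" "0 \<le> sqrt (W - s)" using s lr by auto
    moreover have "sqrt s \<le> B" "sqrt (U - s) \<le> B" "sqrt (W - s) \<le> B" using s lr by (auto intro!: sqB)
    ultimately show "\<bar>gpath U W s k\<bar> \<le> B" by (simp add: coef_def)
    have "s \<ge> \<delta>" "U - s \<ge> \<delta>" "W - s \<ge> \<delta>" using s by (auto simp: \<delta>_def)
    thus "\<bar>a' s k\<bar> \<le> B" using inB[of s] inB[of "U - s"] inB[of "W - s"]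
      by (simp add: coef_def a'_def)
  qed auto
  also have "(\<Sum>k\<in>bordered m n. gpath U W \<tau> k * a' \<tau> k * avg2 (gpath U W \<tau>) (\<lambda>s r. V s k * (V s k + (p - 1) * V r k)))
     = avg2 (gpath U W \<tau>) (\<lambda>s r. \<Sum>k\<in>bordered m n. gpath U W \<tau> k * a' \<tau> k * (V s k * (V s k + (p - 1) * V r k)))"
    by (simp add: avg2_sum[OF finite_bordered] avg2_cmult)
  also have "\<dots> = avg2 (gpath U W \<tau>) (\<lambda>s r. - (p / 2) + (- ((1 - p) / 2)) * (dx s r * dy s r))"
  proof (rule avg2_cong)
    fix s r assume sr: "s \<in> ?S" "r \<in> ?S"
    have *: "(\<Sum>k\<in>J. gpath U W \<tau> k * a' \<tau> k * (V s k * (V s k + (p - 1) * V r k)))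
        = c * ((\<Sum>k\<in>J. V s k * V s k) + (p - 1) * (\<Sum>k\<in>J. V s k * V r k))"
      if "\<And>k. k \<in> J \<Longrightarrow> gpath U W \<tau> k * a' \<tau> k = c" for J c
      using that by (simp add: sum_distrib_left sum.distrib[symmetric] algebra_simps)
    have h: "sqrt z * (inverse (sqrt z) / 2) = 1 / 2" if "z > 0" for z :: real
      using that by (simp add: field_simps)
    have "(\<Sum>k\<in>mat_block m n. gpath U W \<tau> k * a' \<tau> k * (V s k * (V s k + (p - 1) * V r k)))
        = 1/2 * ((\<Sum>k\<in>mat_block m n. V s k * V s k) + (p - 1) * (\<Sum>k\<in>mat_block m n. V s k * V r k))"
      using assms h[of \<tau>] by (intro *) (simp add: a'_def coef_mat)
    moreover have "(\<Sum>k\<in>row_block m n. gpath U W \<tau> k * a' \<tau> k * (V s k * (V s k + (p - 1) * V r k)))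
        = (- 1/2) * ((\<Sum>k\<in>row_block m n. V s k * V s k) + (p - 1) * (\<Sum>k\<in>row_block m n. V s k * V r k))"
      using assms h[of "U - \<tau>"] by (intro *) (simp add: a'_def coef_row)
    moreover have "(\<Sum>k\<in>col_block m n. gpath U W \<tau> k * a' \<tau> k * (V s k * (V s k + (p - 1) * V r k)))
        = (- 1/2) * ((\<Sum>k\<in>col_block m n. V s k * V s k) + (p - 1) * (\<Sum>k\<in>col_block m n. V s k * V r k))"
      using assms h[of "W - \<tau>"] by (intro *) (simp add: a'_def coef_col)
    ultimately have "(\<Sum>k\<in>bordered m n. gpath U W \<tau> k * a' \<tau> k * (V s k * (V s k + (p - 1) * V r k)))
       = 1/2 * ((1 - dx s s) * (1 - dy s s) + (p - 1) * ((1 - dx s r) * (1 - dy s r)))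
         + (- 1/2) * ((1 - dx s s) + (p - 1) * (1 - dx s r))
         + (- 1/2) * ((1 - dy s s) + (p - 1) * (1 - dy s r))"
      by (simp only: sum_bordered sum_V_row sum_V_col sum_V_mat)
    also have "\<dots> = - (p / 2) + (- ((1 - p) / 2)) * (dx s r * dy s r)"
      using sr by (simp add: dx_self dy_self field_simps)
    finally show "(\<Sum>k\<in>bordered m n. gpath U W \<tau> k * a' \<tau> k * (V s k * (V s k + (p - 1) * V r k)))
       = - (p / 2) + (- ((1 - p) / 2)) * (dx s r * dy s r)" .
  qed
  also have "\<dots> = - (p / 2) * D (gpath U W \<tau>) - (1 - p) / 2 * avg2 (gpath U W \<tau>) (\<lambda>s r. dx s r * dy s r)"
    unfolding avg2_add avg2_cmult avg2_const by simp
  finally show ?thesis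
    by (rule DERIV_cong) (simp add: power2_eq_square algebra_simps)
qed

lemma avg2_prod_dist_nonneg: "avg2 a (\<lambda>s r. dx s r * dy s r) \<ge> 0"
  using avg2_mono[of "\<lambda>_ _. 0" "\<lambda>s r. dx s r * dy s r" a] avg2_const[of a 0]
  by (simp add: dx_nonneg dy_nonneg)

text \<open>The gap hypothesis makes \<open>exp (c * \<tau>) * D (gpath U W \<tau>)\<close>
  nonincreasing, where the local \<open>c\<close> is the resulting decay rate. The derivative is
  used in the open interval only, with continuity at its ends.\<close>

lemma D_path_comparison:
  assumes t: "0 \<le> t0" "t0 \<le> t1" "t1 \<le> U" "t1 \<le> W"
    and gap: "\<And>\<tau>. \<lbrakk>t0 < \<tau>; \<tau> < t1\<rbrakk> \<Longrightarrow> \<kappa> * D (gpath U W \<tau>) \<le> avg2 (gpath U W \<tau>) (\<lambda>s r. dx s r * dy s r)"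
  shows "exp (((p * \<beta>)\<^sup>2 / 2 + p * \<beta>\<^sup>2 * (1 - p) / 2 * \<kappa>) * (t1 - t0)) * D (gpath U W t1) \<le> D (gpath U W t0)"
proof -
  define c where "c = (p * \<beta>)\<^sup>2 / 2 + p * \<beta>\<^sup>2 * (1 - p) / 2 * \<kappa>"
  have "exp (c * t1) * D (gpath U W t1) \<le> exp (c * t0) * D (gpath U W t0)"
  proof (rule DERIV_nonpos_imp_decreasing_open[OF t(2), of "\<lambda>\<tau>. exp (c * \<tau>) * D (gpath U W \<tau>)"])
    fix \<tau> assume \<tau>: "t0 < \<tau>" "\<tau> < t1"
    let ?P = "avg2 (gpath U W \<tau>) (\<lambda>s r. dx s r * dy s r)"
    have "((\<lambda>\<tau>. exp (c * \<tau>) * D (gpath U W \<tau>)) has_real_derivative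
        c * exp (c * \<tau>) * D (gpath U W \<tau>)
        + - ((p * \<beta>)\<^sup>2 / 2 * D (gpath U W \<tau>) + p * \<beta>\<^sup>2 * (1 - p) / 2 * ?P) * exp (c * \<tau>)) (at \<tau>)"
      using \<tau> t by (intro DERIV_mult D_path_deriv) (auto intro!: derivative_eq_intros)
    moreover have "c * exp (c * \<tau>) * D (gpath U W \<tau>)
        + - ((p * \<beta>)\<^sup>2 / 2 * D (gpath U W \<tau>) + p * \<beta>\<^sup>2 * (1 - p) / 2 * ?P) * exp (c * \<tau>)
      = exp (c * \<tau>) * (p * \<beta>\<^sup>2 * (1 - p) / 2 * (\<kappa> * D (gpath U W \<tau>) - ?P))"
      by (simp add: c_def algebra_simps)
    moreover have "exp (c * \<tau>) * (p * \<beta>\<^sup>2 * (1 - p) / 2 * (\<kappa> * D (gpath U W \<tau>) - ?P)) \<le> 0"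
      using gap[OF \<tau>] p_pos p_le by (intro mult_nonneg_nonpos) auto
    ultimately show "\<exists>y. ((\<lambda>\<tau>. exp (c * \<tau>) * D (gpath U W \<tau>)) has_real_derivative y) (at \<tau>) \<and> y \<le> 0"
      by auto
  next
    define B where "B = sqrt (max t1 (max U W))"
    have sqB: "sqrt z \<le> B" if "z \<le> max t1 (max U W)" for z
      unfolding B_def by (rule real_sqrt_le_mono[OF that])
    have "continuous_on {t0..t1} (\<lambda>\<tau>. D (gpath U W \<tau>))"
    proof (rule D_continuous_on[where B = B])
      show "continuous_on {t0..t1} (\<lambda>s. gpath U W s k)" for k
      proof -
        have "continuous_on {t0..t1} (\<lambda>s. if fst k < m then if snd k < n then sqrt s else sqrt (W - s) else sqrt (U - s))"
          by (cases "fst k < m"; cases "snd k < n") (auto intro!: continuous_intros)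
        thus ?thesis by (simp add: coef_def)
      qed
      fix s k assume s: "s \<in> {t0..t1}"
      have "0 \<le> sqrt s" "0 \<le> sqrt (U - s)" "0 \<le> sqrt (W - s)" using s t by auto
      moreover have "sqrt s \<le> B" "sqrt (U - s) \<le> B" "sqrt (W - s) \<le> B" using s t by (auto intro!: sqB)
      ultimately show "\<bar>gpath U W s k\<bar> \<le> B" by (simp add: coef_def)
    qed
    thus "continuous_on {t0..t1} (\<lambda>\<tau>. exp (c * \<tau>) * D (gpath U W \<tau>))"
      by (intro continuous_intros)
  qed
  hence "exp (- (c * t0)) * (exp (c * t1) * D (gpath U W t1)) \<le> exp (- (c * t0)) * (exp (c * t0) * D (gpath U W t0))"
    by (rule mult_left_mono) simp
  thus ?thesis unfolding c_def[symmetric]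
    by (simp add: mult.assoc[symmetric] exp_add[symmetric] algebra_simps)
qed

lemma gordon_comparison:
  assumes "0 \<le> t0" "t0 \<le> t1" "t1 \<le> U" "t1 \<le> W"
  shows "exp ((p * \<beta>)\<^sup>2 / 2 * (t1 - t0)) * D (gpath U W t1) \<le> D (gpath U W t0)"
  using D_path_comparison[OF assms, of 0] avg2_prod_dist_nonneg by simp

text \<open>Without the matrix the sum over sign vectors is a product over coordinates, and
  independence carries the factorisation through the power \<open>p\<close> and the
  expectation.\<close>

lemma D_decoupled:
  "D (C 0 u w) = (\<integral>x. (exp (\<beta> * u * x / sqrt n) + exp (- (\<beta> * u * x / sqrt n))) powr p \<partial>std_normal_distribution) ^ n
     * (\<integral>x. (exp (\<beta> * w * x / sqrt m) + exp (- (\<beta> * w * x / sqrt m))) powr p \<partial>std_normal_distribution) ^ m"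
proof -
  define ch where "ch z = exp z + exp (- z)" for z :: real
  have ch: "ch z > 0" for z unfolding ch_def by (simp add: add_pos_pos)
  define f where "f k x = (if k \<in> row_block m n then ch (\<beta> * u * x / sqrt n) powr p
      else if k \<in> col_block m n then ch (\<beta> * w * x / sqrt m) powr p else 1)" for k x
  have Z: "Z (C 0 u w) g powr p = (\<Prod>k\<in>bordered m n. f k (g k))" for g
  proof -
    have "Z (C 0 u w) g = (\<Sum>x\<in>sign_cube n. \<Sum>y\<in>sign_cube m.
        exp (\<Sum>j<n. (\<beta> * u * g (m, j)) * x j) * exp (\<Sum>i<m. (\<beta> * w * g (i, n)) * y i))"
      unfolding Z_def wt_def sum.cartesian_product
    proof (intro sum.cong refl, clarify)
      fix x y
      have "(\<Sum>k\<in>bordered m n. C 0 u w k * g k * V (x, y) k) = (\<Sum>j<n. u * g (m, j) * x j) + (\<Sum>i<m. w * g (i, n) * y i)"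
        unfolding sum_bordered
        by (simp add: sum_row_block sum_col_block sum_mat_block coef_def bordered_prod_def)
      thus "exp (\<beta> * (\<Sum>k\<in>bordered m n. C 0 u w k * g k * V (x, y) k))
          = exp (\<Sum>j<n. (\<beta> * u * g (m, j)) * x j) * exp (\<Sum>i<m. (\<beta> * w * g (i, n)) * y i)"
        by (simp add: exp_add[symmetric] ring_distribs sum_distrib_left mult_ac)
    qed
    also have "\<dots> = (\<Sum>x\<in>sign_cube n. exp (\<Sum>j<n. (\<beta> * u * g (m, j)) * x j)) * (\<Sum>y\<in>sign_cube m. exp (\<Sum>i<m. (\<beta> * w * g (i, n)) * y i))"
      by (simp add: sum_product)
    also have "\<dots> = (\<Prod>j<n. ch (\<beta> * u * g (m, j) / sqrt n)) * (\<Prod>i<m. ch (\<beta> * w * g (i, n) / sqrt m))"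
      unfolding sum_sign_cube_exp[OF n_pos] sum_sign_cube_exp[OF m_pos] ch_def ..
    finally have Z: "Z (C 0 u w) g = \<dots>" .
    have "(\<Prod>k\<in>bordered m n. f k (g k)) = (\<Prod>j<n. ch (\<beta> * u * g (m, j) / sqrt n) powr p) * (\<Prod>i<m. ch (\<beta> * w * g (i, n) / sqrt m) powr p)"
    proof -
      have "(\<Prod>k\<in>mat_block m n. f k (g k)) = 1"
        by (rule prod.neutral) (auto simp: f_def mat_block_def row_block_def col_block_def)
      moreover have "(\<Prod>k\<in>row_block m n. f k (g k)) = (\<Prod>j<n. ch (\<beta> * u * g (m, j) / sqrt n) powr p)"
        unfolding prod_row_block by (intro prod.cong) (auto simp: f_def row_block_def)
      moreover have "(\<Prod>k\<in>col_block m n. f k (g k)) = (\<Prod>i<m. ch (\<beta> * w * g (i, n) / sqrt m) powr p)"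
        unfolding prod_col_block by (intro prod.cong) (auto simp: f_def row_block_def col_block_def)
      ultimately show ?thesis unfolding prod_bordered by simp
    qed
    thus ?thesis unfolding Z
      using ch by (simp add: powr_mult prod_nonneg less_imp_le prod_powr_distrib)
  qed
  have chint: "integrable std_normal_distribution (\<lambda>x. ch (c * x) powr p)" for c
  proof (rule Bochner_Integration.integrable_bound)
    show "integrable std_normal_distribution (\<lambda>x. 2 powr p * exp ((\<bar>c\<bar> * p) * \<bar>x\<bar>))"
      by (intro integrable_mult_right integrable_exp_abs_std_normal)
    have "ch (c * x) powr p \<le> 2 powr p * exp ((\<bar>c\<bar> * p) * \<bar>x\<bar>)" for x
    proof -
      have "c * x \<le> \<bar>c\<bar> * \<bar>x\<bar>" "- (c * x) \<le> \<bar>c\<bar> * \<bar>x\<bar>" by (auto simp: abs_mult[symmetric])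
      hence "exp (c * x) \<le> exp (\<bar>c\<bar> * \<bar>x\<bar>)" "exp (- (c * x)) \<le> exp (\<bar>c\<bar> * \<bar>x\<bar>)" by simp_all
      hence "ch (c * x) \<le> 2 * exp (\<bar>c\<bar> * \<bar>x\<bar>)" unfolding ch_def by linarith
      hence "ch (c * x) powr p \<le> (2 * exp (\<bar>c\<bar> * \<bar>x\<bar>)) powr p"
        using p_pos ch[of "c * x"] by (intro powr_mono2) auto
      thus ?thesis by (simp add: powr_mult exp_powr_real mult_ac)
    qed
    thus "AE x in std_normal_distribution. norm (ch (c * x) powr p) \<le> norm (2 powr p * exp ((\<bar>c\<bar> * p) * \<bar>x\<bar>))"
      by simp
  qed (simp add: ch_def)
  have fint: "integrable std_normal_distribution (f k)" for k
    using chint[of "\<beta> * u / sqrt n"] chint[of "\<beta> * w / sqrt m"]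
    by (cases "k \<in> row_block m n"; cases "k \<in> col_block m n") (simp_all add: f_def[abs_def])
  have "D (C 0 u w) = (\<Prod>k\<in>bordered m n. \<integral>x. f k x \<partial>std_normal_distribution)"
    unfolding D_def Z by (rule integral_gauss_prod[OF finite_bordered fint])
  also have "\<dots> = (\<integral>x. ch (\<beta> * u * x / sqrt n) powr p \<partial>std_normal_distribution) ^ n
     * (\<integral>x. ch (\<beta> * w * x / sqrt m) powr p \<partial>std_normal_distribution) ^ m"
  proof -
    have "(\<Prod>k\<in>mat_block m n. \<integral>x. f k x \<partial>std_normal_distribution) = 1"
      by (rule prod.neutral) (auto simp: f_def mat_block_def row_block_def col_block_def std_normal.prob_space[simplified])
    moreover have "(\<Prod>k\<in>row_block m n. \<integral>x. f k x \<partial>std_normal_distribution) = (\<integral>x. ch (\<beta> * u * x / sqrt n) powr p \<partial>std_normal_distribution) ^ n"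
    proof -
      have "f (m, j) = (\<lambda>x. ch (\<beta> * u * x / sqrt n) powr p)" if "j < n" for j
        using that by (simp add: fun_eq_iff f_def row_block_def)
      thus ?thesis unfolding prod_row_block by simp
    qed
    moreover have "(\<Prod>k\<in>col_block m n. \<integral>x. f k x \<partial>std_normal_distribution) = (\<integral>x. ch (\<beta> * w * x / sqrt m) powr p \<partial>std_normal_distribution) ^ m"
    proof -
      have "f (i, n) = (\<lambda>x. ch (\<beta> * w * x / sqrt m) powr p)" if "i < m" for i
        using that by (simp add: fun_eq_iff f_def row_block_def col_block_def)
      thus ?thesis unfolding prod_col_block by simp
    qed
    ultimately show ?thesis unfolding prod_bordered by simp
  qed
  finally show ?thesis unfolding ch_def .
qed

section \<open>From large fields to large distances\<close>

text \<open>The field lower bound with weight 1, evaluated by integration by parts. With covariance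
  \<open>1 - dy\<close> the three terms add up to \<open>p - dy s r + (2 - p) * dy s u\<close>, and
  both pairs have the same average.\<close>

lemma avg2_dy_lower_bound:
  assumes "\<eta> > 0"
  shows "y * D (C t u w) - 1 / (p * \<beta> * \<eta>) * exp (p * \<beta> * \<eta> * y) * D (C t u (w - \<eta>))
    \<le> \<beta> * w * (p * D (C t u w) + (1 - p) * avg2 (C t u w) dy)"
proof -
  let ?a = "C t u w"
  have J: "col_block m n \<subseteq> bordered m n" by (auto simp: bordered_def)
  have c: "\<And>k. k \<in> col_block m n \<Longrightarrow> ?a k = w" by (rule coef_col)
  have "y * avg2 ?a (\<lambda>_ _. 1) - 1 / (p * \<beta> * \<eta>) * exp (p * \<beta> * \<eta> * y) * D (C t u (w - \<eta>))
     \<le> \<beta> * w * avg3 ?a (\<lambda>s r u. 1 * ((1 - dy s s) + (1 - dy s r) + (p - 2) * (1 - dy s u)))"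
    using order_trans[OF avg2_field_lower_bound[where a = ?a and W = "\<lambda>_ _. 1" and w = 1 and y = y, OF J c assms]
      eq_refl[OF avg2_field_integration_by_parts(1)[where a = ?a and W = "\<lambda>_ _. 1", OF J c]]]
    by (simp add: D_shift_col sum_V_col)
  also have "avg3 ?a (\<lambda>s r u. 1 * ((1 - dy s s) + (1 - dy s r) + (p - 2) * (1 - dy s u)))
     = avg3 ?a (\<lambda>s r u. (p + (- 1) * dy s r) + (2 - p) * dy s u)"
    by (rule avg3_cong) (simp add: dy_self algebra_simps)
  also have "\<dots> = p * D ?a + (1 - p) * avg2 ?a dy"
    unfolding avg3_add avg3_cmult avg3_12[of _ dy] avg3_13[of _ dy] avg3_12[of _ "\<lambda>_ _. p"] avg2_const
    by (simp add: algebra_simps)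
  finally show ?thesis by (simp add: avg2_const)
qed

text \<open>The same for the other field with weight \<open>dy\<close>, whose maximum 2 is the
  factor of the error term. Integration by parts now yields \<open>dy s r * dx s z\<close> over two
  different pairs; \<open>cross_distance_le\<close>, doubled because \<open>2 - p \<le> 2\<close>,
  gives the total 4 + 4 + 8 = 16.\<close>

lemma avg2_prod_dist_lower_bound:
  assumes "\<eta> > 0" "u \<ge> 0"
  shows "y * avg2 (C t u w) dy - 2 / (p * \<beta> * \<eta>) * exp (p * \<beta> * \<eta> * y) * D (C t (u - \<eta>) w)
    \<le> \<beta> * u * (p * avg2 (C t u w) dy + 16 * avg2 (C t u w) (\<lambda>s r. dx s r * dy s r))"
proof -
  let ?a = "C t u w" and ?S = "sign_cube n \<times> sign_cube m"
  let ?P = "\<lambda>s r. dx s r * dy s r"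
  have J: "row_block m n \<subseteq> bordered m n" by (auto simp: bordered_def)
  have c: "\<And>k. k \<in> row_block m n \<Longrightarrow> ?a k = u" by (rule coef_row)
  have "y * avg2 ?a dy - 2 / (p * \<beta> * \<eta>) * exp (p * \<beta> * \<eta> * y) * D (C t (u - \<eta>) w)
     \<le> \<beta> * u * avg3 ?a (\<lambda>s r z. dy s r * ((1 - dx s s) + (1 - dx s r) + (p - 2) * (1 - dx s z)))"
    using avg2_field_lower_bound[where a = ?a and W = dy and w = 2 and y = y, OF J c assms(1)]
    by (simp add: D_shift_row avg2_field_integration_by_parts(1)[where a = ?a, OF J c] sum_V_row dy_nonneg dy_le_2)
  also have "\<dots> \<le> \<beta> * u * avg3 ?a (\<lambda>s r z. (p * dy s r + 4 * ?P s r) + (4 * ?P s z + 8 * ?P r z))"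
  proof (intro mult_left_mono avg3_mono)
    fix s r z assume sr: "s \<in> ?S" "r \<in> ?S" "z \<in> ?S"
    have "dy s r * ((1 - dx s s) + (1 - dx s r) + (p - 2) * (1 - dx s z)) = dy s r * p - dy s r * dx s r + (2 - p) * (dy s r * dx s z)"
      using sr by (simp add: dx_self algebra_simps)
    also have "\<dots> \<le> dy s r * p + 2 * (dy s r * dx s z)"
    proof -
      have "(2 - p) * (dy s r * dx s z) \<le> 2 * (dy s r * dx s z)"
        using sr p_pos by (intro mult_right_mono) (auto simp: dx_nonneg dy_nonneg)
      moreover have "0 \<le> dy s r * dx s r" using sr by (simp add: dx_nonneg dy_nonneg)
      ultimately show ?thesis by linarith
    qed
    also have "dy s r * dx s z \<le> 2 * (dx s r * dy s r) + 2 * (dx s z * dy s z) + 4 * (dx r z * dy r z)"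
    proof (rule cross_distance_le)
      have sym: "dy z r = dy r z" by (simp add: dy_def cube_dist_def mult.commute)
      show "dx s z \<le> dx s r + dx r z"
        unfolding dx_def using sr n_pos by (intro cube_dist_triangle) auto
      have "dy s r \<le> dy s z + dy z r"
        unfolding dy_def using sr m_pos by (intro cube_dist_triangle) auto
      thus "dy s r \<le> dy s z + dy r z" unfolding sym .
    qed (use sr in \<open>auto simp: dx_nonneg dy_nonneg\<close>)
    finally show "dy s r * ((1 - dx s s) + (1 - dx s r) + (p - 2) * (1 - dx s z))
        \<le> (p * dy s r + 4 * ?P s r) + (4 * ?P s z + 8 * ?P r z)" by (simp add: algebra_simps)
  qed (use \<beta>_pos assms in auto)
  also have "avg3 ?a (\<lambda>s r z. (p * dy s r + 4 * ?P s r) + (4 * ?P s z + 8 * ?P r z))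
      = p * avg2 ?a dy + 16 * avg2 ?a ?P"
    unfolding avg3_add avg3_cmult avg3_12[of _ dy] avg3_12[of _ ?P] avg3_13[of _ ?P] avg3_23[of _ ?P] by simp
  finally show ?thesis .
qed

end

section \<open>One-dimensional moments and the error function\<close>

lemma erfc_neg_eq_lborel:
  "erfc (- z) = 2 / sqrt pi * (\<integral>t. indicator {- z..} t * exp (- t\<^sup>2) \<partial>lborel)"
proof -
  have "integrable lborel (\<lambda>x. sqrt (2 * pi * (1 / sqrt 2)\<^sup>2) * normal_density 0 (1 / sqrt 2) x)"
    by (intro integrable_mult_right integrable_normal_density) simp
  hence "integrable lborel (\<lambda>t::real. exp (- t\<^sup>2))"
    by (simp add: normal_density_def power_divide)
  hence "set_integrable lborel {- z..} (\<lambda>t. exp (- t\<^sup>2))"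
    unfolding set_integrable_def by (intro integrable_mult_indicator) auto
  from set_borel_integral_eq_integral(2)[OF this] show ?thesis
    by (simp add: erfc_def set_lebesgue_integral_def)
qed

definition exp_abs_moment :: "real \<Rightarrow> real" where
  "exp_abs_moment c = (\<integral>x. exp (c * \<bar>x\<bar>) \<partial>std_normal_distribution)"

text \<open>Completing the square on the half-line \<open>x \<ge> 0\<close>, with the substitution
  \<open>t = (x - c) / sqrt 2\<close>, and doubling by symmetry.\<close>

lemma exp_abs_moment_eq: "exp_abs_moment c = exp (c\<^sup>2 / 2) * erfc (- (c / sqrt 2))"
proof -
  define f where "f x = std_normal_density x * exp (c * \<bar>x\<bar>)" for x
  have f: "integrable lborel f"
    using integrable_exp_abs_std_normal[of c] unfolding f_def by (subst (asm) integrable_density) auto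
  have "(\<integral>t. indicator {- (c / sqrt 2)..} t * exp (- t\<^sup>2) \<partial>lborel)
      = \<bar>1 / sqrt 2\<bar> *\<^sub>R (\<integral>x. indicator {- (c / sqrt 2)..} (- (c / sqrt 2) + 1 / sqrt 2 * x)
          * exp (- (- (c / sqrt 2) + 1 / sqrt 2 * x)\<^sup>2) \<partial>lborel)"
    by (rule lborel_integral_real_affine) simp
  also have "(\<integral>x. indicator {- (c / sqrt 2)..} (- (c / sqrt 2) + 1 / sqrt 2 * x)
          * exp (- (- (c / sqrt 2) + 1 / sqrt 2 * x)\<^sup>2) \<partial>lborel)
      = (\<integral>x. (exp (- (c\<^sup>2 / 2)) * sqrt (2 * pi)) * (indicator {0..} x *\<^sub>R f x) \<partial>lborel)"
  proof (rule Bochner_Integration.integral_cong[OF refl])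
    fix x :: real
    have "- (- (c / sqrt 2) + 1 / sqrt 2 * x)\<^sup>2 = - (c\<^sup>2 / 2) + c * x + - x\<^sup>2 / 2"
      by (simp add: power2_eq_square field_simps)
    hence "exp (- (- (c / sqrt 2) + 1 / sqrt 2 * x)\<^sup>2) = exp (- (c\<^sup>2 / 2)) * exp (c * x) * exp (- x\<^sup>2 / 2)"
      by (simp only: exp_add)
    moreover have "indicator {- (c / sqrt 2)..} (- (c / sqrt 2) + 1 / sqrt 2 * x) = (indicator {0..} x :: real)"
      by (simp add: indicator_def zero_le_divide_iff)
    ultimately show "indicator {- (c / sqrt 2)..} (- (c / sqrt 2) + 1 / sqrt 2 * x)
          * exp (- (- (c / sqrt 2) + 1 / sqrt 2 * x)\<^sup>2) = (exp (- (c\<^sup>2 / 2)) * sqrt (2 * pi)) * (indicator {0..} x *\<^sub>R f x)"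
      by (simp add: f_def std_normal_density_def indicator_def)
  qed
  finally have *: "(\<integral>t. indicator {- (c / sqrt 2)..} t * exp (- t\<^sup>2) \<partial>lborel)
     = exp (- (c\<^sup>2 / 2)) * sqrt pi * (\<integral>x. indicator {0..} x *\<^sub>R f x \<partial>lborel)"
    by (simp add: real_sqrt_mult)
  have "has_bochner_integral lborel (\<lambda>x. indicator {0..} x *\<^sub>R f x) (\<integral>x. indicator {0..} x *\<^sub>R f x \<partial>lborel)"
    using f by (intro has_bochner_integral_integrable integrable_mult_indicator) auto
  hence "has_bochner_integral lborel f (2 *\<^sub>R (\<integral>x. indicator {0..} x *\<^sub>R f x \<partial>lborel))"
    by (rule has_bochner_integral_even_function) (simp add: f_def normal_density_def)
  hence "(\<integral>x. f x \<partial>lborel) = 2 * (\<integral>x. indicator {0..} x *\<^sub>R f x \<partial>lborel)"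
    by (simp add: has_bochner_integral_integral_eq)
  also have "\<dots> = exp (c\<^sup>2 / 2) * erfc (- (c / sqrt 2))"
    unfolding erfc_neg_eq_lborel * by (simp add: exp_minus field_simps)
  finally show ?thesis
    unfolding exp_abs_moment_def f_def by (subst integral_density) auto
qed

lemma exp_abs_moment_ge_1: "c \<ge> 0 \<Longrightarrow> exp_abs_moment c \<ge> 1"
  using mult_mono[of 1 "exp (c\<^sup>2 / 2)" 1 "erfc (- (c / sqrt 2))"] erfc_neg_ge_1[of "c / sqrt 2"]
  by (simp add: exp_abs_moment_eq)

text \<open>The normal density is at most 1/2, and \<open>exp (- (l * \<bar>x\<bar>))\<close> has
  Lebesgue integral \<open>2 / l\<close>, being a symmetrised exponential density divided by
  \<open>l\<close>.\<close>

lemma exp_abs_moment_neg_le: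
  assumes "l > 0"
  shows "(\<integral>x. exp (- (l * \<bar>x\<bar>)) \<partial>std_normal_distribution) \<le> 1 / l"
proof -
  let ?E = "exponential_density l"
  interpret E: prob_space "density lborel ?E" by (rule prob_space_exponential_density[OF assms])
  have "(\<integral>\<^sup>+x. ennreal (?E x) \<partial>lborel) = ennreal 1"
    using E.emeasure_space_1 by (simp add: emeasure_density)
  hence E: "has_bochner_integral lborel ?E 1"
    using assms by (intro has_bochner_integral_nn_integral) (auto simp: exponential_density_nonneg)
  define f where "f x = exp (- (l * \<bar>x\<bar>))" for x
  have "has_bochner_integral lborel (\<lambda>x. ?E x / l) (1 / l)"
    using E by (rule has_bochner_integral_divide_zero)
  moreover have "(\<lambda>x. ?E x / l) = (\<lambda>x. indicator {0..} x *\<^sub>R f x)"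
    using assms by (auto simp: f_def exponential_density_def indicator_def mult.commute)
  ultimately have "has_bochner_integral lborel (\<lambda>x. indicator {0..} x *\<^sub>R f x) (1 / l)" by simp
  hence f: "has_bochner_integral lborel f (2 *\<^sub>R (1 / l))"
    by (rule has_bochner_integral_even_function) (simp add: f_def)
  have "(\<integral>x. f x \<partial>std_normal_distribution) = (\<integral>x. std_normal_density x * f x \<partial>lborel)"
    by (subst integral_density) (auto simp: f_def[abs_def])
  also have "\<dots> \<le> (\<integral>x. (1 / 2) * f x \<partial>lborel)"
  proof (rule integral_mono')
    show "integrable lborel (\<lambda>x. 1 / 2 * f x)" using f by (auto simp: has_bochner_integral_iff)
    fix x :: real
    have "2 \<le> sqrt (2 * pi)" using pi_gt3 by (intro real_le_rsqrt) simp
    hence "1 / sqrt (2 * pi) \<le> 1 / 2" by (intro divide_left_mono) auto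
    moreover have "exp (- x\<^sup>2 / 2) \<le> 1" by simp
    ultimately have "std_normal_density x \<le> 1 / 2 * 1" unfolding std_normal_density_def by (intro mult_mono) auto
    thus "std_normal_density x * f x \<le> 1 / 2 * f x" by (intro mult_right_mono) (auto simp: f_def)
  qed (auto simp: f_def)
  also have "\<dots> = 1 / l" using f by (simp add: has_bochner_integral_iff)
  finally show ?thesis by (simp add: f_def)
qed

section \<open>Softened moments of the absolute value\<close>

text \<open>The factor contributed by one coordinate to the decoupled partition function; for
  \<open>u > 0\<close> the integrand tends to \<open>exp (c * u * \<bar>x\<bar>)\<close> as
  \<open>b\<close> grows.\<close>

definition soft_moment :: "real \<Rightarrow> real \<Rightarrow> real \<Rightarrow> real" where
  "soft_moment b c u = (\<integral>x. (exp (b * u * x) + exp (- (b * u * x))) powr (c / b) \<partial>std_normal_distribution)"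

text \<open>Source of the loss of order \<open>1 / b\<^sup>2\<close>: after factoring out
  \<open>exp (b * u * \<bar>x\<bar>)\<close>, the excess has height of order \<open>1 / b\<close>
  and lives on \<open>\<bar>x\<bar>\<close> of order \<open>1 / b\<close>.\<close>

lemma two_cosh_powr_bounds:
  fixes b c u x :: real
  assumes "0 < c" "c \<le> b" "0 < u"
  shows "exp (c * u * \<bar>x\<bar>) \<le> (exp (b * u * x) + exp (- (b * u * x))) powr (c / b)"
    and "(exp (b * u * x) + exp (- (b * u * x))) powr (c / b)
      \<le> exp (c * u * \<bar>x\<bar>) + c * exp 1 / b * exp (- (b * u * \<bar>x\<bar>))"
proof -
  have b: "b > 0" using assms by simp
  define z where "z = b * u * \<bar>x\<bar>"
  have z: "z \<ge> 0" using b assms by (simp add: z_def)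
  have ch: "exp (b * u * x) + exp (- (b * u * x)) = exp z * (1 + exp (- 2 * z))"
    by (simp add: z_def abs_if ring_distribs exp_add[symmetric])
  have "(exp (b * u * x) + exp (- (b * u * x))) powr (c / b) = exp (z * (c / b)) * (1 + exp (- 2 * z)) powr (c / b)"
    unfolding ch by (subst powr_mult) (auto simp: exp_powr_real add_nonneg_nonneg)
  moreover have "z * (c / b) = c * u * \<bar>x\<bar>" using b by (simp add: z_def)
  ultimately have eq: "(exp (b * u * x) + exp (- (b * u * x))) powr (c / b)
      = exp (c * u * \<bar>x\<bar>) * (1 + exp (- 2 * z)) powr (c / b)" by simp
  have "1 powr (c / b) \<le> (1 + exp (- 2 * z)) powr (c / b)"
    using assms b by (intro powr_mono2) auto
  thus "exp (c * u * \<bar>x\<bar>) \<le> (exp (b * u * x) + exp (- (b * u * x))) powr (c / b)"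
    unfolding eq by simp
  define e where "e = exp (- 2 * z)"
  have e: "0 < e" "e \<le> 1" using z by (auto simp: e_def)
  have "(1 + e) powr (c / b) \<le> exp e powr (c / b)"
    using assms b e exp_ge_add_one_self[of e] by (intro powr_mono2) auto
  also have "\<dots> = exp (c / b * e)" by (simp add: exp_powr_real mult.commute)
  \<comment> \<open>The inequality \<open>exp t \<le> 1 + t * exp t\<close>, which is
    \<open>1 - t \<le> exp (- t)\<close> multiplied by \<open>exp t\<close>; next
    \<open>t \<le> 1\<close> bounds the second factor by \<open>exp 1\<close>.\<close>
  also have "\<dots> \<le> 1 + (c / b * e) * exp (c / b * e)"
  proof -
    have "1 - c / b * e \<le> exp (- (c / b * e))" using exp_ge_add_one_self[of "- (c / b * e)"] by simp
    hence "(1 - c / b * e) * exp (c / b * e) \<le> exp (- (c / b * e)) * exp (c / b * e)" by (rule mult_right_mono) simp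
    thus ?thesis by (simp add: exp_add[symmetric] algebra_simps)
  qed
  also have "\<dots> \<le> 1 + (c / b * e) * exp 1"
  proof -
    have "c / b * e \<le> 1 * 1" using assms b e by (intro mult_mono) auto
    thus ?thesis using assms b e by (intro add_left_mono mult_left_mono) auto
  qed
  finally have "(1 + e) powr (c / b) \<le> 1 + c * exp 1 / b * e" by (simp add: mult_ac)
  hence "exp (c * u * \<bar>x\<bar>) * (1 + e) powr (c / b) \<le> exp (c * u * \<bar>x\<bar>) * (1 + c * exp 1 / b * e)"
    by (rule mult_left_mono) simp
  also have "\<dots> = exp (c * u * \<bar>x\<bar>) + c * exp 1 / b * (exp (c * u * \<bar>x\<bar>) * e)"
    by (simp add: algebra_simps)
  finally have 1: "exp (c * u * \<bar>x\<bar>) * (1 + e) powr (c / b) \<le> exp (c * u * \<bar>x\<bar>) + c * exp 1 / b * (exp (c * u * \<bar>x\<bar>) * e)" .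
  have "exp (c * u * \<bar>x\<bar>) * e \<le> exp z * e"
    using assms e by (intro mult_right_mono) (auto simp: z_def intro!: mult_right_mono)
  also have "exp z * e = exp (- (b * u * \<bar>x\<bar>))" by (simp add: e_def exp_add[symmetric] z_def)
  finally have "c * exp 1 / b * (exp (c * u * \<bar>x\<bar>) * e) \<le> c * exp 1 / b * exp (- (b * u * \<bar>x\<bar>))"
    using assms b by (intro mult_left_mono) auto
  with 1 show "(exp (b * u * x) + exp (- (b * u * x))) powr (c / b)
      \<le> exp (c * u * \<bar>x\<bar>) + c * exp 1 / b * exp (- (b * u * \<bar>x\<bar>))"
    unfolding eq e_def by linarith
qed

lemma soft_moment_le:
  assumes "0 < c" "c \<le> b" "0 < u"
  shows "soft_moment b c u \<le> exp (c * exp 1 / (b\<^sup>2 * u)) * exp_abs_moment (c * u)"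
proof -
  have b: "b > 0" using assms by simp
  have i1: "integrable std_normal_distribution (\<lambda>x. exp (c * u * \<bar>x\<bar>))"
    by (rule integrable_exp_abs_std_normal)
  have i2: "integrable std_normal_distribution (\<lambda>x. exp (- (b * u * \<bar>x\<bar>)))"
    using integrable_exp_abs_std_normal[of "- (b * u)"] by simp
  have "soft_moment b c u \<le> (\<integral>x. exp (c * u * \<bar>x\<bar>) + c * exp 1 / b * exp (- (b * u * \<bar>x\<bar>)) \<partial>std_normal_distribution)"
    unfolding soft_moment_def
    by (rule integral_mono'[OF _ two_cosh_powr_bounds(2)[OF assms]])
       (use assms b in \<open>auto intro!: i1 i2 integrable_mult_right add_nonneg_nonneg\<close>)
  also have "\<dots> = exp_abs_moment (c * u) + c * exp 1 / b * (\<integral>x. exp (- (b * u * \<bar>x\<bar>)) \<partial>std_normal_distribution)"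
    using i1 i2 by (simp add: exp_abs_moment_def)
  also have "\<dots> \<le> exp_abs_moment (c * u) + c * exp 1 / b * (1 / (b * u))"
    using assms b by (intro add_left_mono mult_left_mono exp_abs_moment_neg_le) auto
  also have "\<dots> = exp_abs_moment (c * u) + c * exp 1 / (b\<^sup>2 * u) * 1"
    by (simp add: power2_eq_square)
  \<comment> \<open>The moment is at least 1, so the additive error can be made multiplicative,
    which survives taking powers \<open>n\<close> and \<open>m\<close>.\<close>
  also have "\<dots> \<le> exp_abs_moment (c * u) + c * exp 1 / (b\<^sup>2 * u) * exp_abs_moment (c * u)"
    using assms b by (intro add_left_mono mult_left_mono exp_abs_moment_ge_1) auto
  also have "\<dots> = (1 + c * exp 1 / (b\<^sup>2 * u)) * exp_abs_moment (c * u)" by (simp add: algebra_simps)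
  also have "\<dots> \<le> exp (c * exp 1 / (b\<^sup>2 * u)) * exp_abs_moment (c * u)"
    using assms exp_abs_moment_ge_1[of "c * u"] by (intro mult_right_mono exp_ge_add_one_self) auto
  finally show ?thesis .
qed

lemma soft_moment_nonneg: "0 \<le> soft_moment b c u"
  unfolding soft_moment_def by simp

lemma erfc_neg_diff_ge:
  assumes "0 \<le> z" "z \<le> k"
  shows "2 / sqrt pi * exp (- k\<^sup>2) * (k - z) \<le> erfc (- k) - erfc (- z)"
proof -
  let ?f = "\<lambda>t::real. exp (- t\<^sup>2)"
  have int: "?f integrable_on {a..b}" for a b
    by (intro integrable_continuous_real continuous_intros)
  have "integral {0..z} ?f + integral {z..k} ?f = integral {0..k} ?f"
    using assms int by (intro Henstock_Kurzweil_Integration.integral_combine) auto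
  moreover have "(k - z) * exp (- k\<^sup>2) \<le> integral {z..k} ?f"
  proof -
    have "integral {z..k} (\<lambda>_. exp (- k\<^sup>2)) \<le> integral {z..k} ?f"
      using assms by (intro integral_le int integrable_const_ivl) (auto intro!: power_mono)
    thus ?thesis using assms by simp
  qed
  ultimately have "(k - z) * exp (- k\<^sup>2) \<le> integral {0..k} ?f - integral {0..z} ?f" by simp
  hence "2 / sqrt pi * ((k - z) * exp (- k\<^sup>2)) \<le> 2 / sqrt pi * (integral {0..k} ?f - integral {0..z} ?f)"
    by (rule mult_left_mono) simp
  thus ?thesis using assms by (simp add: erfc_neg algebra_simps diff_divide_distrib)
qed

text \<open>A tangent bound at \<open>w = 1\<close>, assembled from three inequalities: the
  integrand of erfc is decreasing, \<open>sqrt w \<le> (1 + w) / 2\<close>, and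
  \<open>ln x \<le> x - 1\<close>.\<close>

lemma ln_erfc_neg_scaled_le:
  assumes "0 < k" "0 \<le> w" "w \<le> 1"
  shows "ln (erfc (- (k * sqrt w))) \<le> ln (erfc (- k)) - k * exp (- k\<^sup>2) / (sqrt pi * erfc (- k)) * (1 - w)"
proof -
  have sw: "sqrt w \<le> 1" "0 \<le> sqrt w" using assms by auto
  have "0 \<le> (1 - sqrt w)\<^sup>2" by simp
  hence am: "sqrt w \<le> (1 + w) / 2" using assms by (simp add: power2_diff)
  have e: "erfc (- k) \<ge> 1" "erfc (- (k * sqrt w)) \<ge> 1" using assms by (auto intro!: erfc_neg_ge_1)
  have "k * exp (- k\<^sup>2) / sqrt pi * (1 - w) = 2 / sqrt pi * exp (- k\<^sup>2) * (k * ((1 - w) / 2))"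
    by (simp add: field_simps)
  also have "\<dots> \<le> 2 / sqrt pi * exp (- k\<^sup>2) * (k - k * sqrt w)"
  proof (rule mult_left_mono)
    have "k * ((1 - w) / 2) \<le> k * (1 - sqrt w)" using assms am by (intro mult_left_mono) auto
    thus "k * ((1 - w) / 2) \<le> k - k * sqrt w" by (simp add: algebra_simps)
  qed simp
  also have "\<dots> \<le> erfc (- k) - erfc (- (k * sqrt w))"
    using assms sw by (intro erfc_neg_diff_ge) (auto simp: mult_le_cancel_left1)
  finally have d: "k * exp (- k\<^sup>2) / sqrt pi * (1 - w) / erfc (- k) \<le> (erfc (- k) - erfc (- (k * sqrt w))) / erfc (- k)"
    using e by (intro divide_right_mono) auto
  have "ln (erfc (- (k * sqrt w)) / erfc (- k)) \<le> erfc (- (k * sqrt w)) / erfc (- k) - 1"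
    using e by (intro ln_le_minus_one) auto
  also have "\<dots> = - ((erfc (- k) - erfc (- (k * sqrt w))) / erfc (- k))" using e by (simp add: field_simps)
  also have "\<dots> \<le> - (k * exp (- k\<^sup>2) / sqrt pi * (1 - w) / erfc (- k))" using d by simp
  finally show ?thesis using e by (simp add: ln_div)
qed

section \<open>The interpolation bound and its strict improvement\<close>

text \<open>For \<open>c > 0\<close> this is \<open>c\<close> times the objective, and it is the
  exponent per \<open>n\<close> in the bound on the mean of
  \<open>exp (c * sqrt n * \<xi>)\<close>.\<close>

definition rate :: "real \<Rightarrow> real \<Rightarrow> real" where
  "rate \<alpha> c = c\<^sup>2 / 2 + ln (erfc (- (c / sqrt 2))) + \<alpha> * ln (erfc (- (c / sqrt (2 * \<alpha>))))"

definition softness_loss :: "real \<Rightarrow> real \<Rightarrow> real" where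
  "softness_loss \<alpha> c = 2 * c * exp 1 * (1 + \<alpha> * sqrt \<alpha>)"

text \<open>The derivative of \<open>ln (erfc (- (k * sqrt w)))\<close> in \<open>w\<close> at
  \<open>w = 1\<close>, that is, in the variance of the field.\<close>

definition log_erfc_slope :: "real \<Rightarrow> real" where
  "log_erfc_slope k = k * exp (- k\<^sup>2) / (sqrt pi * erfc (- k))"

lemma log_erfc_slope_pos: "k > 0 \<Longrightarrow> log_erfc_slope k > 0"
  using erfc_neg_ge_1[of k] by (simp add: log_erfc_slope_def)

locale scaled_bipartite =
  fixes m n :: nat and \<alpha> b c :: real
  assumes \<alpha>_pos: "0 < \<alpha>" and n_pos': "0 < n" and m_eq: "real m = \<alpha> * real n"
    and c_pos: "0 < c" and c_le: "c \<le> b"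

sublocale scaled_bipartite \<subseteq> bipartite m n "b * sqrt n" "c / b"
proof
  have "real m > 0" using \<alpha>_pos n_pos' by (simp add: m_eq)
  thus "0 < m" by simp
qed (use n_pos' c_pos c_le in auto)

context scaled_bipartite
begin

lemma b_pos: "b > 0" using c_pos c_le by simp

lemma p\<beta>: "c / b * (b * sqrt n) = c * sqrt n"
  using b_pos by simp

lemma D_decoupled_le:
  assumes u: "1 / 2 \<le> u" and w: "1 / 2 \<le> w"
  shows "D (C 0 u w) \<le> exp (n * (softness_loss \<alpha> c / b\<^sup>2 + (c\<^sup>2 * u\<^sup>2 / 2 + ln (erfc (- (c * u / sqrt 2))))
     + (c\<^sup>2 * w\<^sup>2 / 2 + \<alpha> * ln (erfc (- (c * w / sqrt (2 * \<alpha>)))))))"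
proof -
  \<comment> \<open>The entries of \<open>y\<close> have size \<open>1 / sqrt m\<close>, so relative
    to \<open>sqrt n\<close> the scale of their field is divided by
    \<open>sqrt \<alpha>\<close>.\<close>
  define w' where "w' = w / sqrt \<alpha>"
  have w': "w' > 0" using w \<alpha>_pos by (simp add: w'_def)
  have sm: "sqrt m = sqrt \<alpha> * sqrt n" by (simp add: m_eq real_sqrt_mult)
  have e: "erfc (- (c * u / sqrt 2)) \<ge> 1" "erfc (- (c * w / sqrt (2 * \<alpha>))) \<ge> 1"
    using c_pos u w \<alpha>_pos by (auto intro!: erfc_neg_ge_1)
  have D: "D (C 0 u w) = soft_moment b c u ^ n * soft_moment b c w' ^ m"
    unfolding D_decoupled soft_moment_def sm using n_pos \<alpha>_pos by (simp add: w'_def mult_ac)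
  have 1: "soft_moment b c u \<le> exp (2 * c * exp 1 / b\<^sup>2 + (c\<^sup>2 * u\<^sup>2 / 2 + ln (erfc (- (c * u / sqrt 2)))))"
  proof -
    have "c * exp 1 / (b\<^sup>2 * u) \<le> c * exp 1 / (b\<^sup>2 * (1 / 2))"
      using u c_pos b_pos by (intro divide_left_mono mult_left_mono) auto
    hence "soft_moment b c u \<le> exp (2 * c * exp 1 / b\<^sup>2) * exp_abs_moment (c * u)"
      using c_pos u by (intro order_trans[OF soft_moment_le[OF c_pos c_le]] mult_right_mono)
        (auto intro: order_trans[OF _ exp_abs_moment_ge_1] simp: mult_ac)
    thus ?thesis unfolding exp_abs_moment_eq exp_add using e by (simp add: power_mult_distrib)
  qed
  have 2: "soft_moment b c w' \<le> exp (2 * c * exp 1 * sqrt \<alpha> / b\<^sup>2 + (c\<^sup>2 * w\<^sup>2 / (2 * \<alpha>) + ln (erfc (- (c * w / sqrt (2 * \<alpha>))))))"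
  proof -
    have "c * exp 1 / (b\<^sup>2 * w') \<le> c * exp 1 / (b\<^sup>2 * (1 / 2 / sqrt \<alpha>))"
      using w w' c_pos b_pos \<alpha>_pos unfolding w'_def by (intro divide_left_mono mult_left_mono divide_right_mono) auto
    also have "\<dots> = 2 * c * exp 1 * sqrt \<alpha> / b\<^sup>2" by simp
    finally have "soft_moment b c w' \<le> exp (2 * c * exp 1 * sqrt \<alpha> / b\<^sup>2) * exp_abs_moment (c * w')"
      using c_pos w' by (intro order_trans[OF soft_moment_le[OF c_pos c_le]] mult_right_mono)
        (auto intro: order_trans[OF _ exp_abs_moment_ge_1])
    moreover have "c * w' / sqrt 2 = c * w / sqrt (2 * \<alpha>)" by (simp add: w'_def real_sqrt_mult)
    moreover have "(c * w')\<^sup>2 / 2 = c\<^sup>2 * w\<^sup>2 / (2 * \<alpha>)"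
      using \<alpha>_pos by (simp add: w'_def power_mult_distrib power_divide)
    ultimately show ?thesis unfolding exp_abs_moment_eq exp_add using e by simp
  qed
  have "D (C 0 u w) \<le> exp (2 * c * exp 1 / b\<^sup>2 + (c\<^sup>2 * u\<^sup>2 / 2 + ln (erfc (- (c * u / sqrt 2))))) ^ n
     * exp (2 * c * exp 1 * sqrt \<alpha> / b\<^sup>2 + (c\<^sup>2 * w\<^sup>2 / (2 * \<alpha>) + ln (erfc (- (c * w / sqrt (2 * \<alpha>)))))) ^ m"
    unfolding D by (intro mult_mono power_mono 1 2 soft_moment_nonneg zero_le_power) auto
  also have "\<dots> = exp (n * (2 * c * exp 1 / b\<^sup>2 + (c\<^sup>2 * u\<^sup>2 / 2 + ln (erfc (- (c * u / sqrt 2)))))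
     + m * (2 * c * exp 1 * sqrt \<alpha> / b\<^sup>2 + (c\<^sup>2 * w\<^sup>2 / (2 * \<alpha>) + ln (erfc (- (c * w / sqrt (2 * \<alpha>)))))))"
    by (simp only: exp_add exp_of_nat_mult)
  also have "n * (2 * c * exp 1 / b\<^sup>2 + (c\<^sup>2 * u\<^sup>2 / 2 + ln (erfc (- (c * u / sqrt 2)))))
     + m * (2 * c * exp 1 * sqrt \<alpha> / b\<^sup>2 + (c\<^sup>2 * w\<^sup>2 / (2 * \<alpha>) + ln (erfc (- (c * w / sqrt (2 * \<alpha>))))))
     = n * (softness_loss \<alpha> c / b\<^sup>2 + (c\<^sup>2 * u\<^sup>2 / 2 + ln (erfc (- (c * u / sqrt 2))))
     + (c\<^sup>2 * w\<^sup>2 / 2 + \<alpha> * ln (erfc (- (c * w / sqrt (2 * \<alpha>))))))"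
    unfolding m_eq softness_loss_def using \<alpha>_pos b_pos by (simp add: field_simps)
  finally show ?thesis .
qed

lemma D_decoupled_11_le:
  "D (C 0 1 1) \<le> exp (n * (softness_loss \<alpha> c / b\<^sup>2 + c\<^sup>2 / 2 + rate \<alpha> c))"
  using D_decoupled_le[of 1 1] by (simp add: rate_def algebra_simps)

lemma gordon_exp:
  assumes "0 \<le> t0" "t0 \<le> t1" "t1 \<le> U" "t1 \<le> W"
  shows "exp (n * (c\<^sup>2 / 2 * (t1 - t0))) * D (gpath U W t1) \<le> D (gpath U W t0)"
  using gordon_comparison[OF assms] unfolding p\<beta> by (simp add: power_mult_distrib mult_ac)

text \<open>Running the whole path with \<open>U = W = 1\<close> gains \<open>c\<^sup>2 / 2\<close>,
  exactly the surplus of the decoupled exponent over \<open>rate\<close>.\<close>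

lemma D_matrix_le: "D (C 1 0 0) \<le> exp (n * (softness_loss \<alpha> c / b\<^sup>2 + rate \<alpha> c))"
proof -
  have "exp (n * (c\<^sup>2 / 2)) * D (C 1 0 0) \<le> exp (n * (softness_loss \<alpha> c / b\<^sup>2 + c\<^sup>2 / 2 + rate \<alpha> c))"
    using gordon_exp[of 0 1 1 1] D_decoupled_11_le by simp
  also have "\<dots> = exp (n * (c\<^sup>2 / 2)) * exp (n * (softness_loss \<alpha> c / b\<^sup>2 + rate \<alpha> c))"
    by (simp add: exp_add[symmetric] algebra_simps)
  finally show ?thesis by simp
qed

end

section \<open>The gain when the comparison is nearly tight\<close>

text \<open>\<open>\<kappa>\<close> bounds below the decrease of the log-erfc exponent per unit of
  variance taken from either field. \<open>\<rho>\<close> is the relative lowering of a field scale,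
  small enough for quadratic terms in \<open>\<rho>\<close> to cost at most
  \<open>\<kappa> / 2\<close>. \<open>slack\<close> keeps softness and the tolerance
  \<open>\<epsilon>\<close> below the resulting profit.\<close>

locale tight_bipartite = scaled_bipartite +
  fixes \<kappa> \<rho> \<epsilon> :: real
  assumes \<kappa>_pos: "0 < \<kappa>"
    and \<kappa>_row: "\<kappa> \<le> log_erfc_slope (c / sqrt 2)"
    and \<kappa>_col: "\<kappa> \<le> \<alpha> * log_erfc_slope (c / sqrt (2 * \<alpha>))"
    and \<rho>_pos: "0 < \<rho>" and \<rho>_le: "\<rho> \<le> 1 / 4" and \<rho>_small: "\<rho> * (c\<^sup>2 / 2 + \<kappa>) \<le> \<kappa> / 2"
    and slack: "softness_loss \<alpha> c / b\<^sup>2 + \<epsilon> \<le> \<rho> * \<kappa> / 4"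
    and tight: "exp (n * (rate \<alpha> c - \<epsilon>)) \<le> D (C 1 0 0)"
begin

text \<open>Chosen so that \<open>c * (c + 2 * \<mu>) = c\<^sup>2 + \<kappa> / 2\<close>. Half of
  the excess \<open>2 * \<mu>\<close> is left after the error terms in
  \<open>overlap_gap\<close>.\<close>

definition \<mu> where "\<mu> = \<kappa> / (4 * c)"

lemma \<mu>_pos: "\<mu> > 0" using \<kappa>_pos c_pos by (simp add: \<mu>_def)

text \<open>Tightness, carried back to time \<open>\<tau>\<close> by the plain comparison, bounds
  the unlowered partition function below. The one with a lowered field, \<open>D'\<close>, is
  exponentially smaller; leaving it abstract serves both fields. The exponential factor is the one
  of \<open>avg2_field_lower_bound\<close> at the field level
  \<open>sqrt n * \<sigma> * (c + 2 * \<mu>)\<close>.\<close>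

lemma tilted_partition_small:
  assumes \<tau>: "0 \<le> \<tau>" "\<tau> \<le> 1 / 2" and \<sigma>: "\<sigma> = sqrt (1 - \<tau>)"
    and U: "U = (\<sigma> - \<sigma> * \<rho>)\<^sup>2 + \<tau>"
    and D': "exp (n * (c\<^sup>2 / 2 * \<tau>)) * D' \<le> exp (n * (softness_loss \<alpha> c / b\<^sup>2 + c\<^sup>2 / 2 + rate \<alpha> c - (c\<^sup>2 / 2 + \<kappa>) * (1 - U)))"
  shows "exp (c * sqrt n * (\<sigma> * \<rho>) * (sqrt n * \<sigma> * (c + 2 * \<mu>))) * D' \<le> D (C (sqrt \<tau>) \<sigma> \<sigma>)"
proof -
  have \<sigma>2: "\<sigma>\<^sup>2 = 1 - \<tau>" using \<tau> by (simp add: \<sigma>)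
  define L where "L = softness_loss \<alpha> c / b\<^sup>2"
  have one_minus_U: "1 - U = \<sigma>\<^sup>2 * \<rho> * (2 - \<rho>)"
    unfolding U using \<sigma>2 by (simp add: power2_eq_square algebra_simps)
  have low: "exp (n * (c\<^sup>2 / 2 * (1 - \<tau>))) * exp (n * (rate \<alpha> c - \<epsilon>)) \<le> D (C (sqrt \<tau>) \<sigma> \<sigma>)"
    using order_trans[OF mult_left_mono[OF tight] gordon_exp[of \<tau> 1 1 1, simplified]] \<tau> by (simp add: \<sigma>)
  have ey: "c * sqrt n * (\<sigma> * \<rho>) * (sqrt n * \<sigma> * (c + 2 * \<mu>)) = n * (\<sigma>\<^sup>2 * \<rho> * (c\<^sup>2 + \<kappa> / 2))"
  proof -
    have "c * sqrt n * (\<sigma> * \<rho>) * (sqrt n * \<sigma> * (c + 2 * \<mu>)) = (sqrt n * sqrt n) * (\<sigma>\<^sup>2 * \<rho> * (c * (c + 2 * \<mu>)))"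
      by (simp add: power2_eq_square mult_ac)
    also have "c * (c + 2 * \<mu>) = c\<^sup>2 + \<kappa> / 2" using c_pos by (simp add: \<mu>_def power2_eq_square algebra_simps)
    finally show ?thesis by simp
  qed
  \<comment> \<open>To first order \<open>1 - U\<close> is
    \<open>2 * \<rho> * \<sigma>\<^sup>2\<close>, so the terms in \<open>c\<^sup>2\<close> cancel
    and \<open>3 / 2 * \<kappa>\<close> remains; the quadratic term uses up at most
    \<open>\<kappa> / 2\<close> of it.\<close>
  have "\<sigma>\<^sup>2 * \<rho> * (c\<^sup>2 + \<kappa> / 2) - (c\<^sup>2 / 2 + \<kappa>) * (1 - U)
      = \<sigma>\<^sup>2 * \<rho> * (\<rho> * (c\<^sup>2 / 2 + \<kappa>) - 3 / 2 * \<kappa>)"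
    unfolding one_minus_U by (simp add: algebra_simps)
  also have "\<dots> \<le> \<sigma>\<^sup>2 * \<rho> * (- \<kappa>)"
    using \<rho>_small \<rho>_pos by (intro mult_left_mono) auto
  also have "\<dots> \<le> - (\<rho> * \<kappa> / 2)"
  proof -
    have "1 / 2 * (\<rho> * \<kappa>) \<le> \<sigma>\<^sup>2 * (\<rho> * \<kappa>)" using \<sigma>2 \<tau> \<rho>_pos \<kappa>_pos by (intro mult_right_mono) auto
    thus ?thesis by simp
  qed
  finally have main: "\<sigma>\<^sup>2 * \<rho> * (c\<^sup>2 + \<kappa> / 2) + L - (c\<^sup>2 / 2 + \<kappa>) * (1 - U) + \<epsilon> \<le> 0"
    using slack mult_pos_pos[OF \<rho>_pos \<kappa>_pos] unfolding L_def by linarith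
  have "exp (n * (\<sigma>\<^sup>2 * \<rho> * (c\<^sup>2 + \<kappa> / 2))) * (exp (n * (c\<^sup>2 / 2 * \<tau>)) * D')
      \<le> exp (n * (\<sigma>\<^sup>2 * \<rho> * (c\<^sup>2 + \<kappa> / 2))) * exp (n * (L + c\<^sup>2 / 2 + rate \<alpha> c - (c\<^sup>2 / 2 + \<kappa>) * (1 - U)))"
    unfolding L_def by (rule mult_left_mono[OF D']) simp
  also have "\<dots> = exp (n * (c\<^sup>2 / 2 + rate \<alpha> c - \<epsilon> + (\<sigma>\<^sup>2 * \<rho> * (c\<^sup>2 + \<kappa> / 2) + L - (c\<^sup>2 / 2 + \<kappa>) * (1 - U) + \<epsilon>)))"
    by (simp add: exp_add[symmetric] algebra_simps)
  also have "\<dots> \<le> exp (n * (c\<^sup>2 / 2 + rate \<alpha> c - \<epsilon> + 0))"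
    unfolding exp_le_cancel_iff by (intro mult_left_mono add_left_mono main) simp
  also have "c\<^sup>2 / 2 + rate \<alpha> c - \<epsilon> + 0 = c\<^sup>2 / 2 * \<tau> + (c\<^sup>2 / 2 * (1 - \<tau>) + (rate \<alpha> c - \<epsilon>))"
    by (simp add: field_simps)
  also have "exp (n * \<dots>) = exp (n * (c\<^sup>2 / 2 * \<tau>)) * (exp (n * (c\<^sup>2 / 2 * (1 - \<tau>))) * exp (n * (rate \<alpha> c - \<epsilon>)))"
    by (simp only: distrib_left exp_add)
  also have "\<dots> \<le> exp (n * (c\<^sup>2 / 2 * \<tau>)) * D (C (sqrt \<tau>) \<sigma> \<sigma>)"
    by (rule mult_left_mono[OF low]) simp
  finally have "exp (n * (c\<^sup>2 / 2 * \<tau>)) * (exp (n * (\<sigma>\<^sup>2 * \<rho> * (c\<^sup>2 + \<kappa> / 2))) * D') \<le> exp (n * (c\<^sup>2 / 2 * \<tau>)) * D (C (sqrt \<tau>) \<sigma> \<sigma>)"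
    by (simp add: mult_ac)
  thus ?thesis unfolding ey by simp
qed

lemma tilted_partition_small_row_col:
  assumes \<tau>: "0 \<le> \<tau>" "\<tau> \<le> 1 / 2" and \<sigma>: "\<sigma> = sqrt (1 - \<tau>)"
  shows "exp (c * sqrt n * (\<sigma> * \<rho>) * (sqrt n * \<sigma> * (c + 2 * \<mu>))) * D (C (sqrt \<tau>) (\<sigma> - \<sigma> * \<rho>) \<sigma>) \<le> D (C (sqrt \<tau>) \<sigma> \<sigma>)" (is ?row)
    and "exp (c * sqrt n * (\<sigma> * \<rho>) * (sqrt n * \<sigma> * (c + 2 * \<mu>))) * D (C (sqrt \<tau>) \<sigma> (\<sigma> - \<sigma> * \<rho>)) \<le> D (C (sqrt \<tau>) \<sigma> \<sigma>)" (is ?col)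
proof -
  \<comment> \<open>The initial variance from which the path reaches the lowered field scale at time
    \<open>\<tau>\<close>; the other field starts from 1.\<close>
  define U where "U = (\<sigma> - \<sigma> * \<rho>)\<^sup>2 + \<tau>"
  have \<sigma>0: "0 < \<sigma>" "\<sigma>\<^sup>2 = 1 - \<tau>" using \<tau> by (simp_all add: \<sigma>)
  have d: "\<sigma> - \<sigma> * \<rho> \<ge> 0" using \<sigma>0 \<rho>_le by (simp add: mult_le_cancel_left1)
  have omU: "1 - U = \<sigma>\<^sup>2 * (\<rho> * (2 - \<rho>))"
    unfolding U_def using \<sigma>0 by (simp add: power2_eq_square algebra_simps)
  \<comment> \<open>Keeps \<open>U\<close> at least 1/2, hence its root at least 1/2, as the
    decoupled bound requires.\<close>
  have r: "0 \<le> \<rho> * (2 - \<rho>)" "\<rho> * (2 - \<rho>) \<le> 1 / 4 * 2"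
    using \<rho>_pos \<rho>_le by (simp, intro mult_mono) auto
  have "0 \<le> \<sigma>\<^sup>2 * (\<rho> * (2 - \<rho>))" by (rule mult_nonneg_nonneg[OF zero_le_power2 r(1)])
  moreover have "\<sigma>\<^sup>2 * (\<rho> * (2 - \<rho>)) \<le> 1 * (\<rho> * (2 - \<rho>))" using \<sigma>0 \<tau> r by (intro mult_right_mono) auto
  ultimately have U: "U \<le> 1" "1 / 2 \<le> U" using omU r by linarith+
  have sU: "1 / 2 \<le> sqrt U" using U by (intro real_le_rsqrt) (simp add: power2_eq_square)
  have pU: "U - \<tau> = (\<sigma> - \<sigma> * \<rho>)\<^sup>2" "\<tau> \<le> U" by (simp_all add: U_def)
  have g1: "exp (n * (c\<^sup>2 / 2 * \<tau>)) * D (C (sqrt \<tau>) (\<sigma> - \<sigma> * \<rho>) \<sigma>) \<le> D (C 0 (sqrt U) 1)"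
    using gordon_exp[of 0 \<tau> U 1] \<tau> pU d by (simp add: \<sigma>[symmetric])
  have g2: "exp (n * (c\<^sup>2 / 2 * \<tau>)) * D (C (sqrt \<tau>) \<sigma> (\<sigma> - \<sigma> * \<rho>)) \<le> D (C 0 1 (sqrt U))"
    using gordon_exp[of 0 \<tau> 1 U] \<tau> pU d by (simp add: \<sigma>[symmetric])
  have k: "c / sqrt 2 > 0" "c / sqrt (2 * \<alpha>) > 0" using c_pos \<alpha>_pos by auto
  have "ln (erfc (- (c / sqrt 2 * sqrt U))) \<le> ln (erfc (- (c / sqrt 2))) - log_erfc_slope (c / sqrt 2) * (1 - U)"
    using ln_erfc_neg_scaled_le[OF k(1), of U] U by (simp add: log_erfc_slope_def)
  moreover have "\<kappa> * (1 - U) \<le> log_erfc_slope (c / sqrt 2) * (1 - U)" using \<kappa>_row U by (intro mult_right_mono) auto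
  ultimately have row: "ln (erfc (- (c * sqrt U / sqrt 2))) \<le> ln (erfc (- (c / sqrt 2))) - \<kappa> * (1 - U)"
    by simp
  have "ln (erfc (- (c / sqrt (2 * \<alpha>) * sqrt U))) \<le> ln (erfc (- (c / sqrt (2 * \<alpha>)))) - log_erfc_slope (c / sqrt (2 * \<alpha>)) * (1 - U)"
    using ln_erfc_neg_scaled_le[OF k(2), of U] U by (simp add: log_erfc_slope_def)
  hence "\<alpha> * ln (erfc (- (c / sqrt (2 * \<alpha>) * sqrt U))) \<le> \<alpha> * (ln (erfc (- (c / sqrt (2 * \<alpha>)))) - log_erfc_slope (c / sqrt (2 * \<alpha>)) * (1 - U))"
    using \<alpha>_pos by (intro mult_left_mono) auto
  moreover have "\<kappa> * (1 - U) \<le> (\<alpha> * log_erfc_slope (c / sqrt (2 * \<alpha>))) * (1 - U)" using \<kappa>_col U by (intro mult_right_mono) auto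
  ultimately have col: "\<alpha> * ln (erfc (- (c * sqrt U / sqrt (2 * \<alpha>)))) \<le> \<alpha> * ln (erfc (- (c / sqrt (2 * \<alpha>)))) - \<kappa> * (1 - U)"
    by (simp add: algebra_simps)
  have sqU: "(sqrt U)\<^sup>2 = U" using U by simp
  have "D (C 0 (sqrt U) 1) \<le> exp (n * (softness_loss \<alpha> c / b\<^sup>2 + c\<^sup>2 / 2 + rate \<alpha> c - (c\<^sup>2 / 2 + \<kappa>) * (1 - U)))"
  proof (rule order_trans[OF D_decoupled_le[OF sU]], simp, unfold exp_le_cancel_iff, intro mult_left_mono)
    show "softness_loss \<alpha> c / b\<^sup>2 + (c\<^sup>2 * (sqrt U)\<^sup>2 / 2 + ln (erfc (- (c * sqrt U / sqrt 2)))) + (c\<^sup>2 * 1\<^sup>2 / 2 + \<alpha> * ln (erfc (- (c * 1 / sqrt (2 * \<alpha>)))))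
       \<le> softness_loss \<alpha> c / b\<^sup>2 + c\<^sup>2 / 2 + rate \<alpha> c - (c\<^sup>2 / 2 + \<kappa>) * (1 - U)"
      using row by (simp add: sqU rate_def field_simps)
  qed simp
  from tilted_partition_small[OF \<tau> \<sigma> U_def order_trans[OF g1 this]] show ?row .
  have "D (C 0 1 (sqrt U)) \<le> exp (n * (softness_loss \<alpha> c / b\<^sup>2 + c\<^sup>2 / 2 + rate \<alpha> c - (c\<^sup>2 / 2 + \<kappa>) * (1 - U)))"
  proof (rule order_trans[OF D_decoupled_le[OF _ sU]], simp, unfold exp_le_cancel_iff, intro mult_left_mono)
    show "softness_loss \<alpha> c / b\<^sup>2 + (c\<^sup>2 * 1\<^sup>2 / 2 + ln (erfc (- (c * 1 / sqrt 2)))) + (c\<^sup>2 * (sqrt U)\<^sup>2 / 2 + \<alpha> * ln (erfc (- (c * sqrt U / sqrt (2 * \<alpha>)))))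
       \<le> softness_loss \<alpha> c / b\<^sup>2 + c\<^sup>2 / 2 + rate \<alpha> c - (c\<^sup>2 / 2 + \<kappa>) * (1 - U)"
      using col by (simp add: sqU rate_def field_simps)
  qed simp
  from tilted_partition_small[OF \<tau> \<sigma> U_def order_trans[OF g2 this]] show ?col .
qed

text \<open>The two field bounds are chained: the first gives \<open><dy>\<close> of order
  \<open>\<mu> / b\<close>, which feeds the second. \<open>n1\<close> and \<open>n2\<close> put the
  error terms, of order \<open>1 / n\<close>, below \<open>\<mu>\<close> and
  \<open>\<mu>\<^sup>2 / b\<close>.\<close>

lemma overlap_gap:
  assumes \<tau>: "0 \<le> \<tau>" "\<tau> \<le> 1 / 2" and \<sigma>: "\<sigma> = sqrt (1 - \<tau>)"
    and n1: "2 / (c * n * \<rho>) \<le> \<mu>" and n2: "4 / (c * n * \<rho>) \<le> \<mu>\<^sup>2 / b"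
  shows "\<mu>\<^sup>2 / (16 * b\<^sup>2) * D (C (sqrt \<tau>) \<sigma> \<sigma>) \<le> avg2 (C (sqrt \<tau>) \<sigma> \<sigma>) (\<lambda>s r. dx s r * dy s r)"
proof -
  let ?a = "C (sqrt \<tau>) \<sigma> \<sigma>"
  define \<eta> where "\<eta> = \<sigma> * \<rho>"
  define y where "y = sqrt n * \<sigma> * (c + 2 * \<mu>)"
  define l where "l = c * sqrt n * \<eta>"
  define A where "A = avg2 ?a dy"
  define P where "P = avg2 ?a (\<lambda>s r. dx s r * dy s r)"
  define s where "s = sqrt n * \<sigma>"
  have \<sigma>0: "0 < \<sigma>" "\<sigma>\<^sup>2 = 1 - \<tau>" using \<tau> by (simp_all add: \<sigma>)
  have s0: "s > 0" using \<sigma>0 n_pos by (simp add: s_def)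
  have \<eta>0: "\<eta> > 0" using \<sigma>0 \<rho>_pos by (simp add: \<eta>_def)
  have l0: "l > 0" using \<eta>0 c_pos n_pos by (simp add: l_def)
  have pb: "c / b * (b * sqrt n) * \<eta> = l" using p\<beta> by (simp add: l_def)
  have D0: "D ?a > 0" by (rule D_pos)
  have ls: "2 / (l * s) \<le> 4 / (c * n * \<rho>)"
  proof -
    have "l * s = c * n * \<rho> * \<sigma>\<^sup>2"
      by (simp add: l_def s_def \<eta>_def power2_eq_square mult_ac)
    also have "\<dots> \<ge> c * n * \<rho> * (1 / 2)"
      using \<sigma>0 \<tau> c_pos \<rho>_pos by (intro mult_left_mono) auto
    finally have "c * n * \<rho> * (1 / 2) \<le> l * s" .
    moreover have "c * n * \<rho> > 0" using c_pos n_pos \<rho>_pos by simp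
    ultimately have "2 / (l * s) \<le> 2 / (c * n * \<rho> * (1 / 2))"
      using c_pos n_pos \<rho>_pos by (intro divide_left_mono mult_pos_pos l0 s0) auto
    thus ?thesis by simp
  qed
  have row: "exp (l * y) * D (C (sqrt \<tau>) (\<sigma> - \<eta>) \<sigma>) \<le> D ?a"
    and col: "exp (l * y) * D (C (sqrt \<tau>) \<sigma> (\<sigma> - \<eta>)) \<le> D ?a"
    using tilted_partition_small_row_col[OF \<tau> \<sigma>] by (simp_all add: l_def y_def \<eta>_def mult.assoc)
  have ys: "y = s * (c + 2 * \<mu>)" by (simp add: y_def s_def)
  have bs: "b * sqrt n * \<sigma> = b * s" by (simp add: s_def)
  have il: "1 / l = s * (1 / (l * s))" "2 / l = s * (2 / (l * s))" using s0 by simp_all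
  \<comment> \<open>The level \<open>c + 2 * \<mu>\<close> is compared with the mean
    \<open>c + (b - c) * <dy>\<close>: the \<open>c\<close> cancels and the error consumes one
    \<open>\<mu>\<close>.\<close>
  have 1: "\<mu> * D ?a \<le> b * A"
  proof -
    have "y * D ?a - 1 / l * D ?a \<le> y * D ?a - 1 / l * (exp (l * y) * D (C (sqrt \<tau>) \<sigma> (\<sigma> - \<eta>)))"
      using col l0 by (intro diff_left_mono mult_left_mono) auto
    also have "\<dots> \<le> b * s * (c / b * D ?a + (1 - c / b) * A)"
      using avg2_dy_lower_bound[OF \<eta>0, of y "sqrt \<tau>" \<sigma> \<sigma>] unfolding pb bs A_def by simp
    also have "\<dots> = s * (c * D ?a + (b - c) * A)" using b_pos by (simp add: field_simps)
    finally have "s * ((c + 2 * \<mu> - 1 / (l * s)) * D ?a) \<le> s * (c * D ?a + (b - c) * A)"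
      unfolding ys il by (simp only: mult.assoc right_diff_distrib left_diff_distrib)
    hence "(c + 2 * \<mu> - 1 / (l * s)) * D ?a \<le> c * D ?a + (b - c) * A"
      by (rule mult_left_le_imp_le[OF _ s0])
    moreover have "1 / (l * s) * D ?a \<le> \<mu> * D ?a"
    proof (rule mult_right_mono)
      show "1 / (l * s) \<le> \<mu>" using ls n1 by simp
    qed (use D0 in simp)
    moreover have "(b - c) * A \<le> b * A"
    proof (rule mult_right_mono)
      show "0 \<le> A" unfolding A_def using avg2_mono[of "\<lambda>_ _. 0" dy ?a] avg2_const[of ?a 0] by (simp add: dy_nonneg)
    qed (use c_pos in simp)
    ultimately show ?thesis by (simp add: algebra_simps)
  qed
  \<comment> \<open>Again \<open>c * A\<close> cancels, leaving \<open>2 * \<mu> * A\<close>, which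
    the first bound makes at least \<open>2 * \<mu>\<^sup>2 / b\<close>; the error takes
    half.\<close>
  have "y * A - 2 / l * D ?a \<le> y * A - 2 / l * (exp (l * y) * D (C (sqrt \<tau>) (\<sigma> - \<eta>) \<sigma>))"
    using row l0 by (intro diff_left_mono mult_left_mono) auto
  also have "\<dots> \<le> b * s * (c / b * A + 16 * P)"
    using avg2_prod_dist_lower_bound[OF \<eta>0, of \<sigma> y "sqrt \<tau>" \<sigma>] \<sigma>0 unfolding pb bs A_def P_def by simp
  also have "\<dots> = s * (c * A + 16 * b * P)" using b_pos by (simp add: field_simps)
  finally have "s * ((c + 2 * \<mu>) * A - 2 / (l * s) * D ?a) \<le> s * (c * A + 16 * b * P)"
    unfolding ys il by (simp only: mult.assoc right_diff_distrib left_diff_distrib)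
  hence "(c + 2 * \<mu>) * A - 2 / (l * s) * D ?a \<le> c * A + 16 * b * P"
    by (rule mult_left_le_imp_le[OF _ s0])
  hence "2 * \<mu> * A - 2 / (l * s) * D ?a \<le> 16 * b * P" by (simp add: algebra_simps)
  moreover have "2 / (l * s) * D ?a \<le> \<mu>\<^sup>2 / b * D ?a"
    using ls n2 D0 by (intro mult_right_mono) auto
  moreover have "2 * (\<mu>\<^sup>2 / b * D ?a) \<le> 2 * \<mu> * A"
  proof -
    have "2 * \<mu> / b * (\<mu> * D ?a) \<le> 2 * \<mu> / b * (b * A)" using 1 \<mu>_pos b_pos by (intro mult_left_mono) auto
    thus ?thesis using b_pos by (simp add: power2_eq_square mult_ac)
  qed
  ultimately have "\<mu>\<^sup>2 / b * D ?a \<le> 16 * b * P" by linarith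
  thus ?thesis using b_pos unfolding P_def[symmetric] by (simp add: field_simps power2_eq_square)
qed

text \<open>The gap is used for \<open>\<tau>\<close> up to 1/2 and the plain comparison afterwards.
  The constant 64 is 16 from the gap, 2 from the derivative and 2 from the length of the half
  path.\<close>

lemma D_matrix_improved:
  assumes n1: "2 / (c * n * \<rho>) \<le> \<mu>" and n2: "4 / (c * n * \<rho>) \<le> \<mu>\<^sup>2 / b"
  shows "D (C 1 0 0) \<le> exp (n * (rate \<alpha> c + softness_loss \<alpha> c / b\<^sup>2 - c * (b - c) * \<mu>\<^sup>2 / (64 * b\<^sup>2)))"
proof -
  define G where "G = c * (b - c) * \<mu>\<^sup>2 / (64 * b\<^sup>2)"
  have "exp (((c / b * (b * sqrt n))\<^sup>2 / 2 + c / b * (b * sqrt n)\<^sup>2 * (1 - c / b) / 2 * (\<mu>\<^sup>2 / (16 * b\<^sup>2))) * (1 / 2 - 0))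
     * D (gpath 1 1 (1 / 2)) \<le> D (gpath 1 1 0)"
  proof (rule D_path_comparison)
    fix \<tau> :: real assume "0 < \<tau>" "\<tau> < 1 / 2"
    thus "\<mu>\<^sup>2 / (16 * b\<^sup>2) * D (gpath 1 1 \<tau>) \<le> avg2 (gpath 1 1 \<tau>) (\<lambda>s r. dx s r * dy s r)"
      by (intro overlap_gap n1 n2) auto
  qed auto
  also have "((c / b * (b * sqrt n))\<^sup>2 / 2 + c / b * (b * sqrt n)\<^sup>2 * (1 - c / b) / 2 * (\<mu>\<^sup>2 / (16 * b\<^sup>2))) * (1 / 2 - 0)
     = n * (c\<^sup>2 / 4 + G)"
    using b_pos by (simp add: G_def power_mult_distrib field_simps power2_eq_square)
  also have "gpath 1 1 0 = C 0 1 1" by simp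
  finally have 1: "exp (n * (c\<^sup>2 / 4 + G)) * D (gpath 1 1 (1 / 2)) \<le> exp (n * (softness_loss \<alpha> c / b\<^sup>2 + c\<^sup>2 / 2 + rate \<alpha> c))"
    using D_decoupled_11_le by (rule order_trans)
  have 2: "exp (n * (c\<^sup>2 / 4)) * D (C 1 0 0) \<le> D (gpath 1 1 (1 / 2))"
    using gordon_exp[of "1/2" 1 1 1] by simp
  have "exp (n * (c\<^sup>2 / 2)) * (exp (n * G) * D (C 1 0 0)) = exp (n * (c\<^sup>2 / 4 + G)) * (exp (n * (c\<^sup>2 / 4)) * D (C 1 0 0))"
    by (simp add: mult.assoc[symmetric] exp_add[symmetric] algebra_simps)
  also have "\<dots> \<le> exp (n * (softness_loss \<alpha> c / b\<^sup>2 + c\<^sup>2 / 2 + rate \<alpha> c))"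
    by (rule order_trans[OF mult_left_mono[OF 2] 1]) simp
  also have "\<dots> = exp (n * (c\<^sup>2 / 2)) * (exp (n * G) * exp (n * (rate \<alpha> c + softness_loss \<alpha> c / b\<^sup>2 - G)))"
    by (simp add: exp_add[symmetric] algebra_simps)
  finally show ?thesis unfolding G_def[symmetric] by simp
qed

end

section \<open>Transfer to the random matrix\<close>

lemma xi_p_attained:
  obtains x y where "x \<in> sign_cube n" "y \<in> sign_cube m" "xi_p m n A = (\<Sum>i<m. \<Sum>j<n. y i * A i j * x j)"
proof -
  have "xi_p m n A \<in> (\<lambda>(x, y). \<Sum>i<m. \<Sum>j<n. y i * A i j * x j) ` (sign_cube n \<times> sign_cube m)"
    unfolding xi_p_def by (intro Max_in) (auto simp: sign_cube_finite sign_cube_nonempty)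
  thus ?thesis using that by auto
qed

lemma xi_p_ge:
  assumes "x \<in> sign_cube n" "y \<in> sign_cube m"
  shows "(\<Sum>i<m. \<Sum>j<n. y i * A i j * x j) \<le> xi_p m n A"
proof -
  have "(\<lambda>(x, y). \<Sum>i<m. \<Sum>j<n. y i * A i j * x j) (x, y) \<le> xi_p m n A"
    unfolding xi_p_def using assms by (intro Max_ge finite_imageI imageI) (auto simp: sign_cube_finite)
  thus ?thesis by simp
qed

lemma xi_p_nonneg: "0 \<le> xi_p m n A"
proof -
  define x where "x = (\<lambda>j\<in>{..<n}. 1 / sqrt n)"
  define x' where "x' = (\<lambda>j\<in>{..<n}. - (1 / sqrt n))"
  define y where "y = (\<lambda>i\<in>{..<m}. 1 / sqrt m)"
  have "x \<in> sign_cube n" "x' \<in> sign_cube n" "y \<in> sign_cube m"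
    by (auto simp: x_def x'_def y_def sign_cube_def)
  from xi_p_ge[OF this(1,3), of A] xi_p_ge[OF this(2,3), of A]
  have "(\<Sum>i<m. \<Sum>j<n. y i * A i j * x j) + (\<Sum>i<m. \<Sum>j<n. y i * A i j * x' j) \<le> 2 * xi_p m n A"
    by simp
  moreover have "(\<Sum>i<m. \<Sum>j<n. y i * A i j * x j) + (\<Sum>i<m. \<Sum>j<n. y i * A i j * x' j) = 0"
    unfolding sum.distrib[symmetric] by (intro sum.neutral ballI) (simp add: x_def x'_def)
  ultimately show ?thesis by simp
qed

lemma xi_p_cong: "(\<And>i j. \<lbrakk>i < m; j < n\<rbrakk> \<Longrightarrow> A i j = B i j) \<Longrightarrow> xi_p m n A = xi_p m n B"
  unfolding xi_p_def by (intro arg_cong[where f = Max] image_cong refl) (auto intro!: sum.cong)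

text \<open>\<open>exp (\<beta> * \<xi>)\<close> is one of the positive summands of
  \<open>Z\<close>. The remaining work identifies laws: the matrix block of the bordered Gaussian is
  distributed like \<open>H\<close>.\<close>

lemma (in bipartite) xi_p_exp_moment:
  fixes H :: "'a \<Rightarrow> nat \<Rightarrow> nat \<Rightarrow> real"
  assumes H: "iid_std_normal_matrix M m n H"
  shows "integrable M (\<lambda>\<omega>. exp (p * \<beta> * xi_p m n (H \<omega>)))"
    and "(\<integral>\<omega>. exp (p * \<beta> * xi_p m n (H \<omega>)) \<partial>M) \<le> D (C 1 0 0)"
proof -
  interpret M: prob_space M using H by (simp add: iid_std_normal_matrix_def)
  define I where "I = mat_block m n"
  have I: "finite I" "I \<subseteq> bordered m n" "I \<noteq> {}"
    using m_pos n_pos by (auto simp: I_def mat_block_def bordered_def)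
  define N where "N = gauss I"
  define \<psi> where "\<psi> g = exp (p * \<beta> * xi_p m n (\<lambda>i j. g (i, j)))" for g :: "nat \<times> nat \<Rightarrow> real"
  have \<psi>m[measurable]: "\<psi> \<in> borel_measurable (gauss J)" if "I \<subseteq> J" for J
  proof -
    have comp: "(\<lambda>g. g (i, j)) \<in> borel_measurable (gauss J)" if "i < m" "j < n" for i j
    proof -
      have "(i, j) \<in> J" using that \<open>I \<subseteq> J\<close> by (auto simp: I_def mat_block_def)
      thus ?thesis by measurable
    qed
    have "(\<lambda>g. Max ((\<lambda>s. \<Sum>i<m. \<Sum>j<n. snd s i * g (i, j) * fst s j) ` (sign_cube n \<times> sign_cube m))) \<in> borel_measurable (gauss J)"
      by (intro borel_measurable_Max borel_measurable_sum borel_measurable_times borel_measurable_const comp)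
         (auto simp: sign_cube_finite)
    thus ?thesis unfolding \<psi>_def xi_p_def case_prod_beta' by measurable
  qed
  have \<psi>_le: "\<psi> g \<le> Z (C 1 0 0) g powr p" for g
  proof -
    obtain x y where xy: "x \<in> sign_cube n" "y \<in> sign_cube m"
      "xi_p m n (\<lambda>i j. g (i, j)) = (\<Sum>i<m. \<Sum>j<n. y i * g (i, j) * x j)"
      by (rule xi_p_attained)
    have "wt (C 1 0 0) g (x, y) = exp (\<beta> * (\<Sum>i<m. \<Sum>j<n. y i * g (i, j) * x j))"
      unfolding wt_def sum_bordered sum_mat_block sum_row_block sum_col_block
      by (simp add: coef_def bordered_prod_def mult_ac)
    moreover have "wt (C 1 0 0) g (x, y) \<le> Z (C 1 0 0) g"
      unfolding Z_def using xy finite_S by (intro member_le_sum) (auto simp: wt_def)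
    ultimately have "exp (\<beta> * xi_p m n (\<lambda>i j. g (i, j))) \<le> Z (C 1 0 0) g" using xy by simp
    hence "exp (\<beta> * xi_p m n (\<lambda>i j. g (i, j))) powr p \<le> Z (C 1 0 0) g powr p"
      using p_pos by (intro powr_mono2) auto
    thus ?thesis by (simp add: \<psi>_def exp_powr_real mult_ac)
  qed
  have restrict: "distr (gauss (bordered m n)) N (\<lambda>g. restrict g I) = N"
    unfolding N_def gauss_def using gauss_product.distr_restrict[OF I(2) finite_bordered] by simp
  have rm: "(\<lambda>g. restrict g I) \<in> measurable (gauss (bordered m n)) N"
    unfolding N_def gauss_def by (rule measurable_restrict_subset[OF I(2)])
  have \<psi>_restrict: "\<psi> (restrict g I) = \<psi> g" for g
    unfolding \<psi>_def by (intro arg_cong[where f = exp] arg_cong2[where f = "(*)"] refl xi_p_cong)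
      (auto simp: I_def mat_block_def)
  have intB: "integrable (gauss (bordered m n)) \<psi>"
    by (rule Bochner_Integration.integrable_bound[OF integrable_Z_powr[of "C 1 0 0"] \<psi>m[OF I(2)]])
       (use \<psi>_le in \<open>auto simp: \<psi>_def\<close>)
  have mN: "\<psi> \<in> borel_measurable N" unfolding N_def by (rule \<psi>m) simp
  have intN: "integrable N \<psi>"
    using intB integrable_distr_eq[OF rm mN] by (simp add: restrict \<psi>_restrict)
  have eqN: "(\<integral>g. \<psi> g \<partial>N) = (\<integral>g. \<psi> g \<partial>gauss (bordered m n))"
    using integral_distr[OF rm mN] by (simp add: restrict \<psi>_restrict)
  define h where "h \<omega> = (\<lambda>k\<in>I. (\<lambda>(i, j) \<omega>. H \<omega> i j) k \<omega>)" for \<omega>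
  have dist: "distributed M lborel (\<lambda>\<omega>. H \<omega> i j) std_normal_density" if "(i, j) \<in> I" for i j
    using H that by (auto simp: iid_std_normal_matrix_def I_def mat_block_def)
  have rv: "(\<lambda>(i, j) \<omega>. H \<omega> i j) k \<in> borel_measurable M" if "k \<in> I" for k
    using dist[of "fst k" "snd k"] that by (auto simp: distributed_def case_prod_beta')
  have "M.indep_vars (\<lambda>_. borel) (\<lambda>(i, j) \<omega>. H \<omega> i j) I"
    using H by (simp add: iid_std_normal_matrix_def I_def mat_block_def)
  hence "distr M (\<Pi>\<^sub>M k\<in>I. borel) h = (\<Pi>\<^sub>M k\<in>I. distr M borel ((\<lambda>(i, j) \<omega>. H \<omega> i j) k))"
    unfolding h_def[abs_def] by (subst (asm) M.indep_vars_iff_distr_eq_PiM'[OF I(3) rv]) auto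
  also have "\<dots> = (\<Pi>\<^sub>M k\<in>I. std_normal_distribution)"
  proof (rule PiM_cong[OF refl])
    fix k assume "k \<in> I"
    hence "distr M lborel (\<lambda>\<omega>. H \<omega> (fst k) (snd k)) = std_normal_distribution"
      using dist[of "fst k" "snd k"] by (simp add: distributed_def)
    moreover have "distr M borel ((\<lambda>(i, j) \<omega>. H \<omega> i j) k) = distr M lborel (\<lambda>\<omega>. H \<omega> (fst k) (snd k))"
      by (rule distr_cong) (auto simp: case_prod_beta')
    ultimately show "distr M borel ((\<lambda>(i, j) \<omega>. H \<omega> i j) k) = std_normal_distribution" by simp
  qed
  finally have hd: "distr M (\<Pi>\<^sub>M k\<in>I. borel) h = N" by (simp add: N_def gauss_def)
  have hm: "h \<in> measurable M (\<Pi>\<^sub>M k\<in>I. borel)"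
    unfolding h_def[abs_def] by (intro measurable_restrict rv)
  have mN': "\<psi> \<in> borel_measurable (\<Pi>\<^sub>M k\<in>I. borel)"
    using mN unfolding N_def by (simp cong: measurable_cong_sets add: sets_gauss)
  have \<psi>h: "\<psi> (h \<omega>) = exp (p * \<beta> * xi_p m n (H \<omega>))" for \<omega>
    unfolding \<psi>_def h_def by (intro arg_cong[where f = exp] arg_cong2[where f = "(*)"] refl xi_p_cong)
      (auto simp: I_def mat_block_def)
  show "integrable M (\<lambda>\<omega>. exp (p * \<beta> * xi_p m n (H \<omega>)))"
    using intN integrable_distr_eq[OF hm mN'] by (simp add: hd \<psi>h)
  have "(\<integral>\<omega>. exp (p * \<beta> * xi_p m n (H \<omega>)) \<partial>M) = (\<integral>g. \<psi> g \<partial>gauss (bordered m n))"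
    using integral_distr[OF hm mN'] eqN by (simp add: hd \<psi>h)
  also have "\<dots> \<le> D (C 1 0 0)"
    unfolding D_def by (intro integral_mono intB integrable_Z_powr \<psi>_le)
  finally show "(\<integral>\<omega>. exp (p * \<beta> * xi_p m n (H \<omega>)) \<partial>M) \<le> D (C 1 0 0)" .
qed

text \<open>The moment does not depend on \<open>b\<close>, so the softness loss disappears in the
  limit of large \<open>b\<close>.\<close>

lemma xi_p_exp_moment_le:
  assumes "0 < \<alpha>" "0 < n" "real m = \<alpha> * real n" "0 < c" and H: "iid_std_normal_matrix M m n H"
  shows "integrable M (\<lambda>\<omega>. exp (c * sqrt n * xi_p m n (H \<omega>)))"
    and "(\<integral>\<omega>. exp (c * sqrt n * xi_p m n (H \<omega>)) \<partial>M) \<le> exp (n * rate \<alpha> c)"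
proof -
  have sb: "scaled_bipartite m n \<alpha> b c" if "b \<ge> c" for b
    using assms that by unfold_locales auto
  have bnd: "integrable M (\<lambda>\<omega>. exp (c * sqrt n * xi_p m n (H \<omega>))) \<and>
    (\<integral>\<omega>. exp (c * sqrt n * xi_p m n (H \<omega>)) \<partial>M) \<le> exp (n * (softness_loss \<alpha> c / b\<^sup>2 + rate \<alpha> c))" if "b \<ge> c" for b
  proof -
    interpret scaled_bipartite m n \<alpha> b c by (rule sb[OF that])
    show ?thesis using xi_p_exp_moment[OF H] D_matrix_le unfolding p\<beta> by auto
  qed
  show "integrable M (\<lambda>\<omega>. exp (c * sqrt n * xi_p m n (H \<omega>)))" using bnd[of c] by simp
  have "((\<lambda>b. softness_loss \<alpha> c / b\<^sup>2) \<longlongrightarrow> 0) at_top"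
    by (intro tendsto_divide_0[OF tendsto_const] filterlim_at_top_imp_at_infinity filterlim_pow_at_top filterlim_ident) simp
  hence "((\<lambda>b. exp (n * (softness_loss \<alpha> c / b\<^sup>2 + rate \<alpha> c))) \<longlongrightarrow> exp (n * (0 + rate \<alpha> c))) at_top"
    by (intro tendsto_intros)
  hence "(\<integral>\<omega>. exp (c * sqrt n * xi_p m n (H \<omega>)) \<partial>M) \<le> exp (n * (0 + rate \<alpha> c))"
    by (rule tendsto_lowerbound) (use bnd in \<open>auto intro!: eventually_at_top_linorderI[of c]\<close>)
  thus "(\<integral>\<omega>. exp (c * sqrt n * xi_p m n (H \<omega>)) \<partial>M) \<le> exp (n * rate \<alpha> c)" by simp
qed

text \<open>Here \<open>b\<close> stays fixed while \<open>n\<close> grows. \<open>\<delta>\<close>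
  and \<open>n0\<close> are chosen before \<open>n\<close>, \<open>M\<close> and \<open>H\<close>,
  so the probability space may change with \<open>n\<close>.\<close>

lemma xi_p_exp_moment_strict:
  assumes \<alpha>: "0 < \<alpha>" and c: "0 < c"
  shows "\<exists>\<delta>>0. \<exists>n0. \<forall>n m (M :: 'a measure) H. n0 \<le> real n \<longrightarrow> 0 < n \<longrightarrow> real m = \<alpha> * real n \<longrightarrow>
     iid_std_normal_matrix M m n H \<longrightarrow>
     (\<integral>\<omega>. exp (c * sqrt n * xi_p m n (H \<omega>)) \<partial>M) \<le> exp (n * (rate \<alpha> c - \<delta>))"
proof -
  define \<kappa> where "\<kappa> = min (log_erfc_slope (c / sqrt 2)) (\<alpha> * log_erfc_slope (c / sqrt (2 * \<alpha>)))"
  have \<kappa>: "\<kappa> > 0" using \<alpha> c log_erfc_slope_pos by (simp add: \<kappa>_def)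
  define \<rho> where "\<rho> = min (1 / 4) (\<kappa> / 2 / (c\<^sup>2 / 2 + \<kappa>))"
  have ck: "c\<^sup>2 / 2 + \<kappa> > 0" using \<kappa> by (intro add_nonneg_pos) auto
  have \<rho>: "\<rho> > 0" using \<kappa> ck by (simp add: \<rho>_def)
  have \<rho>_le: "\<rho> \<le> 1 / 4" by (simp only: \<rho>_def min.cobounded1)
  have "\<rho> * (c\<^sup>2 / 2 + \<kappa>) \<le> (\<kappa> / 2 / (c\<^sup>2 / 2 + \<kappa>)) * (c\<^sup>2 / 2 + \<kappa>)"
    using ck by (intro mult_right_mono) (simp_all only: \<rho>_def min.cobounded2 less_imp_le)
  also have "\<dots> = \<kappa> / 2" by (rule nonzero_eq_divide_eq[THEN iffD1]) (use ck in auto)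
  finally have \<rho>_small: "\<rho> * (c\<^sup>2 / 2 + \<kappa>) \<le> \<kappa> / 2" .
  define \<mu> where "\<mu> = \<kappa> / (4 * c)"
  have \<mu>: "\<mu> > 0" using \<kappa> c by (simp add: \<mu>_def)
  define K where "K = softness_loss \<alpha> c"
  have K: "K > 0" using \<alpha> c unfolding K_def softness_loss_def by (intro mult_pos_pos add_pos_pos) auto
  \<comment> \<open>\<open>2 * c\<close> makes \<open>b - c \<ge> b / 2\<close>, so the gain is at
    least \<open>c * \<mu>\<^sup>2 / (128 * b)\<close>; the third summand limits the loss to half of
    that, and the last one, with \<open>1 \<le> b\<close>, provides \<open>slack\<close>.\<close>
  define b where "b = 1 + 2 * c + 256 * K / (c * \<mu>\<^sup>2) + 8 * K / (\<rho> * \<kappa>)"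
  have b: "1 \<le> b" "2 * c \<le> b" "256 * K / (c * \<mu>\<^sup>2) \<le> b" "8 * K / (\<rho> * \<kappa>) \<le> b"
  proof -
    have "0 \<le> 256 * K / (c * \<mu>\<^sup>2)" "0 \<le> 8 * K / (\<rho> * \<kappa>)" using K c \<rho> \<kappa> by auto
    thus "1 \<le> b" "2 * c \<le> b" "256 * K / (c * \<mu>\<^sup>2) \<le> b" "8 * K / (\<rho> * \<kappa>) \<le> b"
      using c unfolding b_def by linarith+
  qed
  define \<epsilon> where "\<epsilon> = \<rho> * \<kappa> / 8"
  define \<delta> where "\<delta> = min \<epsilon> (c * \<mu>\<^sup>2 / (256 * b))"
  define n0 where "n0 = max (2 / (c * \<rho> * \<mu>)) (4 * b / (c * \<rho> * \<mu>\<^sup>2))"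
  have \<delta>: "\<delta> > 0" using \<rho> \<kappa> c \<mu> b by (simp add: \<delta>_def \<epsilon>_def)
  have Kb1: "K / b\<^sup>2 \<le> \<rho> * \<kappa> / 8"
  proof -
    have "K / b\<^sup>2 \<le> K / b" using K b by (intro divide_left_mono) (auto simp: power2_eq_square)
    also have "\<dots> \<le> \<rho> * \<kappa> / 8" using b(1,4) \<rho> \<kappa> by (simp add: field_simps)
    finally show ?thesis .
  qed
  have Kb2: "K / b\<^sup>2 \<le> c * \<mu>\<^sup>2 / (256 * b)"
  proof -
    have "256 * K \<le> b * (c * \<mu>\<^sup>2)" using b(3) c \<mu> by (simp add: pos_divide_le_eq)
    hence "256 * K / (256 * b\<^sup>2) \<le> b * (c * \<mu>\<^sup>2) / (256 * b\<^sup>2)" by (rule divide_right_mono) simp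
    thus ?thesis using b by (simp add: power2_eq_square)
  qed
  have gain: "c * \<mu>\<^sup>2 / (128 * b) \<le> c * (b - c) * \<mu>\<^sup>2 / (64 * b\<^sup>2)"
  proof -
    have "c * \<mu>\<^sup>2 / (64 * b\<^sup>2) * (b / 2) \<le> c * \<mu>\<^sup>2 / (64 * b\<^sup>2) * (b - c)"
      using b c by (intro mult_left_mono) auto
    thus ?thesis using b by (simp add: power2_eq_square mult_ac)
  qed
  show ?thesis
  proof (rule exI[of _ \<delta>], rule conjI[OF \<delta>], rule exI[of _ n0], intro allI impI)
    fix n m :: nat and M :: "'a measure" and H
    assume n: "n0 \<le> real n" "0 < n" "real m = \<alpha> * real n" and H: "iid_std_normal_matrix M m n H"
    interpret scaled_bipartite m n \<alpha> b c using \<alpha> c n b by unfold_locales auto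
    have "D (C 1 0 0) \<le> exp (n * (rate \<alpha> c - \<delta>))"
    \<comment> \<open>Either the moment already has a gain \<open>\<epsilon>\<close>, or the
      comparison is tight and the improved bound applies.\<close>
    proof (cases "D (C 1 0 0) \<le> exp (n * (rate \<alpha> c - \<epsilon>))")
      case True
      also have "exp (n * (rate \<alpha> c - \<epsilon>)) \<le> exp (n * (rate \<alpha> c - \<delta>))"
        unfolding exp_le_cancel_iff by (intro mult_left_mono) (auto simp: \<delta>_def)
      finally show ?thesis .
    next
      case False
      interpret T: tight_bipartite m n \<alpha> b c \<kappa> \<rho> \<epsilon>
      proof
        show "softness_loss \<alpha> c / b\<^sup>2 + \<epsilon> \<le> \<rho> * \<kappa> / 4" using Kb1 unfolding K_def[symmetric] \<epsilon>_def by linarith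
        show "exp (n * (rate \<alpha> c - \<epsilon>)) \<le> D (C 1 0 0)" using False by simp
      qed (use \<kappa> \<rho> \<rho>_le \<rho>_small in \<open>auto simp: \<kappa>_def\<close>)
      have \<mu>_eq: "T.\<mu> = \<mu>" by (simp add: T.\<mu>_def \<mu>_def)
      have n1: "2 / (c * n * \<rho>) \<le> T.\<mu>"
      proof -
        have "2 / (c * \<rho> * \<mu>) \<le> n" using n by (simp add: n0_def)
        hence "2 \<le> n * (c * \<rho> * \<mu>)" using c \<rho> \<mu> by (simp add: pos_divide_le_eq)
        thus ?thesis using c \<rho> n unfolding \<mu>_eq by (simp add: pos_divide_le_eq mult_ac)
      qed
      have n2: "4 / (c * n * \<rho>) \<le> T.\<mu>\<^sup>2 / b"
      proof -
        have "4 * b / (c * \<rho> * \<mu>\<^sup>2) \<le> n" using n by (simp add: n0_def)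
        hence "4 * b \<le> n * (c * \<rho> * \<mu>\<^sup>2)" using c \<rho> \<mu> by (simp add: pos_divide_le_eq)
        thus ?thesis using c \<rho> n b unfolding \<mu>_eq by (simp add: pos_divide_le_eq pos_le_divide_eq mult_ac)
      qed
      have "D (C 1 0 0) \<le> exp (n * (rate \<alpha> c + K / b\<^sup>2 - c * (b - c) * \<mu>\<^sup>2 / (64 * b\<^sup>2)))"
        using T.D_matrix_improved[OF n1 n2] unfolding \<mu>_eq K_def .
      also have "\<dots> \<le> exp (n * (rate \<alpha> c - \<delta>))"
      proof -
        have "K / b\<^sup>2 - c * (b - c) * \<mu>\<^sup>2 / (64 * b\<^sup>2) \<le> c * \<mu>\<^sup>2 / (256 * b) - c * \<mu>\<^sup>2 / (128 * b)"
          using Kb2 gain by linarith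
        also have "\<dots> = - (c * \<mu>\<^sup>2 / (256 * b))" by simp
        also have "\<dots> \<le> - \<delta>" by (simp add: \<delta>_def)
        finally show ?thesis unfolding exp_le_cancel_iff by (intro mult_left_mono) auto
      qed
      finally show ?thesis .
    qed
    thus "(\<integral>\<omega>. exp (c * sqrt n * xi_p m n (H \<omega>)) \<partial>M) \<le> exp (n * (rate \<alpha> c - \<delta>))"
      using xi_p_exp_moment(2)[OF H] unfolding p\<beta> by simp
  qed
qed

section \<open>The minimiser is positive\<close>

lemma lifted_expr_eq_rate: "c \<noteq> 0 \<Longrightarrow> lifted_expr \<alpha> c = rate \<alpha> c / c"
  by (simp add: lifted_expr_def rate_def add_divide_distrib power2_eq_square)

text \<open>The constant \<open>3/5\<close> lies between \<open>1/2\<close>, which is what makes the objective decrease near \<open>0\<close>,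
  and \<open>2/pi\<close>, the exact coefficient in the expansion.\<close>

lemma ln_erfc_neg_le:
  assumes "0 < z" "z \<le> 1 / 50"
  shows "ln (erfc (- z)) \<le> 2 / sqrt pi * z - 3 / 5 * z\<^sup>2"
proof -
  define a where "a = 2 / sqrt pi"
  have a2: "a\<^sup>2 = 4 / pi" by (simp add: a_def power_divide)
  have pi: "pi \<le> 32 / 10" using pi_approx by simp
  have a2_ge: "5 / 4 \<le> a\<^sup>2" unfolding a2 using pi by (simp add: field_simps)
  have a: "1 \<le> a" 
  proof (rule power2_le_imp_le)
    show "1\<^sup>2 \<le> a\<^sup>2" using a2_ge by simp
  qed (simp add: a_def)
  define w where "w = a * z - 3 / 5 * z\<^sup>2"
  have "w = z * (a - 3 / 5 * z)" by (simp add: w_def power2_eq_square algebra_simps)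
  moreover have "a - 3 / 5 * z \<ge> 0" using a assms by simp
  ultimately have w: "w \<ge> 0" using assms by simp
  have "integral {0..z} (\<lambda>t. exp (- t\<^sup>2)) \<le> integral {0..z} (\<lambda>t. 1::real)"
    by (intro integral_le integrable_continuous_real continuous_intros) auto
  hence "integral {0..z} (\<lambda>t. exp (- t\<^sup>2)) \<le> z" using assms by simp
  hence "erfc (- z) \<le> 1 + a * z"
    using assms unfolding a_def by (subst erfc_neg) (auto intro!: divide_right_mono)
  \<comment> \<open>It suffices that \<open>w\<^sup>2 \<ge> 6 / 5 * z\<^sup>2\<close>, which
    compensates the subtracted \<open>3 / 5 * z\<^sup>2\<close>; this holds since
    \<open>a\<^sup>2 \<ge> 5 / 4\<close> and \<open>z\<close> is small.\<close>
  also have "\<dots> \<le> 1 + w + w\<^sup>2 / 2"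
  proof -
    have "w\<^sup>2 = z\<^sup>2 * (a\<^sup>2 - 6 / 5 * a * z + (3 / 5 * z)\<^sup>2)" unfolding w_def by (simp add: power2_eq_square algebra_simps)
    moreover have "a\<^sup>2 - 6 / 5 * a * z + (3 / 5 * z)\<^sup>2 \<ge> 6 / 5"
    proof -
      have "a * z \<le> a\<^sup>2 * (1 / 50)" unfolding power2_eq_square mult.assoc using a assms by (intro mult_left_mono) (auto intro: order_trans[of _ "1/50"])
      moreover have "0 \<le> (3 / 5 * z)\<^sup>2" by (rule zero_le_power2)
      ultimately show ?thesis using a2_ge unfolding mult.assoc by linarith
    qed
    ultimately have "w\<^sup>2 \<ge> z\<^sup>2 * (6 / 5)" by (simp only: mult_left_mono zero_le_power2)
    thus ?thesis unfolding w_def by simp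
  qed
  also have "\<dots> \<le> exp w" by (rule exp_lower_Taylor_quadratic[OF w])
  finally have "ln (erfc (- z)) \<le> ln (exp w)"
    using erfc_neg_ge_1[of z] assms by (subst ln_le_cancel_iff) auto
  thus ?thesis by (simp add: w_def a_def)
qed

lemma lifted_obj_0: "\<alpha> > 0 \<Longrightarrow> lifted_obj \<alpha> 0 = 2 / (sqrt pi * sqrt 2) + \<alpha> * (2 / (sqrt pi * sqrt (2 * \<alpha>)))"
proof -
  assume \<alpha>: "\<alpha> > 0"
  have "((\<lambda>c. c / 2 + ln (erfc (- (c / sqrt 2))) / c + \<alpha> * (ln (erfc (- (c / sqrt (2 * \<alpha>)))) / c))
      \<longlongrightarrow> 0 / 2 + 2 / (sqrt pi * sqrt 2) + \<alpha> * (2 / (sqrt pi * sqrt (2 * \<alpha>)))) (at_right 0)"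
    using \<alpha> by (intro tendsto_intros ln_erfc_limit) auto
  hence "(lifted_expr \<alpha> \<longlongrightarrow> 0 / 2 + 2 / (sqrt pi * sqrt 2) + \<alpha> * (2 / (sqrt pi * sqrt (2 * \<alpha>)))) (at_right 0)"
    by (simp add: lifted_expr_def[abs_def])
  from tendsto_unique[OF _ lifted_expr_limit[OF \<alpha>] this] show ?thesis by simp
qed

text \<open>Excludes a minimum at \<open>c = 0\<close>, where there would be no exponential moment
  to work with.\<close>

lemma lifted_obj_less_at_0:
  assumes \<alpha>: "\<alpha> > 0"
  obtains c where "c > 0" "lifted_obj \<alpha> c < lifted_obj \<alpha> 0"
proof -
  define c where "c = min (1 / 50) (sqrt \<alpha> / 50)"
  have c: "c > 0" "c \<le> 1 / 50" "c \<le> sqrt \<alpha> / 50" using \<alpha> by (auto simp: c_def)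
  have s2: "sqrt 2 \<ge> 1" by simp
  have 1: "ln (erfc (- (c / sqrt 2))) \<le> 2 / sqrt pi * (c / sqrt 2) - 3 / 5 * (c / sqrt 2)\<^sup>2"
  proof (rule ln_erfc_neg_le)
    have "c / sqrt 2 \<le> c / 1" using c by (intro divide_left_mono) auto
    also have "\<dots> \<le> 1 / 50" using c by simp
    finally show "c / sqrt 2 \<le> 1 / 50" .
  qed (use c in simp)
  have 2: "ln (erfc (- (c / sqrt (2 * \<alpha>)))) \<le> 2 / sqrt pi * (c / sqrt (2 * \<alpha>)) - 3 / 5 * (c / sqrt (2 * \<alpha>))\<^sup>2"
  proof (rule ln_erfc_neg_le)
    have "c / sqrt (2 * \<alpha>) \<le> c / sqrt \<alpha>" using c \<alpha> by (intro divide_left_mono) auto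
    also have "\<dots> \<le> 1 / 50" using c \<alpha> by (simp add: pos_divide_le_eq)
    finally show "c / sqrt (2 * \<alpha>) \<le> 1 / 50" .
  qed (use c \<alpha> in simp)
  have "rate \<alpha> c \<le> c\<^sup>2 / 2 + (2 / sqrt pi * (c / sqrt 2) - 3 / 5 * (c / sqrt 2)\<^sup>2)
     + \<alpha> * (2 / sqrt pi * (c / sqrt (2 * \<alpha>)) - 3 / 5 * (c / sqrt (2 * \<alpha>))\<^sup>2)"
    unfolding rate_def using \<alpha> by (intro add_mono order_refl 1 mult_left_mono[OF 2]) simp
  \<comment> \<open>Each erfc term contributes \<open>- 3 / 10 * c\<^sup>2\<close> whatever
    \<open>\<alpha>\<close> is, against \<open>c\<^sup>2 / 2\<close>.\<close>
  also have "\<dots> = c * lifted_obj \<alpha> 0 - c\<^sup>2 / 10"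
    using \<alpha> by (simp add: lifted_obj_0 power_divide algebra_simps)
  also have "\<dots> < c * lifted_obj \<alpha> 0" using c by simp
  finally have "lifted_obj \<alpha> c < lifted_obj \<alpha> 0"
    using c by (simp add: lifted_obj_def lifted_expr_eq_rate pos_divide_less_eq mult.commute)
  thus ?thesis using that c by blast
qed

lemma xi_u_low_attained:
  assumes "\<alpha> > 0"
  obtains c where "c > 0" "rate \<alpha> c = c * xi_u_low \<alpha>" "xi_u_low \<alpha> \<ge> 0"
proof -
  obtain c where c: "c \<ge> 0" "lifted_obj \<alpha> c = xi_u_low \<alpha>" using xi_u_low_is_min(1)[OF assms] by auto
  obtain c' where c': "c' > 0" "lifted_obj \<alpha> c' < lifted_obj \<alpha> 0" by (rule lifted_obj_less_at_0[OF assms])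
  have "xi_u_low \<alpha> \<le> lifted_obj \<alpha> c'" using xi_u_low_is_min(2)[OF assms] c' by simp
  hence "c \<noteq> 0" using c c' by auto
  hence c0: "c > 0" using c by simp
  have "rate \<alpha> c = c * xi_u_low \<alpha>" using c c0 by (simp add: lifted_obj_def lifted_expr_eq_rate field_simps)
  moreover have "xi_u_low \<alpha> \<ge> 0" using lifted_obj_ge[OF assms c0] c c0 by simp
  ultimately show ?thesis using that c0 by blast
qed

lemma expectation_xi_p_le:
  assumes \<alpha>: "0 < \<alpha>" and n: "0 < n" "real m = \<alpha> * real n" and H: "iid_std_normal_matrix M m n H"
  shows "(\<integral>\<omega>. xi_p m n (H \<omega>) \<partial>M) / sqrt n \<le> xi_u_low \<alpha>"
proof -
  interpret prob_space M using H by (simp add: iid_std_normal_matrix_def)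
  obtain c where c: "c > 0" "rate \<alpha> c = c * xi_u_low \<alpha>" by (rule xi_u_low_attained[OF \<alpha>])
  define \<mu> where "\<mu> = (\<integral>\<omega>. xi_p m n (H \<omega>) \<partial>M)"
  define l where "l = c * sqrt n"
  have l: "l > 0" using c n by (simp add: l_def)
  note e = xi_p_exp_moment_le[OF \<alpha> n c(1) H, folded l_def]
  note i = integrable_xi_p[OF H]
  \<comment> \<open>Jensen's inequality through the tangent of exp at the mean, whose linear part
    integrates to 0.\<close>
  have "(\<integral>\<omega>. exp (l * \<mu>) * (1 + l * (xi_p m n (H \<omega>) - \<mu>)) \<partial>M) \<le> (\<integral>\<omega>. exp (l * xi_p m n (H \<omega>)) \<partial>M)"
  proof (intro integral_mono e(1))
    show "integrable M (\<lambda>\<omega>. exp (l * \<mu>) * (1 + l * (xi_p m n (H \<omega>) - \<mu>)))"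
      using i by (intro integrable_mult_right Bochner_Integration.integrable_add Bochner_Integration.integrable_diff) auto
    fix \<omega>
    have "exp (l * \<mu>) * (1 + l * (xi_p m n (H \<omega>) - \<mu>)) \<le> exp (l * \<mu>) * exp (l * (xi_p m n (H \<omega>) - \<mu>))"
      by (intro mult_left_mono exp_ge_add_one_self) simp
    thus "exp (l * \<mu>) * (1 + l * (xi_p m n (H \<omega>) - \<mu>)) \<le> exp (l * xi_p m n (H \<omega>))"
      by (simp add: exp_add[symmetric] algebra_simps)
  qed
  also have "(\<integral>\<omega>. exp (l * \<mu>) * (1 + l * (xi_p m n (H \<omega>) - \<mu>)) \<partial>M) = exp (l * \<mu>)"
    using i by (simp add: \<mu>_def prob_space)
  also note e(2)
  finally have "l * \<mu> \<le> n * (c * xi_u_low \<alpha>)" unfolding c(2) exp_le_cancel_iff .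
  hence "c * (sqrt n * \<mu>) \<le> c * (n * xi_u_low \<alpha>)" by (simp add: l_def mult_ac)
  hence "sqrt n * \<mu> \<le> n * xi_u_low \<alpha>" using c by simp
  also have "n * xi_u_low \<alpha> = sqrt n * (sqrt n * xi_u_low \<alpha>)" by simp
  finally have "\<mu> \<le> sqrt n * xi_u_low \<alpha>" using n by simp
  thus ?thesis using n by (simp add: \<mu>_def pos_divide_le_eq mult.commute)
qed

text \<open>At the minimiser \<open>rate \<alpha> c = c * xi_u_low \<alpha>\<close> cancels against
  the threshold in Markov's inequality, so exactly the gain \<open>\<delta>\<close>
  survives.\<close>

lemma prob_xi_p_ge:
  assumes \<alpha>: "0 < \<alpha>"
  shows "\<exists>\<delta>>0. \<exists>n0. \<forall>n m (M :: 'a measure) H. n0 \<le> real n \<longrightarrow> 0 < n \<longrightarrow> real m = \<alpha> * real n \<longrightarrow>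
     iid_std_normal_matrix M m n H \<longrightarrow>
     1 - exp (- (\<delta> * n)) \<le> \<P>(\<omega> in M. xi_p m n (H \<omega>) \<le> sqrt n * xi_u_low \<alpha>)"
proof -
  obtain c where c: "c > 0" "rate \<alpha> c = c * xi_u_low \<alpha>" by (rule xi_u_low_attained[OF \<alpha>])
  obtain \<delta> n0 where \<delta>: "\<delta> > 0" and strict: "\<forall>n m (M :: 'a measure) H. n0 \<le> real n \<longrightarrow> 0 < n \<longrightarrow> real m = \<alpha> * real n \<longrightarrow>
     iid_std_normal_matrix M m n H \<longrightarrow>
     (\<integral>\<omega>. exp (c * sqrt n * xi_p m n (H \<omega>)) \<partial>M) \<le> exp (n * (rate \<alpha> c - \<delta>))"
    using xi_p_exp_moment_strict[OF \<alpha> c(1), where 'a = 'a] by blast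
  show ?thesis
  proof (rule exI[of _ \<delta>], rule conjI[OF \<delta>], rule exI[of _ n0], intro allI impI)
    fix n m and M :: "'a measure" and H
    assume n: "n0 \<le> real n" "0 < n" "real m = \<alpha> * real n" and H: "iid_std_normal_matrix M m n H"
    interpret prob_space M using H by (simp add: iid_std_normal_matrix_def)
    let ?X = "\<lambda>\<omega>. xi_p m n (H \<omega>)" and ?y = "sqrt n * xi_u_low \<alpha>"
    have [measurable]: "?X \<in> borel_measurable M" using integrable_xi_p[OF H] by simp
    have l: "c * sqrt n > 0" using c n by simp
    have "prob {\<omega> \<in> space M. \<not> ?X \<omega> \<le> ?y} \<le> prob {\<omega> \<in> space M. exp (c * sqrt n * ?X \<omega>) \<ge> exp (c * sqrt n * ?y)}"
      by (intro finite_measure_mono) (use c n in auto)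
    also have "\<dots> \<le> (\<integral>\<omega>. exp (c * sqrt n * ?X \<omega>) \<partial>M) / exp (c * sqrt n * ?y)"
      by (intro integral_Markov_inequality_measure[where A = "space M"] xi_p_exp_moment_le[OF \<alpha> n(2,3) c(1) H]) auto
    also have "\<dots> \<le> exp (n * (rate \<alpha> c - \<delta>)) / exp (c * sqrt n * ?y)"
      using strict n H by (intro divide_right_mono) auto
    also have "\<dots> = exp (- (\<delta> * n))"
      using c by (simp add: exp_diff[symmetric] algebra_simps)
    finally have "prob {\<omega> \<in> space M. \<not> ?X \<omega> \<le> ?y} \<le> exp (- (\<delta> * n))" .
    moreover have "prob {\<omega> \<in> space M. \<not> ?X \<omega> \<le> ?y} = 1 - \<P>(\<omega> in M. ?X \<omega> \<le> ?y)"
      by (intro prob_neg) measurable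
    ultimately show "1 - exp (- (\<delta> * n)) \<le> \<P>(\<omega> in M. ?X \<omega> \<le> ?y)" by simp
  qed
qed

section \<open>The case \<open>\<alpha> = 1\<close> numerically\<close>

definition gauss_const :: real where "gauss_const = 2 / sqrt pi / sqrt 2"

lemma gauss_const_nonneg[simp]: "0 \<le> gauss_const"
  by (simp add: gauss_const_def)

lemma gauss_const_bounds: "0.79788 \<le> gauss_const" "gauss_const \<le> 0.79789"
proof -
  have sq: "gauss_const\<^sup>2 = 2 / pi" by (simp add: gauss_const_def power_divide power_mult_distrib)
  have "(0.79788::real)\<^sup>2 \<le> gauss_const\<^sup>2" unfolding sq using pi_approx pi_gt_zero by (simp add: field_simps power2_eq_square)
  thus "0.79788 \<le> gauss_const" by (rule power2_le_imp_le) simp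
  have "gauss_const\<^sup>2 \<le> (0.79789::real)\<^sup>2" unfolding sq using pi_approx pi_gt_zero by (simp add: field_simps power2_eq_square)
  thus "gauss_const \<le> 0.79789" by (rule power2_le_imp_le) simp
qed

text \<open>Twice the standard normal distribution function.\<close>

definition scaled_erfc where "scaled_erfc c = erfc (- (c / sqrt 2))"

lemma scaled_erfc_deriv:
  assumes "c > 0"
  shows "(scaled_erfc has_real_derivative gauss_const * exp (- c\<^sup>2 / 2)) (at c)"
proof -
  have d: "((\<lambda>z. erfc (- z)) has_real_derivative 2 / sqrt pi * exp (- (c / sqrt 2)\<^sup>2)) (at (c / sqrt 2))"
  proof -
    have "at (c / sqrt 2) within {0..} = at (c / sqrt 2)"
      using assms by (intro at_within_interior) simp
    thus ?thesis using erfc_neg_deriv[of "c / sqrt 2"] assms by simp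
  qed
  have "((\<lambda>c. c / sqrt 2) has_real_derivative 1 / sqrt 2) (at c)"
    by (rule DERIV_cdivide[OF DERIV_ident])
  note chain = DERIV_chain2[OF d this]
  have "(c / sqrt 2)\<^sup>2 = c\<^sup>2 / 2" by (simp add: power_divide)
  hence "2 / sqrt pi * exp (- (c / sqrt 2)\<^sup>2) * (1 / sqrt 2) = gauss_const * exp (- c\<^sup>2 / 2)"
    unfolding gauss_const_def
    by (simp only: times_divide_eq_right times_divide_eq_left mult_1_right minus_divide_left)
  with chain show ?thesis unfolding scaled_erfc_def[abs_def] by simp
qed

lemma scaled_erfc_continuous: "continuous_on {0..} scaled_erfc"
  unfolding scaled_erfc_def[abs_def] by (rule continuous_on_compose2[OF erfc_neg_continuous]) (auto intro!: continuous_intros)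

lemma scaled_erfc_0: "scaled_erfc 0 = 1" by (simp add: scaled_erfc_def erfc_0)

section \<open>Polynomial bounds for exp and the normal distribution function\<close>

lemma exp_minus_bounds:
  fixes u :: real
  assumes "u \<ge> 0"
  shows "1 - u + u ^ 2 / 2 - u ^ 3 / 6 + u ^ 4 / 24 - u ^ 5 / 120 \<le> exp (- u)"
    and "exp (- u) \<le> 1 - u + u ^ 2 / 2 - u ^ 3 / 6 + u ^ 4 / 24"
proof -
  obtain t where "exp (- u) = (\<Sum>m<6. (- u) ^ m / fact m) + (exp t / fact 6) * (- u) ^ 6"
    using Maclaurin_exp_le[of "- u" 6] by auto
  moreover have "0 \<le> (exp t / fact 6) * (- u) ^ 6" by simp
  ultimately show "1 - u + u ^ 2 / 2 - u ^ 3 / 6 + u ^ 4 / 24 - u ^ 5 / 120 \<le> exp (- u)"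
    by (simp add: eval_nat_numeral)
  obtain t where "exp (- u) = (\<Sum>m<5. (- u) ^ m / fact m) + (exp t / fact 5) * (- u) ^ 5"
    using Maclaurin_exp_le[of "- u" 5] by auto
  moreover have "(exp t / fact 5) * (- u) ^ 5 \<le> 0" using assms by (intro mult_nonneg_nonpos) auto
  ultimately show "exp (- u) \<le> 1 - u + u ^ 2 / 2 - u ^ 3 / 6 + u ^ 4 / 24"
    by (simp add: eval_nat_numeral)
qed

text \<open>The last denominator is \<open>fact 8 / 3\<close>, from the Lagrange remainder with
  \<open>exp 1 \<le> 3\<close>.\<close>

lemma exp_bounds:
  fixes x :: real
  assumes "0 \<le> x" "x \<le> 1"
  shows "1 + x + x ^ 2 / 2 + x ^ 3 / 6 + x ^ 4 / 24 + x ^ 5 / 120 + x ^ 6 / 720 + x ^ 7 / 5040 \<le> exp x"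
    and "exp x \<le> 1 + x + x ^ 2 / 2 + x ^ 3 / 6 + x ^ 4 / 24 + x ^ 5 / 120 + x ^ 6 / 720 + x ^ 7 / 5040 + x ^ 8 / 13440"
proof -
  obtain t where t: "\<bar>t\<bar> \<le> \<bar>x\<bar>" "exp x = (\<Sum>m<8. x ^ m / fact m) + (exp t / fact 8) * x ^ 8"
    using Maclaurin_exp_le[of x 8] by auto
  have s: "(\<Sum>m<8. x ^ m / fact m) = 1 + x + x ^ 2 / 2 + x ^ 3 / 6 + x ^ 4 / 24 + x ^ 5 / 120 + x ^ 6 / 720 + x ^ 7 / 5040"
    by (simp add: eval_nat_numeral)
  have "0 \<le> (exp t / fact 8) * x ^ 8" by simp
  thus "1 + x + x ^ 2 / 2 + x ^ 3 / 6 + x ^ 4 / 24 + x ^ 5 / 120 + x ^ 6 / 720 + x ^ 7 / 5040 \<le> exp x"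
    using t(2) unfolding s by linarith
  have "exp t \<le> exp 1" using t(1) assms by simp
  hence "exp t \<le> 3" using exp_le by (rule order_trans)
  hence "exp t / fact 8 * x ^ 8 \<le> 3 / fact 8 * x ^ 8" by (intro mult_right_mono divide_right_mono) auto
  also have "3 / fact 8 * x ^ 8 = x ^ 8 / 13440" by (simp add: eval_nat_numeral)
  finally show "exp x \<le> 1 + x + x ^ 2 / 2 + x ^ 3 / 6 + x ^ 4 / 24 + x ^ 5 / 120 + x ^ 6 / 720 + x ^ 7 / 5040 + x ^ 8 / 13440"
    using t(2) unfolding s by linarith
qed

text \<open>Integrated Taylor bounds for \<open>exp (- t\<^sup>2 / 2)\<close>: the coefficient of
  \<open>c ^ (2 * k + 1)\<close> is, up to sign,
  \<open>1 / (2 ^ k * fact k * (2 * k + 1))\<close>.\<close>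

lemma scaled_erfc_bounds:
  assumes "0 \<le> c"
  shows "1 + gauss_const * (c - c ^ 3 / 6 + c ^ 5 / 40 - c ^ 7 / 336 + c ^ 9 / 3456 - c ^ 11 / 42240) \<le> scaled_erfc c"
    and "scaled_erfc c \<le> 1 + gauss_const * (c - c ^ 3 / 6 + c ^ 5 / 40 - c ^ 7 / 336 + c ^ 9 / 3456)"
proof -
  have cont: "continuous_on {0..c} scaled_erfc" by (rule continuous_on_subset[OF scaled_erfc_continuous]) auto
  let ?P = "\<lambda>c::real. c - c ^ 3 / 6 + c ^ 5 / 40 - c ^ 7 / 336 + c ^ 9 / 3456 - c ^ 11 / 42240"
  let ?Q = "\<lambda>c::real. c - c ^ 3 / 6 + c ^ 5 / 40 - c ^ 7 / 336 + c ^ 9 / 3456"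
  have P: "(?P has_real_derivative 1 - (t\<^sup>2 / 2) + (t\<^sup>2 / 2) ^ 2 / 2 - (t\<^sup>2 / 2) ^ 3 / 6 + (t\<^sup>2 / 2) ^ 4 / 24 - (t\<^sup>2 / 2) ^ 5 / 120) (at t)" for t
    by (auto intro!: derivative_eq_intros simp: field_simps simp flip: power_mult)
  have Q: "(?Q has_real_derivative 1 - (t\<^sup>2 / 2) + (t\<^sup>2 / 2) ^ 2 / 2 - (t\<^sup>2 / 2) ^ 3 / 6 + (t\<^sup>2 / 2) ^ 4 / 24) (at t)" for t
    by (auto intro!: derivative_eq_intros simp: field_simps simp flip: power_mult)
  have "scaled_erfc 0 - (1 + gauss_const * ?P 0) \<le> scaled_erfc c - (1 + gauss_const * ?P c)"
  proof (rule DERIV_nonneg_imp_increasing_open[OF assms, of "\<lambda>c. scaled_erfc c - (1 + gauss_const * ?P c)"])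
    fix t assume t: "0 < t" "t < c"
    have "((\<lambda>c. scaled_erfc c - (1 + gauss_const * ?P c)) has_real_derivative
        gauss_const * exp (- t\<^sup>2 / 2) - (0 + gauss_const * (1 - (t\<^sup>2 / 2) + (t\<^sup>2 / 2) ^ 2 / 2 - (t\<^sup>2 / 2) ^ 3 / 6 + (t\<^sup>2 / 2) ^ 4 / 24 - (t\<^sup>2 / 2) ^ 5 / 120))) (at t)"
      by (intro DERIV_diff scaled_erfc_deriv t DERIV_add DERIV_const DERIV_cmult P)
    moreover have "gauss_const * (1 - (t\<^sup>2 / 2) + (t\<^sup>2 / 2) ^ 2 / 2 - (t\<^sup>2 / 2) ^ 3 / 6 + (t\<^sup>2 / 2) ^ 4 / 24 - (t\<^sup>2 / 2) ^ 5 / 120)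
        \<le> gauss_const * exp (- t\<^sup>2 / 2)"
      using exp_minus_bounds(1)[of "t\<^sup>2 / 2"] by (intro mult_left_mono) auto
    ultimately show "\<exists>y. ((\<lambda>c. scaled_erfc c - (1 + gauss_const * ?P c)) has_real_derivative y) (at t) \<and> 0 \<le> y"
      by (intro exI conjI) auto
  qed (intro continuous_intros cont, auto)
  thus "1 + gauss_const * ?P c \<le> scaled_erfc c" by (simp add: scaled_erfc_0)
  have "(1 + gauss_const * ?Q 0) - scaled_erfc 0 \<le> (1 + gauss_const * ?Q c) - scaled_erfc c"
  proof (rule DERIV_nonneg_imp_increasing_open[OF assms, of "\<lambda>c. (1 + gauss_const * ?Q c) - scaled_erfc c"])
    fix t assume t: "0 < t" "t < c"
    have "((\<lambda>c. (1 + gauss_const * ?Q c) - scaled_erfc c) has_real_derivative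
        (0 + gauss_const * (1 - (t\<^sup>2 / 2) + (t\<^sup>2 / 2) ^ 2 / 2 - (t\<^sup>2 / 2) ^ 3 / 6 + (t\<^sup>2 / 2) ^ 4 / 24)) - gauss_const * exp (- t\<^sup>2 / 2)) (at t)"
      by (intro DERIV_diff scaled_erfc_deriv t DERIV_add DERIV_const DERIV_cmult Q)
    moreover have "gauss_const * exp (- t\<^sup>2 / 2)
        \<le> gauss_const * (1 - (t\<^sup>2 / 2) + (t\<^sup>2 / 2) ^ 2 / 2 - (t\<^sup>2 / 2) ^ 3 / 6 + (t\<^sup>2 / 2) ^ 4 / 24)"
      using exp_minus_bounds(2)[of "t\<^sup>2 / 2"] by (intro mult_left_mono) auto
    ultimately show "\<exists>y. ((\<lambda>c. (1 + gauss_const * ?Q c) - scaled_erfc c) has_real_derivative y) (at t) \<and> 0 \<le> y"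
      by (intro exI conjI) auto
  qed (intro continuous_intros cont, auto)
  thus "scaled_erfc c \<le> 1 + gauss_const * ?Q c" by (simp add: scaled_erfc_0)
qed

text \<open>The exponent is \<open>0.82 * (0.76885 - 0.82 / 4)\<close>, which places the objective
  at 0.82 exactly below the upper end \<open>2 * 0.76885\<close>.\<close>

lemma scaled_erfc_82_upper: "scaled_erfc (82/100) \<le> exp (0.462357)"
proof -
  have "scaled_erfc (82/100) \<le> 1 + gauss_const * ((82/100) - (82/100) ^ 3 / 6 + (82/100) ^ 5 / 40 - (82/100) ^ 7 / 336 + (82/100) ^ 9 / 3456)"
    by (rule scaled_erfc_bounds) simp
  also have "\<dots> \<le> 1 + 0.79789 * ((82/100) - (82/100) ^ 3 / 6 + (82/100) ^ 5 / 40 - (82/100) ^ 7 / 336 + (82/100) ^ 9 / 3456)"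
    by (intro add_left_mono mult_right_mono gauss_const_bounds) (simp add: power_numeral_reduce)
  also have "\<dots> \<le> exp (0.462357)"
    by (rule order_trans[OF _ exp_bounds(1)]) (simp_all add: power_numeral_reduce)
  finally show ?thesis .
qed

text \<open>\<open>123/160 = 0.76875\<close> is the lower end of the interval around \<open>0.7688\<close>, and the lower bound
  says that \<open>tangent_gap\<close> is nonnegative. Its derivative is a positive multiple of the convex
  function \<open>gap_slope\<close>, which is positive at \<open>0\<close>, negative at \<open>0.8\<close> and positive at \<open>0.82\<close>.\<close>

definition tangent_gap where "tangent_gap c = scaled_erfc c - exp (123/160 * c - c\<^sup>2 / 4)"

definition gap_slope where "gap_slope c = gauss_const * exp (- (c\<^sup>2 / 4) - 123/160 * c) - (123/160 - c / 2)"

lemma tangent_gap_deriv: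
  assumes "c > 0"
  shows "(tangent_gap has_real_derivative exp (123/160 * c - c\<^sup>2 / 4) * gap_slope c) (at c)"
proof -
  have "((\<lambda>c. exp (123/160 * c - c\<^sup>2 / 4)) has_real_derivative exp (123/160 * c - c\<^sup>2 / 4) * (123/160 - c / 2)) (at c)"
    by (auto intro!: derivative_eq_intros)
  from DERIV_diff[OF scaled_erfc_deriv[OF assms] this]
  have "(tangent_gap has_real_derivative gauss_const * exp (- c\<^sup>2 / 2) - exp (123/160 * c - c\<^sup>2 / 4) * (123/160 - c / 2)) (at c)"
    by (simp add: tangent_gap_def[abs_def])
  moreover have "exp (- c\<^sup>2 / 2) = exp (123/160 * c - c\<^sup>2 / 4) * exp (- (c\<^sup>2 / 4) - 123/160 * c)"
    by (simp add: exp_add[symmetric])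
  ultimately show ?thesis by (simp add: gap_slope_def algebra_simps)
qed

lemma tangent_gap_continuous: "continuous_on {0..} tangent_gap"
  unfolding tangent_gap_def[abs_def] by (intro continuous_intros scaled_erfc_continuous) simp

text \<open>The second derivative is nonnegative because \<open>(123/160)\<^sup>2 \<ge> 1/2\<close>.
  The chord inequality is cleared of denominators so that it also serves to extrapolate beyond an
  end of the chord.\<close>

lemma gap_slope_convex:
  assumes "0 \<le> a" "a \<le> x" "x \<le> b"
  shows "gap_slope x * (b - a) \<le> gap_slope a * (b - x) + gap_slope b * (x - a)"
proof (cases "a = b")
  case False
  hence ab: "a < b" using assms by simp
  define k :: real where "k = 123/160"
  define e where "e c = gauss_const * exp (- (c\<^sup>2 / 4) - k * c)" for c :: real
  have gap_slope: "gap_slope = (\<lambda>c. e c - (k - c / 2))" by (simp add: fun_eq_iff gap_slope_def e_def k_def)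
  have de: "(e has_real_derivative - (c / 2 + k) * e c) (at c)" for c
    unfolding e_def[abs_def] by (auto intro!: derivative_eq_intros)
  have "convex_on {0..} gap_slope"
  proof (rule f''_ge0_imp_convex)
    fix c :: real assume c: "c \<in> {0..}"
    show "(gap_slope has_real_derivative (- (c / 2 + k) * e c + 1 / 2)) (at c)"
      unfolding gap_slope by (auto intro!: derivative_eq_intros de)
    show "((\<lambda>c. - (c / 2 + k) * e c + 1 / 2) has_real_derivative ((c / 2 + k)\<^sup>2 - 1 / 2) * e c) (at c)"
      by (auto intro!: derivative_eq_intros de simp: power2_eq_square field_simps)
    have "k\<^sup>2 \<le> (c / 2 + k)\<^sup>2" using c by (intro power_mono) (auto simp: k_def)
    moreover have "1 / 2 \<le> k\<^sup>2" by (simp add: k_def power2_eq_square)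
    ultimately have "0 \<le> (c / 2 + k)\<^sup>2 - 1 / 2" by simp
    moreover have "e c \<ge> 0" by (simp add: e_def)
    ultimately show "0 \<le> ((c / 2 + k)\<^sup>2 - 1 / 2) * e c" by (rule mult_nonneg_nonneg)
  qed simp
  hence "convex_on {a..b} gap_slope" by (rule convex_on_subset) (use assms in auto)
  hence "gap_slope x \<le> (gap_slope b - gap_slope a) / (b - a) * (x - a) + gap_slope a"
    using assms by (intro convex_onD_Icc') auto
  hence "gap_slope x * (b - a) \<le> ((gap_slope b - gap_slope a) / (b - a) * (x - a) + gap_slope a) * (b - a)"
    using ab by (intro mult_right_mono) auto
  also have "\<dots> = (gap_slope b - gap_slope a) * (x - a) + gap_slope a * (b - a)"
    using ab by (simp add: field_simps)
  finally show ?thesis by (simp add: algebra_simps)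
qed (use assms in auto)

lemma gap_slope_values:
  "gap_slope 0 \<ge> 0" "gap_slope 0 \<le> 0.0292" "gap_slope (8/10) < 0" "gap_slope (8/10) \<ge> - 0.0012" "gap_slope (82/100) > 0"
proof -
  show "gap_slope 0 \<ge> 0" "gap_slope 0 \<le> 0.0292" using gauss_const_bounds unfolding gap_slope_def by auto
  \<comment> \<open>0.775 is \<open>0.8\<^sup>2 / 4 + 123/160 * 0.8\<close>; 0.798475 below is the
    same expression at 0.82.\<close>
  have e1: "2.1705 \<le> exp (0.775 :: real)"
    by (rule order_trans[OF _ exp_bounds(1)]) (simp_all add: power_numeral_reduce)
  have e2: "exp (0.775 :: real) \<le> 2.1707"
    by (rule order_trans[OF exp_bounds(2)]) (simp_all add: power_numeral_reduce)
  have s8: "gap_slope (8/10) = gauss_const / exp 0.775 - 0.36875"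
    by (simp add: gap_slope_def power2_eq_square exp_minus field_simps)
  have "gauss_const / exp 0.775 \<le> 0.79789 / 2.1705"
    using gauss_const_bounds e1 e2 by (intro frac_le) auto
  thus "gap_slope (8/10) < 0" unfolding s8 by simp
  have "0.79788 / 2.1707 \<le> gauss_const / exp 0.775"
    using gauss_const_bounds e1 e2 by (intro frac_le) auto
  thus "gap_slope (8/10) \<ge> - 0.0012" unfolding s8 by simp
  have e': "exp (0.798475 :: real) \<le> 2.2223"
    by (rule order_trans[OF exp_bounds(2)]) (simp_all add: power_numeral_reduce)
  have s82: "gap_slope (82/100) = gauss_const / exp 0.798475 - 0.35875"
    by (simp add: gap_slope_def power2_eq_square exp_minus field_simps)
  have "0.79788 / 2.2223 \<le> gauss_const / exp 0.798475"
    using gauss_const_bounds e' by (intro frac_le) auto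
  thus "gap_slope (82/100) > 0" unfolding s82 by simp
qed

lemma tangent_gap_values: "tangent_gap (8/10) \<ge> 0.0001" "tangent_gap (82/100) \<ge> 0"
proof -
  have "1 + 0.79788 * ((8/10) - (8/10) ^ 3 / 6 + (8/10) ^ 5 / 40 - (8/10) ^ 7 / 336 + (8/10) ^ 9 / 3456 - (8/10) ^ 11 / 42240)
     \<le> 1 + gauss_const * ((8/10) - (8/10) ^ 3 / 6 + (8/10) ^ 5 / 40 - (8/10) ^ 7 / 336 + (8/10) ^ 9 / 3456 - (8/10) ^ 11 / 42240)"
    by (intro add_left_mono mult_right_mono gauss_const_bounds) (simp add: power_numeral_reduce)
  also have "\<dots> \<le> scaled_erfc (8/10)" by (rule scaled_erfc_bounds) simp
  finally have 1: "1.57628 \<le> scaled_erfc (8/10)" by (rule order_trans[rotated]) (simp add: power_numeral_reduce)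
  \<comment> \<open>0.455 is \<open>123/160 * 0.8 - 0.8\<^sup>2 / 4\<close>; 0.462275 below is the
    same expression at 0.82.\<close>
  have 2: "exp (0.455 :: real) \<le> 1.576176"
    by (rule order_trans[OF exp_bounds(2)]) (simp_all add: power_numeral_reduce)
  have "tangent_gap (8/10) = scaled_erfc (8/10) - exp 0.455" by (simp add: tangent_gap_def power2_eq_square)
  thus "tangent_gap (8/10) \<ge> 0.0001" using 1 2 by simp
  have "1 + 0.79788 * ((82/100) - (82/100) ^ 3 / 6 + (82/100) ^ 5 / 40 - (82/100) ^ 7 / 336 + (82/100) ^ 9 / 3456 - (82/100) ^ 11 / 42240)
     \<le> 1 + gauss_const * ((82/100) - (82/100) ^ 3 / 6 + (82/100) ^ 5 / 40 - (82/100) ^ 7 / 336 + (82/100) ^ 9 / 3456 - (82/100) ^ 11 / 42240)"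
    by (intro add_left_mono mult_right_mono gauss_const_bounds) (simp add: power_numeral_reduce)
  also have "\<dots> \<le> scaled_erfc (82/100)" by (rule scaled_erfc_bounds) simp
  finally have 1: "1.58777 \<le> scaled_erfc (82/100)" by (rule order_trans[rotated]) (simp add: power_numeral_reduce)
  have 2: "exp (0.462275 :: real) \<le> 1.58769"
    by (rule order_trans[OF exp_bounds(2)]) (simp_all add: power_numeral_reduce)
  have "tangent_gap (82/100) = scaled_erfc (82/100) - exp 0.462275" by (simp add: tangent_gap_def power2_eq_square)
  thus "tangent_gap (82/100) \<ge> 0" using 1 2 by simp
qed

lemma tangent_gap_mono:
  assumes "0 \<le> a" "a \<le> b" "\<And>x. \<lbrakk>a < x; x < b\<rbrakk> \<Longrightarrow> gap_slope x \<ge> 0"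
  shows "tangent_gap a \<le> tangent_gap b"
proof (rule DERIV_nonneg_imp_increasing_open[OF assms(2)])
  fix x assume x: "a < x" "x < b"
  have "0 \<le> exp (123/160 * x - x\<^sup>2 / 4) * gap_slope x" using assms(3)[OF x] by simp
  thus "\<exists>y. (tangent_gap has_real_derivative y) (at x) \<and> 0 \<le> y" using tangent_gap_deriv[of x] assms(1) x by auto
qed (rule continuous_on_subset[OF tangent_gap_continuous], use assms(1) in auto)

lemma tangent_gap_antimono:
  assumes "0 \<le> a" "a \<le> b" "\<And>x. \<lbrakk>a < x; x < b\<rbrakk> \<Longrightarrow> gap_slope x \<le> 0"
  shows "tangent_gap b \<le> tangent_gap a"
proof (rule DERIV_nonpos_imp_decreasing_open[OF assms(2)])
  fix x assume x: "a < x" "x < b"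
  have "exp (123/160 * x - x\<^sup>2 / 4) * gap_slope x \<le> 0" using assms(3)[OF x] by (simp add: mult_le_0_iff)
  thus "\<exists>y. (tangent_gap has_real_derivative y) (at x) \<and> y \<le> 0" using tangent_gap_deriv[of x] assms(1) x by auto
qed (rule continuous_on_subset[OF tangent_gap_continuous], use assms(1) in auto)

text \<open>Up to 0.8, convexity of the slope lets the gap first rise from its value 0 at the origin
  and then fall to its value at 0.8; beyond 0.82 it rises. In between it drops by at most
  \<open>0.0044 * 0.02\<close>, less than the 0.0001 available at 0.8.\<close>

lemma tangent_gap_nonneg:
  assumes "c > 0"
  shows "tangent_gap c \<ge> 0"
proof -
  consider "c \<le> 8/10" "gap_slope c \<ge> 0" | "c \<le> 8/10" "gap_slope c < 0" | "8/10 \<le> c" "c \<le> 82/100" | "82/100 \<le> c" by linarith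
  thus ?thesis
  proof cases
    case 1
    have "tangent_gap 0 \<le> tangent_gap c"
    proof (rule tangent_gap_mono)
      fix x assume x: "0 < x" "x < c"
      show "gap_slope x \<ge> 0"
      proof (rule ccontr)
        assume neg: "\<not> gap_slope x \<ge> 0"
        have "gap_slope c * (8/10 - x) \<le> gap_slope x * (8/10 - c) + gap_slope (8/10) * (c - x)"
          using x 1 by (intro gap_slope_convex) auto
        moreover have "gap_slope x * (8/10 - c) \<le> 0" using neg 1 by (intro mult_nonpos_nonneg) auto
        moreover have "gap_slope (8/10) * (c - x) < 0" using gap_slope_values x by (intro mult_neg_pos) auto
        moreover have "0 \<le> gap_slope c * (8/10 - x)" using 1 x by (intro mult_nonneg_nonneg) auto
        ultimately show False by linarith
      qed
    qed (use assms in auto)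
    thus ?thesis by (simp add: tangent_gap_def scaled_erfc_0)
  next
    case 2
    have "tangent_gap (8/10) \<le> tangent_gap c"
    proof (rule tangent_gap_antimono)
      fix x assume x: "c < x" "x < 8/10"
      have "gap_slope x * (8/10 - c) \<le> gap_slope c * (8/10 - x) + gap_slope (8/10) * (x - c)"
        using x assms by (intro gap_slope_convex) auto
      also have "\<dots> \<le> 0" using 2 x gap_slope_values by (intro add_nonpos_nonpos mult_nonpos_nonneg) auto
      finally show "gap_slope x \<le> 0" using x by (simp add: mult_le_0_iff)
    qed (use assms 2 in auto)
    thus ?thesis using tangent_gap_values by simp
  next
    case 3
    \<comment> \<open>Extrapolates the chord from 0 to 0.8: the slope is at least
      \<open>- (0.0012 * 0.82 + 0.0292 * 0.02) / 0.8\<close>.\<close>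
    have ge: "- 0.0022 \<le> gap_slope x" if x: "8/10 < x" "x < c" for x
    proof -
      have "gap_slope (8/10) * (x - 0) \<le> gap_slope 0 * (x - 8/10) + gap_slope x * (8/10 - 0)"
        using x by (intro gap_slope_convex) auto
      moreover have "gap_slope 0 * (x - 8/10) \<le> 0.0292 * (2/100)" using gap_slope_values x 3 by (intro mult_mono) auto
      moreover have "- 0.0012 * (82/100) \<le> gap_slope (8/10) * x"
      proof -
        have "- 0.0012 * (82/100) \<le> - 0.0012 * x" using x 3 by simp
        also have "\<dots> \<le> gap_slope (8/10) * x" using gap_slope_values x by (intro mult_right_mono) auto
        finally show ?thesis .
      qed
      ultimately show ?thesis by simp
    qed
    \<comment> \<open>0.0044 is 0.0022 times the bound 2 on the exponential factor of the
      derivative.\<close>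
    have "tangent_gap (8/10) + 0.0044 * (8/10) \<le> tangent_gap c + 0.0044 * c"
    proof (rule DERIV_nonneg_imp_increasing_open[OF 3(1), of "\<lambda>c. tangent_gap c + 0.0044 * c"])
      fix x assume x: "8/10 < x" "x < c"
      have "((\<lambda>c. tangent_gap c + 0.0044 * c) has_real_derivative exp (123/160 * x - x\<^sup>2 / 4) * gap_slope x + 0.0044 * 1) (at x)"
        using x by (intro DERIV_add tangent_gap_deriv DERIV_cmult DERIV_ident) auto
      moreover have "exp (123/160 * x - x\<^sup>2 / 4) \<le> 2"
      proof -
        have "123/160 * x \<le> 123/160 * (82/100)" using x 3 by (intro mult_left_mono) auto
        moreover have "(8/10)\<^sup>2 \<le> x\<^sup>2" using x by (intro power_mono) auto
        ultimately have "123/160 * x - x\<^sup>2 / 4 \<le> 1/2" by (simp add: power2_eq_square)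
        hence "exp (123/160 * x - x\<^sup>2 / 4) \<le> exp (1/2)" by simp
        also have "\<dots> \<le> 2" by (rule order_trans[OF exp_bounds(2)]) (simp_all add: power_numeral_reduce)
        finally show ?thesis .
      qed
      moreover have "exp (123/160 * x - x\<^sup>2 / 4) * gap_slope x \<ge> - 0.0044"
      proof -
        have "exp (123/160 * x - x\<^sup>2 / 4) * (- 0.0022) \<le> exp (123/160 * x - x\<^sup>2 / 4) * gap_slope x"
          using ge[OF x] by (intro mult_left_mono) auto
        thus ?thesis using \<open>exp (123/160 * x - x\<^sup>2 / 4) \<le> 2\<close> by simp
      qed
      ultimately show "\<exists>y. ((\<lambda>c. tangent_gap c + 0.0044 * c) has_real_derivative y) (at x) \<and> 0 \<le> y"
        by (intro exI conjI) auto
    qed (intro continuous_intros continuous_on_subset[OF tangent_gap_continuous], auto)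
    thus ?thesis using tangent_gap_values 3 by simp
  next
    case 4
    have "tangent_gap (82/100) \<le> tangent_gap c"
    proof (rule tangent_gap_mono)
      fix x assume x: "82/100 < x" "x < c"
      have "gap_slope (82/100) * (x - 8/10) \<le> gap_slope (8/10) * (x - 82/100) + gap_slope x * (82/100 - 8/10)"
        using x by (intro gap_slope_convex) auto
      moreover have "gap_slope (8/10) * (x - 82/100) \<le> 0" using gap_slope_values x by (intro mult_nonpos_nonneg) auto
      moreover have "0 \<le> gap_slope (82/100) * (x - 8/10)" using gap_slope_values x by (intro mult_nonneg_nonneg) auto
      ultimately show "gap_slope x \<ge> 0" by simp
    qed (use 4 in auto)
    thus ?thesis using tangent_gap_values by simp
  qed
qed

lemma xi_u_low_1_bounds: "\<bar>xi_u_low 1 / 2 - 0.7688\<bar> \<le> 0.00005"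
proof -
  have rate: "rate 1 c = c\<^sup>2 / 2 + 2 * ln (scaled_erfc c)" for c by (simp add: rate_def scaled_erfc_def)
  have E1: "scaled_erfc c \<ge> 1" if "c \<ge> 0" for c using that by (simp add: scaled_erfc_def erfc_neg_ge_1)
  have "xi_u_low 1 \<le> lifted_obj 1 (82/100)" by (rule xi_u_low_is_min(2)) auto
  also have "\<dots> = rate 1 (82/100) / (82/100)" by (simp add: lifted_obj_def lifted_expr_eq_rate)
  also have "rate 1 (82/100) \<le> (82/100)\<^sup>2 / 2 + 2 * 0.462357"
  proof -
    have "ln (scaled_erfc (82/100)) \<le> ln (exp 0.462357)"
      using scaled_erfc_82_upper E1[of "82/100"] by (subst ln_le_cancel_iff) auto
    thus ?thesis unfolding rate by simp
  qed
  finally have up: "xi_u_low 1 \<le> 2 * 0.76885" by (simp add: power2_eq_square divide_right_mono)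
  obtain c where c: "c > 0" "rate 1 c = c * xi_u_low 1" using xi_u_low_attained[of 1] by auto
  have "exp (123/160 * c - c\<^sup>2 / 4) \<le> scaled_erfc c" using tangent_gap_nonneg[OF c(1)] by (simp add: tangent_gap_def)
  hence "ln (exp (123/160 * c - c\<^sup>2 / 4)) \<le> ln (scaled_erfc c)" using E1[of c] c by (subst ln_le_cancel_iff) auto
  hence "c * (123/80) \<le> c * xi_u_low 1" using c(2) unfolding rate by simp
  hence "123/80 \<le> xi_u_low 1" using c(1) by simp
  with up show ?thesis by (intro abs_leI) simp_all
qed


section \<open>The theorem\<close>

theorem lemma8:
  fixes \<alpha> :: real
    and M :: "nat \<Rightarrow> 'a measure"
    and H :: "nat \<Rightarrow> 'a \<Rightarrow> nat \<Rightarrow> nat \<Rightarrow> real"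
  assumes "\<alpha> > 0"
    and "\<And>n. n \<in> admissible \<alpha> \<Longrightarrow> iid_std_normal_matrix (M n) (num_rows \<alpha> n) n (H n)"
  shows "(\<forall>n\<in>admissible \<alpha>.
            (\<integral>\<omega>. xi_p (num_rows \<alpha> n) n (H n \<omega>) \<partial>M n) / sqrt (real n) \<le> xi_u_low \<alpha>) \<and>
         ((\<lambda>n. \<P>(\<omega> in M n. xi_p (num_rows \<alpha> n) n (H n \<omega>) \<le> sqrt (real n) * xi_u_low \<alpha>))
            \<longlongrightarrow> 1) (inf sequentially (principal (admissible \<alpha>))) \<and>
         ((\<lambda>n. \<P>(\<omega> in M n. (xi_p (num_rows \<alpha> n) n (H n \<omega>))\<^sup>2 \<le> real n * (xi_u_low \<alpha>)\<^sup>2))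
            \<longlongrightarrow> 1) (inf sequentially (principal (admissible \<alpha>))) \<and>
         (\<alpha> = 1 \<longrightarrow>
            (\<forall>n>0. (\<integral>\<omega>. xi_p n n (H n \<omega>) \<partial>M n) / sqrt (real n) \<le> xi_u_low 1) \<and>
            \<bar>xi_u_low 1 / 2 - 0.7688\<bar> \<le> 0.00005)"
proof -
  let ?X = "\<lambda>n \<omega>. xi_p (num_rows \<alpha> n) n (H n \<omega>)"
  let ?Flt = "inf sequentially (principal (admissible \<alpha>))"
  have mean: "(\<integral>\<omega>. ?X n \<omega> \<partial>M n) / sqrt n \<le> xi_u_low \<alpha>" if "n \<in> admissible \<alpha>" for n
    using expectation_xi_p_le[OF assms(1) _ num_rows_eq(1)[OF assms(1) that] assms(2)[OF that]] that
    by (simp add: admissible_def)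
  obtain \<delta> n0 where \<delta>: "\<delta> > 0" and pr: "\<forall>n m (M :: 'a measure) H. n0 \<le> real n \<longrightarrow> 0 < n \<longrightarrow> real m = \<alpha> * real n \<longrightarrow>
     iid_std_normal_matrix M m n H \<longrightarrow>
     1 - exp (- (\<delta> * n)) \<le> \<P>(\<omega> in M. xi_p m n (H \<omega>) \<le> sqrt n * xi_u_low \<alpha>)"
    using prob_xi_p_ge[OF assms(1), where 'a = 'a] by blast
  have lim1: "((\<lambda>n. \<P>(\<omega> in M n. ?X n \<omega> \<le> sqrt (real n) * xi_u_low \<alpha>)) \<longlongrightarrow> 1) ?Flt"
  proof (rule tendsto_sandwich)
    show "\<forall>\<^sub>F n in ?Flt. 1 - exp (- (\<delta> * real n)) \<le> \<P>(\<omega> in M n. ?X n \<omega> \<le> sqrt (real n) * xi_u_low \<alpha>)"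
      unfolding eventually_inf_principal
    proof (rule eventually_sequentiallyI[of "nat \<lceil>n0\<rceil>"], rule impI)
      fix n assume n: "nat \<lceil>n0\<rceil> \<le> n" "n \<in> admissible \<alpha>"
      have "n0 \<le> real n" using n(1) by linarith
      thus "1 - exp (- (\<delta> * real n)) \<le> \<P>(\<omega> in M n. ?X n \<omega> \<le> sqrt (real n) * xi_u_low \<alpha>)"
        using pr num_rows_eq(1)[OF assms(1) n(2)] assms(2)[OF n(2)] n(2) by (auto simp: admissible_def)
    qed
    show "\<forall>\<^sub>F n in ?Flt. \<P>(\<omega> in M n. ?X n \<omega> \<le> sqrt (real n) * xi_u_low \<alpha>) \<le> 1"
      unfolding eventually_inf_principal
    proof (intro always_eventually allI impI)
      fix n assume "n \<in> admissible \<alpha>"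
      then interpret prob_space "M n" using assms(2) by (simp add: iid_std_normal_matrix_def)
      show "\<P>(\<omega> in M n. ?X n \<omega> \<le> sqrt (real n) * xi_u_low \<alpha>) \<le> 1" by simp
    qed
    have "(\<lambda>n. 1 - exp (- (\<delta> * real n))) \<longlonglongrightarrow> 1" using \<delta> by real_asymp
    thus "((\<lambda>n. 1 - exp (- (\<delta> * real n))) \<longlongrightarrow> 1) ?Flt" by (rule tendsto_mono[OF inf_le1])
  qed simp
  have u: "xi_u_low \<alpha> \<ge> 0" using xi_u_low_attained[OF assms(1)] by blast
  \<comment> \<open>Both \<open>\<xi>\<close> and the threshold are nonnegative, so the two events
    coincide for every sample point.\<close>
  have "(?X n \<omega>)\<^sup>2 \<le> real n * (xi_u_low \<alpha>)\<^sup>2 \<longleftrightarrow> ?X n \<omega> \<le> sqrt (real n) * xi_u_low \<alpha>" for n \<omega>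
  proof -
    have "real n * (xi_u_low \<alpha>)\<^sup>2 = (sqrt (real n) * xi_u_low \<alpha>)\<^sup>2" by (simp add: power_mult_distrib)
    thus ?thesis using u xi_p_nonneg by (simp add: power2_le_iff_abs_le abs_of_nonneg)
  qed
  hence lim2: "((\<lambda>n. \<P>(\<omega> in M n. (?X n \<omega>)\<^sup>2 \<le> real n * (xi_u_low \<alpha>)\<^sup>2)) \<longlongrightarrow> 1) ?Flt"
    using lim1 by simp
  \<comment> \<open>For \<open>\<alpha> = 1\<close> every positive \<open>n\<close> is admissible
    and the matrix is square.\<close>
  have "(\<integral>\<omega>. xi_p n n (H n \<omega>) \<partial>M n) / sqrt n \<le> xi_u_low 1" if "\<alpha> = 1" "n > 0" for n
    using mean[of n] that by (simp add: admissible_def num_rows_def)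
  thus ?thesis using mean lim1 lim2 xi_u_low_1_bounds by blast
qed

end
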